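(* Let $A_1,\dots,A_m\in M_n$ be Hermitian matrices, and let $k\in\{1,2,\dots,\lfloor n/2\rfloor\}$. The following are equivalent. (a) There is a non-scalar Hermitian matrix $C\in M_n$ with $\gamma(C)=k$ such that $\operatorname{conv} W_C(A_1,\dots,A_m)$ or $W_C(A_1,\dots,A_m)$ is polyhedral. (b) There exist $\ell\ge 2k$ and a unitary $U\in M_n$ such that for each $j=1,\dots,m$, $U^*A_jU=D_j\oplus Q_j$, where $D_j\in M_\ell$ is a diagonal matrix, and $W_k(A_1,\dots,A_m)=W_k(D_1,\dots,D_m)$. (c) There exist $\ell\ge 2k$ and a unitary matrix $U\in M_n$ such that for each $j=1,\dots,m$, $U^*A_jU=D_j\oplus Q_j$, where $D_j\in M_\ell$ is a diagonal matrix, and for any non-scalar Hermitian $C\in M_n$ with eigenvalues $c_1\ge\cdots\ge c_n$ and $\gamma(C)=k$, we have $$W_{(C-c_{k+1}I)}(A_1,\dots,A_m)=W_{\hat C}(D_1,\dots,D_m),$$ where $\hat C=\operatorname{diag}(c_1-c_{k+1},\dots,c_k-c_{k+1},\,c_{k+n-\ell+1}-c_{k+1},\dots,c_n-c_{k+1})\in M_\ell$. (d) $W_C(A_1,\dots,A_m)$ is polyhedral for any non-scalar Hermitian $C\in M_n$ with $\gamma(C)\le k$.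
   Context: $M_n$ is the set of $n\times n$ complex matrices. For Hermitian $C,A_1,\dots,A_m\in M_n$, the joint $C$-numerical range is $$W_C(A_1,\dots,A_m)=\{(\operatorname{tr} CU^*A_1U,\dots,\operatorname{tr} CU^*A_mU): U\in M_n \text{ unitary}\}\subseteq\mathbb{R}^m .$$ The joint $k$-numerical range $W_k(A_1,\dots,A_m)$ is $W_C(A_1,\dots,A_m)$ for $C=I_k\oplus 0_{n-k}$; the same definitions are used for matrices in $M_\ell$ (with $\ell$ in place of $n$). $\operatorname{conv}$ denotes convex hull, and a set is polyhedral if it is the convex hull of a finite set of points. For a non-scalar Hermitian $C\in M_n$ with eigenvalues $c_1\ge\cdots\ge c_n$ (so $c_1>c_n$), define $$\gamma(C)=\max\big(\{j\le n/2: c_j>c_{j+1}\}\cup\{n-j\le n/2: c_j>c_{j+1}\}\big),$$ where $j$ ranges over $1,\dots,n-1$. In (b) and (c), $\ell\le n$ and $Q_j\in M_{n-\ell}$; if $\ell=n$ the block $Q_j$ is absent. *)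

theory Defs
  imports
    "HOL-Analysis.Analysis"
    "Jordan_Normal_Form.Schur_Decomposition"
begin

unbundle no vec_syntax

definition hermitian_mat :: "nat \<Rightarrow> complex mat \<Rightarrow> bool" where
  "hermitian_mat n A \<longleftrightarrow> A \<in> carrier_mat n n \<and> mat_adjoint A = A"

definition unitary_mat :: "nat \<Rightarrow> complex mat \<Rightarrow> bool" where
  "unitary_mat n U \<longleftrightarrow> U \<in> carrier_mat n n \<and> mat_adjoint U * U = 1\<^sub>m n"

definition scalar_mat :: "nat \<Rightarrow> complex mat \<Rightarrow> bool" where
  "scalar_mat n A \<longleftrightarrow> (\<exists>a. A = a \<cdot>\<^sub>m 1\<^sub>m n)"

definition tr :: "complex mat \<Rightarrow> complex" where
  "tr A = sum_list (diag_mat A)"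

text \<open>The size of the matrices is read off from \<open>C\<close>. The membership condition equates
  real coordinates with complex traces; for Hermitian \<open>C\<close> and \<open>A j\<close> the traces are real, so
  every unitary contributes a point.\<close>

definition joint_C_range :: "complex mat \<Rightarrow> ('m::finite \<Rightarrow> complex mat) \<Rightarrow> (real ^ 'm) set" where
  "joint_C_range C A = {x. \<exists>U. unitary_mat (dim_row C) U \<and>
     (\<forall>j. complex_of_real (vec_nth x j) = tr (C * mat_adjoint U * A j * U))}"

definition joint_k_range :: "nat \<Rightarrow> nat \<Rightarrow> ('m::finite \<Rightarrow> complex mat) \<Rightarrow> (real ^ 'm) set" where
  "joint_k_range n k A = joint_C_range (diag_block_mat [1\<^sub>m k, 0\<^sub>m (n - k) (n - k)]) A"

text \<open>Eigenvalues of a Hermitian matrix, counted with algebraic multiplicity, in descending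
  order and indexed from 1. They are real, so applying \<open>Re\<close> only changes the type; the
  value is meaningful for \<open>1 \<le> j \<le> n\<close>.\<close>

definition eig :: "complex mat \<Rightarrow> nat \<Rightarrow> real" where
  "eig C j = rev (sorted_list_of_multiset (image_mset Re (proots (char_poly C)))) ! (j - 1)"

definition gamma :: "nat \<Rightarrow> complex mat \<Rightarrow> nat" where
  "gamma n C = Max
     ({j. j \<in> {1..n - 1} \<and> 2 * j \<le> n \<and> eig C j > eig C (j + 1)} \<union>
      {n - j | j. j \<in> {1..n - 1} \<and> 2 * (n - j) \<le> n \<and> eig C j > eig C (j + 1)})"

text \<open>\<open>diag(c\<^sub>1 - c\<^sub>k\<^sub>+\<^sub>1, \<dots>, c\<^sub>k - c\<^sub>k\<^sub>+\<^sub>1, c\<^sub>k\<^sub>+\<^sub>n\<^sub>-\<^sub>l\<^sub>+\<^sub>1 - c\<^sub>k\<^sub>+\<^sub>1, \<dots>, c\<^sub>n - c\<^sub>k\<^sub>+\<^sub>1)\<close>; the row index \<open>i\<close> starts at 0,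
  the eigenvalue index at 1.\<close>

definition C_hat :: "nat \<Rightarrow> nat \<Rightarrow> nat \<Rightarrow> complex mat \<Rightarrow> complex mat" where
  "C_hat n k l C = mat_diag l (\<lambda>i. complex_of_real
     ((if i < k then eig C (i + 1) else eig C (i + 1 + n - l)) - eig C (k + 1)))"

end

theory Submission
  imports Defs "Jordan_Normal_Form.Spectral_Radius"
begin

text \<open>Suppose \<open>conv W_C\<close> is a polytope, where, replacing \<open>C\<close> by \<open>-C\<close> if necessary,
  \<open>c_k > c_(k+1)\<close>. The normal cones with nonempty interior cover the space of directions \<open>v\<close>. By the
  Ky Fan inequality a vertex \<open>p\<close> yields a rank \<open>k\<close> projection \<open>P\<close> that, for every \<open>v\<close> in the cone of
  \<open>p\<close>, contains the eigenvectors of \<open>H v = \<Sum>j. v_j A_j\<close> above the \<open>k\<close>-th eigenvalue and kills those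
  below it; in particular \<open>P\<close> commutes with all \<open>A_j\<close>.

  Split off a maximal orthonormal set of \<open>l\<close> joint eigenvectors, and let \<open>F\<close> be the projection onto the
  complement. For \<open>v\<close> on the wall between two cones, \<open>H v\<close> is scalar on the range of
  \<open>(1 - P') P\<close>; since a wall spans a hyperplane, the \<open>A_j\<close> commute there, so that
  \<open>(1 - P') P F = 0\<close>. Crossing walls shows that \<open>P F\<close> is fixed by the projections of all vertices,
  those of \<open>v\<close> and \<open>-v\<close> included, and \<open>2 k \<le> n\<close> makes every \<open>H v\<close> scalar on its range. As \<open>F\<close> contains no
  joint eigenvector, \<open>P F = 0\<close>: the \<open>k\<close> largest and the \<open>k\<close> smallest eigenvalues of every \<open>H v\<close> occur
  in the diagonal block \<open>D\<close>.

  For \<open>\<gamma>(C) \<le> k\<close> the eigenvalues of \<open>C - c_(k+1) I\<close> vanish in the middle, so the support function of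
  its range only sees \<open>D\<close>; by Horn's theorem the range of the diagonal family \<open>D\<close> is the convex hull of
  finitely many points, and it is contained in the range of the \<open>A_j\<close>.\<close>

section \<open>Hermitian and unitary matrices\<close>

text \<open>The obstacle is that the projections of the vertices do jump from cone to cone: already
  a diagonal family exchanges unit vectors where two of its eigenvalues cross. What can be shown is
  that jumps involve joint eigenvectors only, which is why a maximal set of these is split off
  before walls are considered. A wall together with one further direction a spans the space. On the
  range of (1 - P') P F every H v with v in the wall is a scalar, so diagonalizing the single
  Hermitian matrix H a would produce new joint eigenvectors; hence that range is zero.

  A multiple k-th eigenvalue leaves the optimal projection for a single v undetermined. P is
  therefore fixed once per vertex and is controlled only off the k-th eigenvalue, which is all that
  the wall argument uses. That l is at least 2 k is a consequence, not a choice: otherwise the index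
  sets found for v and -v overlap and the complementary block is scalar for every v.\<close>

abbreviation adj :: "complex mat \<Rightarrow> complex mat" where
  "adj \<equiv> mat_adjoint"

abbreviation rdiag :: "nat \<Rightarrow> (nat \<Rightarrow> real) \<Rightarrow> complex mat" where
  "rdiag n b \<equiv> mat_diag n (\<lambda>i. complex_of_real (b i))"

lemma adj_dim [simp]: "dim_row (adj A) = dim_col A" "dim_col (adj A) = dim_row A"
  by (auto simp: mat_adjoint_def)

lemma adj_carrier [simp, intro]: "A \<in> carrier_mat n m \<Longrightarrow> adj A \<in> carrier_mat m n"
  by auto

lemma adj_index [simp]: "i < dim_col A \<Longrightarrow> j < dim_row A \<Longrightarrow> adj A $$ (i, j) = cnj (A $$ (j, i))"
  by (simp add: mat_adjoint_def mat_of_rows_def)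

lemma mult_index:
  assumes "A \<in> carrier_mat n m" "B \<in> carrier_mat m p" "i < n" "j < p"
  shows "(A * B) $$ (i, j) = (\<Sum>l<m. A $$ (i, l) * B $$ (l, j))"
  using assms by (auto simp: scalar_prod_def atLeast0LessThan intro!: sum.cong)

lemma adj_adj [simp]: "adj (adj A) = A"
  by (rule eq_matI) auto

lemma adj_mult:
  assumes "A \<in> carrier_mat n m" "B \<in> carrier_mat m p"
  shows "adj (A * B) = adj B * adj A"
proof (rule eq_matI)
  fix i j assume ij: "i < dim_row (adj B * adj A)" "j < dim_col (adj B * adj A)"
  then have ij': "i < p" "j < n" using assms by auto
  have "adj (A * B) $$ (i, j) = cnj ((A * B) $$ (j, i))"
    using assms ij' by (subst adj_index) auto
  also have "\<dots> = (\<Sum>l<m. cnj (A $$ (j, l)) * cnj (B $$ (l, i)))"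
    using ij' by (simp add: mult_index[OF assms])
  also have "\<dots> = (\<Sum>l<m. adj B $$ (i, l) * adj A $$ (l, j))"
    using assms ij' by (auto intro!: sum.cong)
  also have "\<dots> = (adj B * adj A) $$ (i, j)"
    using assms ij' by (subst mult_index[of _ p m _ n]) auto
  finally show "adj (A * B) $$ (i, j) = (adj B * adj A) $$ (i, j)" .
qed (use assms in auto)

lemma sq_mult: "A \<in> carrier_mat n n \<Longrightarrow> B \<in> carrier_mat n n \<Longrightarrow> A * B \<in> carrier_mat n n"
  by auto

lemma sq_assoc:
  "A \<in> carrier_mat n n \<Longrightarrow> B \<in> carrier_mat n n \<Longrightarrow> C \<in> carrier_mat n n \<Longrightarrow>
    A * B * C = A * (B * C)"
  by (rule assoc_mult_mat)

lemma adj_one [simp]: "adj (1\<^sub>m n) = 1\<^sub>m n"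
  by (rule eq_matI) auto

lemma adj_rdiag [simp]: "adj (rdiag n b) = rdiag n b"
  by (rule eq_matI) (auto simp: mat_diag_def)

lemma hermitianD:
  assumes "hermitian_mat n A"
  shows "A \<in> carrier_mat n n" "adj A = A"
    "\<And>i j. i < n \<Longrightarrow> j < n \<Longrightarrow> A $$ (j, i) = cnj (A $$ (i, j))"
proof -
  show A: "A \<in> carrier_mat n n" "adj A = A" using assms by (auto simp: hermitian_mat_def)
  show "A $$ (j, i) = cnj (A $$ (i, j))" if "i < n" "j < n" for i j
    using A adj_index[of j A i] that by auto
qed

lemma hermitian_diag_real:
  assumes "hermitian_mat n A" "i < n"
  shows "complex_of_real (Re (A $$ (i, i))) = A $$ (i, i)"
  using hermitianD(3)[OF assms(1) assms(2) assms(2)] by (simp add: complex_eq_iff)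

lemma hermitianI:
  assumes "A \<in> carrier_mat n n" "\<And>i j. i < n \<Longrightarrow> j < n \<Longrightarrow> A $$ (j, i) = cnj (A $$ (i, j))"
  shows "hermitian_mat n A"
proof -
  have "adj A = A"
  proof (rule eq_matI)
    fix i j assume "i < dim_row A" "j < dim_col A"
    then show "adj A $$ (i, j) = A $$ (i, j)"
      using assms(1) assms(2)[of j i] by (subst adj_index) auto
  qed (use assms(1) in auto)
  then show ?thesis using assms(1) by (simp add: hermitian_mat_def)
qed

lemma hermitian_rdiag [simp]: "hermitian_mat n (rdiag n b)"
  by (simp add: hermitian_mat_def)

lemma unitaryD:
  assumes "unitary_mat n U"
  shows "U \<in> carrier_mat n n" "adj U * U = 1\<^sub>m n" "U * adj U = 1\<^sub>m n"
  using assms mat_mult_left_right_inverse[of "adj U" n U] by (auto simp: unitary_mat_def)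

lemma unitary_one [simp]: "unitary_mat n (1\<^sub>m n)"
  by (simp add: unitary_mat_def)

lemma unitary_adj [simp]:
  assumes "unitary_mat n U"
  shows "unitary_mat n (adj U)"
  using unitaryD(1,3)[OF assms] by (simp add: unitary_mat_def)

lemma unitary_mult:
  assumes "unitary_mat n U" "unitary_mat n V"
  shows "unitary_mat n (U * V)"
proof -
  note U = unitaryD[OF assms(1)] and V = unitaryD[OF assms(2)]
  have "adj (U * V) * (U * V) = adj V * (adj U * U) * V"
    using U(1) V(1)
    by (simp add: adj_mult[of _ n n _ n] sq_assoc[where n = n] sq_mult[where n = n])
  then show ?thesis using U V by (simp add: unitary_mat_def)
qed

lemma unitary_cancel:
  assumes "unitary_mat n U" "M \<in> carrier_mat n m"
  shows "adj U * (U * M) = M" "U * (adj U * M) = M"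
  using unitaryD[OF assms(1)] assms(2) assoc_mult_mat[of "adj U" n n U n M m]
    assoc_mult_mat[of U n n "adj U" n M m]
  by auto

lemma hermitian_conj:
  assumes "hermitian_mat n A" "U \<in> carrier_mat n m"
  shows "hermitian_mat m (adj U * A * U)"
proof -
  note A = hermitianD[OF assms(1)]
  have "adj (adj U * A * U) = adj U * A * U"
    using A(1,2) assms(2) adj_mult[of "adj U * A" m n U m] adj_mult[of "adj U" m n A n]
      assoc_mult_mat[of "adj U" m n A n U m] mult_carrier_mat[of "adj U" m n A n] by simp
  then show ?thesis using A assms(2) by (auto simp: hermitian_mat_def)
qed

lemma conj_mult:
  assumes "A \<in> carrier_mat n n" "U \<in> carrier_mat n n" "V \<in> carrier_mat n n"
  shows "adj (U * V) * A * (U * V) = adj V * (adj U * A * U) * V"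
  using assms
  by (simp add: adj_mult[of _ n n _ n] sq_assoc[where n = n] sq_mult[where n = n])

lemma conj_cancel:
  assumes "A \<in> carrier_mat n n" "unitary_mat n U"
  shows "U * (adj U * A * U) * adj U = A" "adj U * (U * A * adj U) * U = A"
proof -
  note U = unitaryD[OF assms(2)]
  have "U * (adj U * A * U) * adj U = (U * adj U) * A * (U * adj U)"
    "adj U * (U * A * adj U) * U = (adj U * U) * A * (adj U * U)"
    using U(1) assms(1) by (simp_all add: sq_assoc[where n = n] sq_mult[where n = n])
  then show "U * (adj U * A * U) * adj U = A" "adj U * (U * A * adj U) * U = A"
    using U assms(1) by simp_all
qed

lemma tr_sum: "A \<in> carrier_mat n n \<Longrightarrow> tr A = (\<Sum>i<n. A $$ (i, i))"
  by (auto simp: tr_def diag_mat_def sum_list_sum_nth atLeast0LessThan)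

lemma tr_mult_comm:
  assumes "A \<in> carrier_mat n m" "B \<in> carrier_mat m n"
  shows "tr (A * B) = tr (B * A)"
proof -
  have AB: "A * B \<in> carrier_mat n n" "B * A \<in> carrier_mat m m" using assms by auto
  have "tr (A * B) = (\<Sum>i<n. \<Sum>l<m. A $$ (i, l) * B $$ (l, i))"
    using AB(1) by (auto simp: tr_sum mult_index[OF assms] intro!: sum.cong)
  also have "\<dots> = (\<Sum>l<m. \<Sum>i<n. B $$ (l, i) * A $$ (i, l))"
    by (subst sum.swap) (simp add: mult.commute)
  also have "\<dots> = tr (B * A)"
    using AB(2) by (auto simp: tr_sum mult_index[OF assms(2,1)] intro!: sum.cong)
  finally show ?thesis .
qed

lemma unitary_sums:
  assumes "unitary_mat n U" "i < n" "j < n"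
  shows "(\<Sum>l<n. cnj (U $$ (l, i)) * U $$ (l, j)) = (if i = j then 1 else 0)"
    "(\<Sum>l<n. U $$ (i, l) * cnj (U $$ (j, l))) = (if i = j then 1 else 0)"
proof -
  note U = unitaryD[OF assms(1)]
  have "(adj U * U) $$ (i, j) = (\<Sum>l<n. cnj (U $$ (l, i)) * U $$ (l, j))"
    using U(1) assms by (subst mult_index[of _ n n _ n]) (auto intro!: sum.cong)
  then show "(\<Sum>l<n. cnj (U $$ (l, i)) * U $$ (l, j)) = (if i = j then 1 else 0)"
    using U assms by simp
  have "(U * adj U) $$ (i, j) = (\<Sum>l<n. U $$ (i, l) * cnj (U $$ (j, l)))"
    using U(1) assms by (subst mult_index[of _ n n _ n]) (auto intro!: sum.cong)
  then show "(\<Sum>l<n. U $$ (i, l) * cnj (U $$ (j, l))) = (if i = j then 1 else 0)"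
    using U assms by simp
qed

lemma unitaryI:
  assumes "U \<in> carrier_mat n n"
    "\<And>i j. i < n \<Longrightarrow> j < n \<Longrightarrow> (\<Sum>l<n. cnj (U $$ (l, i)) * U $$ (l, j)) = (if i = j then 1 else 0)"
  shows "unitary_mat n U"
proof -
  have "adj U * U = 1\<^sub>m n"
  proof (rule eq_matI)
    fix i j assume "i < dim_row (1\<^sub>m n :: complex mat)" "j < dim_col (1\<^sub>m n :: complex mat)"
    then have ij: "i < n" "j < n" by auto
    have "(adj U * U) $$ (i, j) = (\<Sum>l<n. adj U $$ (i, l) * U $$ (l, j))"
      using assms(1) ij by (intro mult_index) auto
    also have "\<dots> = (\<Sum>l<n. cnj (U $$ (l, i)) * U $$ (l, j))"
      using assms(1) ij by (intro sum.cong) auto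
    finally show "(adj U * U) $$ (i, j) = 1\<^sub>m n $$ (i, j)" using assms(2)[OF ij] ij by simp
  qed (use assms(1) in auto)
  then show ?thesis using assms(1) by (simp add: unitary_mat_def)
qed

lemma conj_index:
  assumes "A \<in> carrier_mat n n" "U \<in> carrier_mat n m" "i < m" "j < m"
  shows "(adj U * A * U) $$ (i, j)
    = (\<Sum>p<n. \<Sum>q<n. cnj (U $$ (p, i)) * A $$ (p, q) * U $$ (q, j))"
proof -
  have "(adj U * A * U) $$ (i, j) = (\<Sum>q<n. (adj U * A) $$ (i, q) * U $$ (q, j))"
    using assms by (intro mult_index) auto
  also have "\<dots> = (\<Sum>q<n. (\<Sum>p<n. adj U $$ (i, p) * A $$ (p, q)) * U $$ (q, j))"
  proof (rule sum.cong)
    fix q assume "q \<in> {..<n}"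
    then have q: "q < n" by simp
    show "(adj U * A) $$ (i, q) * U $$ (q, j) = (\<Sum>p<n. adj U $$ (i, p) * A $$ (p, q)) * U $$ (q, j)"
      by (subst mult_index[OF adj_carrier[OF assms(2)] assms(1) assms(3) q]) simp
  qed simp
  also have "\<dots> = (\<Sum>q<n. \<Sum>p<n. cnj (U $$ (p, i)) * A $$ (p, q) * U $$ (q, j))"
    using assms by (auto simp: sum_distrib_right intro!: sum.cong)
  finally show ?thesis by (subst sum.swap) simp
qed

lemma rdiag_conj_index:
  assumes "X \<in> carrier_mat n m" "i < m" "j < m"
  shows "(adj X * rdiag n b * X) $$ (i, j) = (\<Sum>l<n. b l * (cnj (X $$ (l, i)) * X $$ (l, j)))"
proof -
  have "(adj X * rdiag n b * X) $$ (i, j)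
    = (\<Sum>p<n. \<Sum>q<n. if p = q then b p * (cnj (X $$ (p, i)) * X $$ (p, j)) else 0)"
    using assms(2,3) unfolding conj_index[OF mat_diag_dim assms]
    by (intro sum.cong refl) (auto simp: mat_diag_def)
  also have "\<dots> = (\<Sum>l<n. b l * (cnj (X $$ (l, i)) * X $$ (l, j)))"
    by (intro sum.cong) (auto simp: if_distrib cong: if_cong)
  finally show ?thesis .
qed

section \<open>Joint diagonalization and the spectral theorem\<close>

text \<open>Only the first \<open>l\<close> columns are constrained: they say that the first
  \<open>l\<close> unit vectors are eigenvectors. For Hermitian matrices the rows follow
  (\<open>hermitian_diag_upto_row\<close>).\<close>

definition diag_upto :: "nat \<Rightarrow> nat \<Rightarrow> complex mat \<Rightarrow> bool" where
  "diag_upto n l B \<longleftrightarrow> (\<forall>i<n. \<forall>t<l. i \<noteq> t \<longrightarrow> B $$ (i, t) = 0)"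

definition joint_ev :: "nat \<Rightarrow> nat \<Rightarrow> ('m \<Rightarrow> complex mat) \<Rightarrow> complex vec \<Rightarrow> bool" where
  "joint_ev n l B x \<longleftrightarrow> x \<in> carrier_vec n \<and> x \<noteq> 0\<^sub>v n \<and> (\<forall>i<l. x $ i = 0) \<and>
     (\<forall>j. \<exists>a. B j *\<^sub>v x = a \<cdot>\<^sub>v x)"

text \<open>The reflection I - 2 w w^H / |w|^2 with w = x + \<open>ph\<close> e_l sends e_l to a
  multiple of x. Taking \<open>ph\<close> as the phase of x_l prevents cancellation, so that |w|^2 =
  2 \<open>r\<close> with \<open>r\<close> at least 1. The vectors e_t with t < l are fixed because
  w vanishes there.\<close>

lemma householder_unitary:
  fixes x :: "nat \<Rightarrow> complex"
  assumes norm: "(\<Sum>i<n. (cmod (x i))\<^sup>2) = 1" and l: "l < n" and x0: "\<And>i. i < l \<Longrightarrow> x i = 0"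
  obtains V s where "unitary_mat n V" "\<And>i. i < n \<Longrightarrow> V $$ (i, l) = s * x i"
    "\<And>i t. i < n \<Longrightarrow> t < l \<Longrightarrow> V $$ (i, t) = (if i = t then 1 else 0)"
proof -
  define ph where "ph = (if x l = 0 then 1 else x l / cmod (x l))"
  have ph: "cmod ph = 1" "x l = cmod (x l) * ph" by (auto simp: ph_def norm_divide)
  then have phc: "ph * cnj ph = 1" by (simp add: complex_norm_square[symmetric])
  define w where "w i = x i + (if i = l then ph else 0)" for i
  define r where "r = 1 + cmod (x l)"
  have r: "r > 0" by (simp add: r_def add_pos_nonneg)
  have wl: "w l = r * ph" using ph(2) by (simp add: w_def r_def algebra_simps)
  have "(\<Sum>i<n. (cmod (w i))\<^sup>2) = (\<Sum>i<n. (cmod (x i))\<^sup>2 + (if i = l then 1 + 2 * cmod (x l) else 0))"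
  proof (rule sum.cong[OF refl])
    fix i
    have "cmod (w l) = r" unfolding wl norm_mult norm_of_real using ph(1) r by simp
    then have "(cmod (w l))\<^sup>2 = (1 + cmod (x l))\<^sup>2" by (simp add: r_def)
    then show "(cmod (w i))\<^sup>2 = (cmod (x i))\<^sup>2 + (if i = l then 1 + 2 * cmod (x l) else 0)"
      by (auto simp: w_def power2_eq_square algebra_simps)
  qed
  then have w_norm: "(\<Sum>i<n. (cmod (w i))\<^sup>2) = 2 * r"
    using norm l by (simp add: sum.distrib r_def)
  then have w_norm': "(\<Sum>p<n. w p * cnj (w p)) = 2 * r"
    by (simp add: complex_norm_square[symmetric] flip: of_real_sum of_real_power)
  define V where "V = Matrix.mat n n (\<lambda>(i, j). (if i = j then 1 else 0) - w i * cnj (w j) / r)"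
  have V: "V \<in> carrier_mat n n" by (simp add: V_def)
  have "unitary_mat n V"
  proof (rule unitaryI[OF V])
    fix i j assume ij: "i < n" "j < n"
    have "(\<Sum>p<n. cnj (V $$ (p, i)) * V $$ (p, j))
      = (\<Sum>p<n. (if p = i then (if i = j then 1 else 0) - w i * cnj (w j) / r else 0)
          - (if p = j then cnj (w j) * w i / r else 0)
          + w p * cnj (w p) * (w i * cnj (w j) / (r * r)))"
      using ij by (intro sum.cong refl) (auto simp: V_def algebra_simps)
    also have "\<dots> = (if i = j then 1 else 0) - w i * cnj (w j) / r - cnj (w j) * w i / r
      + (\<Sum>p<n. w p * cnj (w p)) * (w i * cnj (w j) / (r * r))"
      using ij by (simp add: sum.distrib sum_subtractf sum_distrib_right sum_divide_distrib)
    also have "\<dots> = (if i = j then 1 else 0)"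
      unfolding w_norm' using r by (simp add: field_simps)
    finally show "(\<Sum>p<n. cnj (V $$ (p, i)) * V $$ (p, j)) = (if i = j then 1 else 0)" .
  qed
  moreover have "V $$ (i, l) = - cnj ph * x i" if "i < n" for i
  proof -
    have "V $$ (i, l) = (if i = l then 1 else 0) - w i * cnj ph"
      using that l r wl by (simp add: V_def)
    then show ?thesis using phc by (cases "i = l") (auto simp: w_def algebra_simps)
  qed
  moreover have "V $$ (i, t) = (if i = t then 1 else 0)" if "i < n" "t < l" for i t
    using that l x0[of t] by (simp add: V_def w_def)
  ultimately show ?thesis using that by blast
qed

lemma conj_eigencolumn:
  assumes U: "unitary_mat n V" and B: "B \<in> carrier_mat n n" and "t < n" "i < n"
    and ev: "\<And>i. i < n \<Longrightarrow> (B * V) $$ (i, t) = a * V $$ (i, t)"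
  shows "(adj V * B * V) $$ (i, t) = (if i = t then a else 0)"
proof -
  note V = unitaryD[OF U]
  have "(adj V * B * V) $$ (i, t) = (adj V * (B * V)) $$ (i, t)"
    using V B by (simp add: sq_assoc[where n = n])
  also have "\<dots> = (\<Sum>l<n. adj V $$ (i, l) * (B * V) $$ (l, t))"
    using V B assms by (intro mult_index) auto
  also have "\<dots> = (\<Sum>l<n. a * (cnj (V $$ (l, i)) * V $$ (l, t)))"
    using V(1) assms by (intro sum.cong) auto
  also have "\<dots> = a * (if i = t then 1 else 0)"
    unfolding sum_distrib_left[symmetric] unitary_sums(1)[OF U assms(4,3)] ..
  finally show ?thesis by simp
qed

lemma mult_vec_index:
  assumes "B \<in> carrier_mat n n" "x \<in> carrier_vec n" "i < n"
  shows "(B *\<^sub>v x) $ i = (\<Sum>p<n. B $$ (i, p) * x $ p)"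
  using assms by (auto simp: scalar_prod_def atLeast0LessThan intro!: sum.cong)

text \<open>The normalized joint eigenvector becomes column \<open>l\<close> of a Householder matrix
  whose earlier columns are the unit vectors already split off, so that all columns up to
  \<open>l\<close> are joint eigenvectors.\<close>

lemma joint_ev_step:
  fixes B :: "'m \<Rightarrow> complex mat"
  assumes B: "\<And>j. B j \<in> carrier_mat n n" and dg: "\<And>j. diag_upto n l (B j)"
    and ev: "joint_ev n l B x"
  obtains V where "l < n" "unitary_mat n V" "\<And>j. diag_upto n (Suc l) (adj V * B j * V)"
    "\<And>i t. i < n \<Longrightarrow> t < l \<Longrightarrow> V $$ (i, t) = (if i = t then 1 else 0)"
proof -
  from ev have x: "x \<in> carrier_vec n" "x \<noteq> 0\<^sub>v n" "\<And>i. i < l \<Longrightarrow> x $ i = 0"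
    and ex: "\<And>j. \<exists>a. B j *\<^sub>v x = a \<cdot>\<^sub>v x" by (auto simp: joint_ev_def)
  from x obtain i0 where i0: "i0 < n" "x $ i0 \<noteq> 0"
    by (metis carrier_vecD eq_vecI index_zero_vec)
  then have ln: "l < n" using x(3)[of i0] by (cases "i0 < l") auto
  define N where "N = (\<Sum>i<n. (cmod (x $ i))\<^sup>2)"
  have N: "N > 0"
    unfolding N_def using i0 by (intro sum_pos2[where i = i0]) auto
  define z where "z i = x $ i / sqrt N" for i
  have "(\<Sum>i<n. (cmod (z i))\<^sup>2) = (\<Sum>i<n. (cmod (x $ i))\<^sup>2) / N"
    using N by (simp add: z_def norm_divide power_divide sum_divide_distrib)
  then have "(\<Sum>i<n. (cmod (z i))\<^sup>2) = 1" using N by (simp add: N_def)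
  moreover have "\<And>i. i < l \<Longrightarrow> z i = 0" by (simp add: z_def x)
  ultimately obtain V s where V: "unitary_mat n V" and Vl: "\<And>i. i < n \<Longrightarrow> V $$ (i, l) = s * z i"
    and Vt: "\<And>i t. i < n \<Longrightarrow> t < l \<Longrightarrow> V $$ (i, t) = (if i = t then 1 else 0)"
    using householder_unitary[where x = z and n = n and l = l] ln by metis
  have Vc: "V \<in> carrier_mat n n" using unitaryD[OF V] by auto
  have "diag_upto n (Suc l) (adj V * B j * V)" for j
  proof -
    have "\<exists>a. \<forall>i<n. (B j * V) $$ (i, t) = a * V $$ (i, t)" if t: "t < Suc l" for t
    proof (cases "t = l")
      case True
      obtain a where a: "B j *\<^sub>v x = a \<cdot>\<^sub>v x" using ex by blast
      have "(B j * V) $$ (i, l) = a * V $$ (i, l)" if i: "i < n" for i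
      proof -
        have "(B j * V) $$ (i, l) = (\<Sum>p<n. B j $$ (i, p) * V $$ (p, l))"
          using B Vc i ln by (intro mult_index) auto
        also have "\<dots> = (\<Sum>p<n. B j $$ (i, p) * x $ p) * (s / sqrt N)"
          unfolding sum_distrib_right by (intro sum.cong refl) (simp add: Vl z_def)
        also have "\<dots> = (a \<cdot>\<^sub>v x) $ i * (s / sqrt N)"
          using mult_vec_index[OF B x(1) i, of j] a by simp
        finally show ?thesis using i x(1) Vl[OF i] by (simp add: z_def)
      qed
      then show ?thesis using True by auto
    next
      case False
      then have t: "t < l" using that by simp
      then have tn: "t < n" using ln by simp
      have "(B j * V) $$ (i, t) = B j $$ (t, t) * V $$ (i, t)" if i: "i < n" for i
      proof -
        have "(B j * V) $$ (i, t) = (\<Sum>p<n. B j $$ (i, p) * V $$ (p, t))"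
          using B Vc i tn by (intro mult_index) auto
        also have "\<dots> = (\<Sum>p<n. if p = t then B j $$ (i, t) else 0)"
          using t by (intro sum.cong refl) (simp add: Vt)
        also have "\<dots> = B j $$ (i, t)" using tn by simp
        finally show ?thesis using dg[of j] i t by (simp add: Vt diag_upto_def)
      qed
      then show ?thesis by blast
    qed
    then obtain a where a: "\<And>t i. t < Suc l \<Longrightarrow> i < n \<Longrightarrow> (B j * V) $$ (i, t) = a t * V $$ (i, t)"
      by metis
    show ?thesis unfolding diag_upto_def
    proof (intro allI impI)
      fix i t assume it: "i < n" "t < Suc l" "i \<noteq> t"
      then have "t < n" using ln by simp
      from conj_eigencolumn[OF V B this it(1) a[OF it(2)]] it(3)
      show "(adj V * B j * V) $$ (i, t) = 0" by simp
    qed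
  qed
  then show ?thesis using that ln V Vt by blast
qed

text \<open>Column \<open>i\<close> is orthogonal to column \<open>t\<close>, which is a unit
  vector; hence it vanishes in row \<open>t\<close> unless \<open>i = t\<close>.\<close>

lemma fixed_columns_adj:
  assumes V: "unitary_mat n V" and l: "l \<le> n"
    and Vt: "\<And>i t. i < n \<Longrightarrow> t < l \<Longrightarrow> V $$ (i, t) = (if i = t then 1 else 0)"
    and "i < n" "t < l"
  shows "V $$ (t, i) = (if i = t then 1 else 0)"
proof -
  note VD = unitaryD[OF V]
  have "(if t = i then 1 else 0) = (\<Sum>p<n. cnj (V $$ (p, t)) * V $$ (p, i))"
    using unitary_sums(1)[OF V, of t i] assms by simp
  also have "\<dots> = (\<Sum>p<n. if p = t then V $$ (t, i) else 0)"
    using assms by (intro sum.cong refl) (simp add: Vt)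
  also have "\<dots> = V $$ (t, i)" using assms by simp
  finally show ?thesis by auto
qed

text \<open>\<open>l\<close> is chosen greatest, so a remaining joint eigenvector would contradict
  \<open>joint_ev_step\<close>. With \<open>l0 = 0\<close> joint eigenvectors are split off from
  scratch; for a family of one matrix this yields a spectral theorem that respects a given diagonal
  block.\<close>

lemma joint_diag:
  fixes B :: "'m \<Rightarrow> complex mat"
  assumes B: "\<And>j. B j \<in> carrier_mat n n" and dg: "\<And>j. diag_upto n l0 (B j)" and l0: "l0 \<le> n"
  obtains l V where "l0 \<le> l" "l \<le> n" "unitary_mat n V" "\<And>j. diag_upto n l (adj V * B j * V)"
    "\<And>i t. i < n \<Longrightarrow> t < l0 \<Longrightarrow> V $$ (i, t) = (if i = t then 1 else 0)"
    "\<And>x. \<not> joint_ev n l (\<lambda>j. adj V * B j * V) x"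
proof -
  define G where "G l \<longleftrightarrow> l0 \<le> l \<and> l \<le> n \<and> (\<exists>V. unitary_mat n V \<and> (\<forall>j. diag_upto n l (adj V * B j * V)) \<and>
    (\<forall>i<n. \<forall>t<l0. V $$ (i, t) = (if i = t then 1 else 0)))" for l
  have "adj (1\<^sub>m n) * B j * 1\<^sub>m n = B j" for j
    using left_mult_one_mat[OF B, of j] right_mult_one_mat[OF B, of j] by simp
  then have "G l0" unfolding G_def using l0 dg by (auto intro!: exI[of _ "1\<^sub>m n"])
  moreover have "\<forall>l. G l \<longrightarrow> l \<le> n" by (simp add: G_def)
  ultimately obtain l where Gl: "G l" and max: "\<And>l'. G l' \<Longrightarrow> l' \<le> l"
    by (metis GreatestI_nat Greatest_le_nat)
  from Gl obtain V where l: "l0 \<le> l" "l \<le> n" and V: "unitary_mat n V"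
    and dV: "\<And>j. diag_upto n l (adj V * B j * V)"
    and Vt: "\<And>i t. i < n \<Longrightarrow> t < l0 \<Longrightarrow> V $$ (i, t) = (if i = t then 1 else 0)"
    unfolding G_def by blast
  note VD = unitaryD[OF V]
  have "\<not> joint_ev n l (\<lambda>j. adj V * B j * V) x" for x
  proof
    assume ev: "joint_ev n l (\<lambda>j. adj V * B j * V) x"
    have BV: "adj V * B j * V \<in> carrier_mat n n" for j using VD(1) B[of j] by auto
    obtain W where W: "l < n" "unitary_mat n W"
      "\<And>j. diag_upto n (Suc l) (adj W * (adj V * B j * V) * W)"
      "\<And>i t. i < n \<Longrightarrow> t < l \<Longrightarrow> W $$ (i, t) = (if i = t then 1 else 0)"
      using joint_ev_step[OF BV dV ev] by blast
    note WD = unitaryD[OF W(2)]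
    have "(V * W) $$ (i, t) = (if i = t then 1 else 0)" if "i < n" "t < l0" for i t
    proof -
      have "(V * W) $$ (i, t) = (\<Sum>p<n. V $$ (i, p) * W $$ (p, t))"
        using that VD(1) WD(1) l by (intro mult_index[of _ n n _ n]) auto
      also have "\<dots> = (\<Sum>p<n. if p = t then V $$ (i, t) else 0)"
        using that l by (intro sum.cong refl) (auto simp: W(4))
      finally show ?thesis using that l Vt by simp
    qed
    moreover have "diag_upto n (Suc l) (adj (V * W) * B j * (V * W))" for j
      using W(3)[of j] conj_mult[OF B VD(1) WD(1), of j] by simp
    ultimately have "G (Suc l)"
      unfolding G_def using l W(1) unitary_mult[OF V W(2)] by (auto intro!: exI[of _ "V * W"])
    then show False using max[of "Suc l"] by simp
  qed
  then show ?thesis using that l V dV Vt by blast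
qed

lemma hermitian_diag_upto_row:
  assumes "hermitian_mat n B" "diag_upto n l B" "l \<le> n" "i < n" "t < l" "i \<noteq> t"
  shows "B $$ (t, i) = 0"
  using assms hermitianD(3)[OF assms(1), of i t] by (simp add: diag_upto_def)

text \<open>An eigenvector of the complementary block, padded with zeros, is an eigenvector of
  \<open>B\<close>, since Hermitian symmetry clears the entries above that block. The index type
  \<open>unit\<close> lets a single matrix use the notions for families.\<close>

lemma lower_block_eigenvector:
  assumes B: "hermitian_mat n B" and dg: "diag_upto n l B" and l: "l < n"
  shows "\<exists>x. joint_ev n l (\<lambda>_::unit. B) x"
proof -
  define Q where "Q = Matrix.mat (n - l) (n - l) (\<lambda>(i, j). B $$ (i + l, j + l))"
  have Q: "Q \<in> carrier_mat (n - l) (n - l)" by (simp add: Q_def)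
  have Bc: "B \<in> carrier_mat n n" using hermitianD[OF B] by auto
  obtain a y where "eigenvector Q y a"
    using spectrum_non_empty[OF Q] l by (auto simp: spectrum_def eigenvalue_def)
  then have y: "y \<in> carrier_vec (n - l)" "y \<noteq> 0\<^sub>v (n - l)" "Q *\<^sub>v y = a \<cdot>\<^sub>v y"
    using Q by (auto simp: eigenvector_def)
  define x where "x = Matrix.vec n (\<lambda>i. if i < l then 0 else y $ (i - l))"
  have x: "x \<in> carrier_vec n" by (simp add: x_def)
  have "x \<noteq> 0\<^sub>v n"
  proof
    assume x0: "x = 0\<^sub>v n"
    have "y $ i = 0" if "i < n - l" for i
    proof -
      have "x $ (i + l) = 0" using x0 that by simp
      then show ?thesis using that by (simp add: x_def)
    qed
    then have "y = 0\<^sub>v (n - l)" using y(1) by (intro eq_vecI) auto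
    then show False using y by simp
  qed
  moreover have "B *\<^sub>v x = a \<cdot>\<^sub>v x"
  proof (rule eq_vecI)
    fix i assume "i < dim_vec (a \<cdot>\<^sub>v x)"
    then have i: "i < n" by (simp add: x_def)
    have sp: "{..<n} = {..<l} \<union> (\<lambda>p. p + l) ` {..<n - l}"
    proof -
      have "i \<in> (\<lambda>p. p + l) ` {..<n - l}" if "i < n" "\<not> i < l" for i
        using that l by (intro image_eqI[of _ _ "i - l"]) auto
      then show ?thesis using l by auto
    qed
    have "(B *\<^sub>v x) $ i = (\<Sum>p<n. B $$ (i, p) * x $ p)" by (rule mult_vec_index[OF Bc x i])
    also have "\<dots> = (\<Sum>p<l. B $$ (i, p) * x $ p) + (\<Sum>p\<in>(\<lambda>p. p + l) ` {..<n - l}. B $$ (i, p) * x $ p)"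
      unfolding sp by (rule sum.union_disjoint) auto
    also have "(\<Sum>p<l. B $$ (i, p) * x $ p) = 0" using l by (simp add: x_def)
    also have "(\<Sum>p\<in>(\<lambda>p. p + l) ` {..<n - l}. B $$ (i, p) * x $ p) = (\<Sum>p<n - l. B $$ (i, p + l) * y $ p)"
      using l by (subst sum.reindex) (auto simp: x_def inj_on_def intro!: sum.cong)
    finally have eq: "(B *\<^sub>v x) $ i = (\<Sum>p<n - l. B $$ (i, p + l) * y $ p)" by simp
    show "(B *\<^sub>v x) $ i = (a \<cdot>\<^sub>v x) $ i"
    proof (cases "i < l")
      case True
      have "B $$ (i, p + l) = 0" if "p < n - l" for p
        using hermitian_diag_upto_row[OF B dg, of "p + l" i] True that l by auto
      then show ?thesis unfolding eq using True i by (simp add: x_def)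
    next
      case False
      have "(\<Sum>p<n - l. B $$ (i, p + l) * y $ p) = (Q *\<^sub>v y) $ (i - l)"
        using False i by (subst mult_vec_index[OF Q y(1)]) (auto simp: Q_def)
      then show ?thesis unfolding eq y(3) using False i y(1) by (simp add: x_def)
    qed
  qed (use Bc in \<open>auto simp: x_def\<close>)
  ultimately show ?thesis using x l by (auto simp: joint_ev_def x_def intro!: exI[of _ x])
qed

definition diagonalizes :: "nat \<Rightarrow> complex mat \<Rightarrow> complex mat \<Rightarrow> (nat \<Rightarrow> real) \<Rightarrow> bool" where
  "diagonalizes n Y H b \<longleftrightarrow>
     unitary_mat n Y \<and> H \<in> carrier_mat n n \<and> adj Y * H * Y = rdiag n b"

text \<open>For one Hermitian matrix the maximal number from \<open>joint_diag\<close> is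
  \<open>n\<close>, as a proper complementary block has an eigenvector. Keeping the first
  \<open>l\<close> coordinates makes \<open>b\<close> agree there with the diagonal of
  \<open>H\<close>; the remaining columns diagonalize the complementary block.\<close>

lemma spectral_fixing:
  assumes H: "hermitian_mat n H" and dg: "diag_upto n l H" and l: "l \<le> n"
  obtains V b where "diagonalizes n V H b"
    "\<And>i t. i < n \<Longrightarrow> t < l \<Longrightarrow> V $$ (i, t) = (if i = t then 1 else 0)"
proof -
  have Hc: "H \<in> carrier_mat n n" using hermitianD[OF H] by auto
  obtain l' V where V: "l' \<le> n" "unitary_mat n V" "diag_upto n l' (adj V * H * V)"
    "\<And>i t. i < n \<Longrightarrow> t < l \<Longrightarrow> V $$ (i, t) = (if i = t then 1 else 0)"
    and nev: "\<And>x. \<not> joint_ev n l' (\<lambda>_::unit. adj V * H * V) x"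
    using joint_diag[of "\<lambda>_::unit. H" n l] Hc dg l by metis
  note VD = unitaryD[OF V(2)]
  have herm: "hermitian_mat n (adj V * H * V)" by (rule hermitian_conj[OF H VD(1)])
  have "l' = n"
  proof (rule ccontr)
    assume "l' \<noteq> n"
    then have "l' < n" using V(1) by simp
    from lower_block_eigenvector[OF herm V(3) this] nev show False by blast
  qed
  define b where "b i = Re ((adj V * H * V) $$ (i, i))" for i
  have "adj V * H * V = rdiag n b"
  proof (rule eq_matI)
    fix i j assume "i < dim_row (rdiag n b)" "j < dim_col (rdiag n b)"
    then have ij: "i < n" "j < n" by (auto simp: mat_diag_def)
    then show "(adj V * H * V) $$ (i, j) = rdiag n b $$ (i, j)"
      using V(3) \<open>l' = n\<close> hermitian_diag_real[OF herm ij(1)]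
      by (auto simp: b_def mat_diag_def diag_upto_def)
  qed (use VD Hc in \<open>auto simp: mat_diag_def\<close>)
  then have "diagonalizes n V H b" using V(2) Hc by (simp add: diagonalizes_def)
  then show ?thesis using that V by blast
qed

section \<open>Rearrangement and trace inequalities\<close>

lemma exists_sorting_permutation:
  fixes f :: "nat \<Rightarrow> real"
  obtains p where "p permutes {..<n}" "\<And>i j. i \<le> j \<Longrightarrow> j < n \<Longrightarrow> f (p j) \<le> f (p i)"
proof -
  define xs where "xs = sort_key (\<lambda>i. - f i) [0..<n]"
  have xs: "length xs = n" "distinct xs" "set xs = {..<n}" by (auto simp: xs_def)
  define p where "p i = (if i < n then xs ! i else i)" for i
  have "bij_betw ((!) xs) {..<n} {..<n}" by (rule bij_betw_nth) (simp_all add: xs)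
  moreover have "bij_betw p {..<n} {..<n} \<longleftrightarrow> bij_betw ((!) xs) {..<n} {..<n}"
    by (rule bij_betw_cong) (simp add: p_def)
  ultimately have "bij_betw p {..<n} {..<n}" by simp
  then have p: "p permutes {..<n}" by (rule bij_imp_permutes) (simp add: p_def)
  have "sorted (map (\<lambda>i. - f i) xs)" unfolding xs_def by (rule sorted_sort_key)
  then have "f (p j) \<le> f (p i)" if "i \<le> j" "j < n" for i j
    using that xs(1) sorted_nth_mono[of "map (\<lambda>i. - f i) xs" i j] by (simp add: p_def)
  then show ?thesis using that p by blast
qed

text \<open>Ties of \<open>c\<close> leave \<open>a\<close> unconstrained. This matters in
  \<open>diag_range_subset_hull\<close>, where the weights vanish on a middle stretch and the
  eigenvalues are not fully sorted.\<close>

definition similarly_ordered :: "nat \<Rightarrow> (nat \<Rightarrow> real) \<Rightarrow> (nat \<Rightarrow> real) \<Rightarrow> bool" where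
  "similarly_ordered n c a \<longleftrightarrow> (\<forall>i<n. \<forall>j<n. c j < c i \<longrightarrow> a j \<le> a i)"

abbreviation antitone :: "nat \<Rightarrow> (nat \<Rightarrow> real) \<Rightarrow> bool" where
  "antitone n c \<equiv> (\<forall>i j. i \<le> j \<longrightarrow> j < n \<longrightarrow> c j \<le> c i)"

lemma antitone_similarly_ordered:
  "antitone n c \<Longrightarrow> antitone n a \<Longrightarrow> similarly_ordered n c a"
  unfolding similarly_ordered_def by (meson linorder_le_cases not_le)

text \<open>The potentials \<open>u\<close> form a dual certificate for the assignment problem: \<open>u i - u j\<close>
  dominates \<open>(c i - c j) * a j\<close>.\<close>

lemma rearrangement_antitone:
  fixes c a :: "nat \<Rightarrow> real"
  assumes c: "antitone n c" and a: "antitone n a"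
    and s: "\<And>i j. i < n \<Longrightarrow> j < n \<Longrightarrow> 0 \<le> s i j"
    and row: "\<And>i. i < n \<Longrightarrow> (\<Sum>j<n. s i j) = 1" and col: "\<And>j. j < n \<Longrightarrow> (\<Sum>i<n. s i j) = 1"
  shows "(\<Sum>i<n. \<Sum>j<n. c i * a j * s i j) \<le> (\<Sum>i<n. c i * a i)"
proof -
  define u where "u i = (\<Sum>t<i. a t * (c (Suc t) - c t))" for i
  have le1: "(c i - c j) * a j \<le> u i - u j" if "j \<le> i" "i < n" for i j
    using that
  proof (induction i rule: dec_induct)
    case (step i)
    have "(c (Suc i) - c i) * a j \<le> (c (Suc i) - c i) * a i"
      using c a step by (intro mult_left_mono_neg) auto
    then show ?case using step by (simp add: u_def algebra_simps)
  qed simp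
  have le2: "(c i - c j) * a j \<le> u i - u j" if "i \<le> j" "j < n" for i j
    using that(1)
  proof (induction i rule: inc_induct)
    case (step i)
    have "(c i - c (Suc i)) * a j \<le> (c i - c (Suc i)) * a i"
      using c a step that(2) by (intro mult_left_mono) auto
    then show ?case using step by (simp add: u_def algebra_simps)
  qed simp
  have "(\<Sum>i<n. \<Sum>j<n. c i * a j * s i j) \<le> (\<Sum>i<n. \<Sum>j<n. (u i - u j + c j * a j) * s i j)"
  proof (intro sum_mono mult_right_mono)
    fix i j assume "i \<in> {..<n}" "j \<in> {..<n}"
    then show "c i * a j \<le> u i - u j + c j * a j"
      using le1[of j i] le2[of i j] by (cases "j \<le> i") (auto simp: algebra_simps)
  qed (use s in auto)
  also have "\<dots> = (\<Sum>i<n. \<Sum>j<n. u i * s i j) + (\<Sum>i<n. \<Sum>j<n. (c j * a j - u j) * s i j)"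
    by (simp add: sum.distrib[symmetric] algebra_simps)
  also have "(\<Sum>i<n. \<Sum>j<n. (c j * a j - u j) * s i j) = (\<Sum>j<n. (c j * a j - u j))"
    by (subst sum.swap) (simp add: sum_distrib_left[symmetric] col)
  also have "(\<Sum>i<n. \<Sum>j<n. u i * s i j) = (\<Sum>i<n. u i)"
    by (simp add: sum_distrib_left[symmetric] row)
  finally show ?thesis by (simp add: sum_subtractf)
qed

lemma rearrangement:
  fixes c a :: "nat \<Rightarrow> real"
  assumes ca: "similarly_ordered n c a"
    and s: "\<And>i j. i < n \<Longrightarrow> j < n \<Longrightarrow> 0 \<le> s i j"
    and row: "\<And>i. i < n \<Longrightarrow> (\<Sum>j<n. s i j) = 1" and col: "\<And>j. j < n \<Longrightarrow> (\<Sum>i<n. s i j) = 1"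
  shows "(\<Sum>i<n. \<Sum>j<n. c i * a j * s i j) \<le> (\<Sum>i<n. c i * a i)"
proof -
  \<comment> \<open>Sorting by the sum \<open>c + a\<close> sorts both sequences: by similar
    ordering a strict increase of one comes with no decrease of the other, which would contradict
    the order of the sums.\<close>
  obtain p where p: "p permutes {..<n}"
    and srt: "\<And>i j. i \<le> j \<Longrightarrow> j < n \<Longrightarrow> c (p j) + a (p j) \<le> c (p i) + a (p i)"
    using exists_sorting_permutation[of n "\<lambda>i. c i + a i"] by metis
  have pn: "p i < n" if "i < n" for i using permutes_in_image[OF p, of i] that by simp
  have mono: "c (p j) \<le> c (p i) \<and> a (p j) \<le> a (p i)" if "i \<le> j" "j < n" for i j
    using srt[OF that] ca pn[of i] pn[of j] that unfolding similarly_ordered_def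
    by (smt (verit) order_le_less_trans)
  have perm: "(\<Sum>i<n. f (p i)) = (\<Sum>i<n. f i)" for f :: "nat \<Rightarrow> real"
    using sum.permute[OF p, of f] by (simp add: o_def)
  have "(\<Sum>i<n. \<Sum>j<n. c (p i) * a (p j) * s (p i) (p j)) \<le> (\<Sum>i<n. c (p i) * a (p i))"
  proof (rule rearrangement_antitone)
    show "(\<Sum>j<n. s (p i) (p j)) = 1" if "i < n" for i
      using perm[of "s (p i)"] row pn that by simp
    show "(\<Sum>i<n. s (p i) (p j)) = 1" if "j < n" for j
      using perm[of "\<lambda>i. s i (p j)"] col pn that by simp
  qed (use mono s pn in auto)
  moreover have "(\<Sum>i<n. \<Sum>j<n. c (p i) * a (p j) * s (p i) (p j)) = (\<Sum>i<n. \<Sum>j<n. c i * a j * s i j)"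
    using perm[of "\<lambda>i. \<Sum>j<n. c i * a (p j) * s i (p j)"] perm[of "\<lambda>j. c i * a j * s i j" for i] by simp
  ultimately show ?thesis using perm[of "\<lambda>i. c i * a i"] by simp
qed

lemma diagonalizesD:
  assumes "diagonalizes n Y H b"
  shows "unitary_mat n Y" "Y \<in> carrier_mat n n" "H \<in> carrier_mat n n" "adj Y * H * Y = rdiag n b"
    "H = Y * rdiag n b * adj Y" "H * Y = Y * rdiag n b"
proof -
  show Y: "unitary_mat n Y" and H: "H \<in> carrier_mat n n" and eq: "adj Y * H * Y = rdiag n b"
    using assms by (auto simp: diagonalizes_def)
  show Yc: "Y \<in> carrier_mat n n" using unitaryD[OF Y] by simp
  show "H = Y * rdiag n b * adj Y" using conj_cancel(1)[OF H Y] eq by simp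
  have "Y * (adj Y * (H * Y)) = H * Y"
    using unitary_cancel(2)[OF Y] H Yc by (meson mult_carrier_mat)
  then show "H * Y = Y * rdiag n b"
    using eq Yc H by (simp add: sq_assoc[where n = n])
qed

text \<open>In the eigenbasis of \<open>H\<close> the diagonal of U^H H U averages \<open>b\<close>
  with the squared moduli of the entries of a unitary matrix. These are doubly stochastic, so the
  rearrangement inequality applies.\<close>

lemma trace_rearrangement:
  assumes dec: "diagonalizes n Y H b" and U: "unitary_mat n U" and cb: "similarly_ordered n c b"
  shows "(\<Sum>i<n. c i * Re ((adj U * H * U) $$ (i, i))) \<le> (\<Sum>i<n. c i * b i)"
proof -
  note Y = diagonalizesD[OF dec] and UD = unitaryD[OF U]
  define X where "X = adj Y * U"
  have X: "unitary_mat n X" unfolding X_def by (intro unitary_mult unitary_adj Y U)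
  have Xc: "X \<in> carrier_mat n n" using unitaryD[OF X] by simp
  have "adj U * H * U = adj X * rdiag n b * X"
    using UD(1) Y(2)
    by (subst Y(5)) (simp add: X_def adj_mult[of _ n n _ n] sq_assoc[where n = n] sq_mult[where n = n])
  then have "Re ((adj U * H * U) $$ (i, i)) = (\<Sum>l<n. b l * (cmod (X $$ (l, i)))\<^sup>2)" if "i < n" for i
    using rdiag_conj_index[OF Xc that that, of b]
    by (simp add: complex_norm_square[symmetric] mult.commute[of "cnj _"] flip: of_real_mult of_real_sum of_real_power)
  then have "(\<Sum>i<n. c i * Re ((adj U * H * U) $$ (i, i)))
    = (\<Sum>i<n. \<Sum>l<n. c i * b l * (cmod (X $$ (l, i)))\<^sup>2)"
    by (simp add: sum_distrib_left mult.assoc)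
  also have "\<dots> \<le> (\<Sum>i<n. c i * b i)"
  proof (rule rearrangement[OF cb])
    have eq: "(\<Sum>l<n. f l * cnj (f l)) = complex_of_real (\<Sum>l<n. (cmod (f l))\<^sup>2)" for f
      unfolding of_real_sum complex_norm_square ..
    show "(\<Sum>l<n. (cmod (X $$ (l, i)))\<^sup>2) = 1" if "i < n" for i
      using unitary_sums(1)[OF X that that] eq[of "\<lambda>l. X $$ (l, i)"]
      by (metis (no_types, lifting) mult.commute of_real_eq_1_iff sum.cong)
    show "(\<Sum>i<n. (cmod (X $$ (l, i)))\<^sup>2) = 1" if "l < n" for l
      using unitary_sums(2)[OF X that that] eq[of "\<lambda>i. X $$ (l, i)"]
      by (metis of_real_eq_1_iff)
  qed auto
  finally show ?thesis .
qed

definition permute_cols :: "nat \<Rightarrow> (nat \<Rightarrow> nat) \<Rightarrow> complex mat \<Rightarrow> complex mat" where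
  "permute_cols n p U = Matrix.mat n n (\<lambda>(i, j). U $$ (i, p j))"

lemma permute_cols:
  assumes U: "unitary_mat n U" and p: "p permutes {..<n}"
  shows "permute_cols n p U \<in> carrier_mat n n" "unitary_mat n (permute_cols n p U)"
    "\<And>A i j. A \<in> carrier_mat n n \<Longrightarrow> i < n \<Longrightarrow> j < n \<Longrightarrow>
      (adj (permute_cols n p U) * A * permute_cols n p U) $$ (i, j) = (adj U * A * U) $$ (p i, p j)"
proof -
  have pn: "p i < n" if "i < n" for i using permutes_in_image[OF p, of i] that by simp
  have inj: "p i = p j \<longleftrightarrow> i = j" for i j using permutes_inj[OF p] by (auto simp: inj_def)
  note UD = unitaryD[OF U]
  show c: "permute_cols n p U \<in> carrier_mat n n" by (simp add: permute_cols_def)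
  show "unitary_mat n (permute_cols n p U)"
  proof (rule unitaryI[OF c])
    fix i j assume ij: "i < n" "j < n"
    then show "(\<Sum>l<n. cnj (permute_cols n p U $$ (l, i)) * permute_cols n p U $$ (l, j)) = (if i = j then 1 else 0)"
      using unitary_sums(1)[OF U pn[OF ij(1)] pn[OF ij(2)]] by (simp add: permute_cols_def inj)
  qed
  show "(adj (permute_cols n p U) * A * permute_cols n p U) $$ (i, j) = (adj U * A * U) $$ (p i, p j)"
    if "A \<in> carrier_mat n n" "i < n" "j < n" for A i j
    unfolding conj_index[OF that(1) c that(2,3)] conj_index[OF that(1) UD(1) pn[OF that(2)] pn[OF that(3)]]
    using that by (simp add: permute_cols_def)
qed

lemma diagonalizes_permute:
  assumes "diagonalizes n Y H b" "p permutes {..<n}"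
  shows "diagonalizes n (permute_cols n p Y) H (b \<circ> p)"
proof -
  note Y = diagonalizesD[OF assms(1)] and P = permute_cols[OF Y(1) assms(2)]
  have pn: "p i < n" if "i < n" for i using permutes_in_image[OF assms(2), of i] that by simp
  have inj: "p i = p j \<longleftrightarrow> i = j" for i j using permutes_inj[OF assms(2)] by (auto simp: inj_def)
  have "adj (permute_cols n p Y) * H * permute_cols n p Y = rdiag n (b \<circ> p)"
  proof (rule eq_matI)
    fix i j assume "i < dim_row (rdiag n (b \<circ> p))" "j < dim_col (rdiag n (b \<circ> p))"
    then have "i < n" "j < n" by (auto simp: mat_diag_def)
    then show "(adj (permute_cols n p Y) * H * permute_cols n p Y) $$ (i, j) = rdiag n (b \<circ> p) $$ (i, j)"
      using P(3)[OF Y(3)] Y(4) pn by (simp add: mat_diag_def inj)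
  qed (use P Y in \<open>auto simp: mat_diag_def\<close>)
  then show ?thesis using P Y by (simp add: diagonalizes_def)
qed

lemma spectral_sorted:
  assumes H: "hermitian_mat n H"
  obtains Y b where "diagonalizes n Y H b" "antitone n b"
proof -
  obtain V b where V: "diagonalizes n V H b"
    using spectral_fixing[OF H, of 0] by (auto simp: diag_upto_def)
  obtain p where p: "p permutes {..<n}" "\<And>i j. i \<le> j \<Longrightarrow> j < n \<Longrightarrow> b (p j) \<le> b (p i)"
    using exists_sorting_permutation[of n b] by metis
  show ?thesis using that[OF diagonalizes_permute[OF V p(1)]] p(2) by simp
qed

section \<open>Horn's theorem\<close>

text \<open>For Hermitian \<open>A j\<close> this is the joint range of any C that is diagonalized
  with eigenvalues \<open>c\<close> (\<open>joint_C_range_eq_diag_range\<close>), in real terms and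
  with the entries of \<open>c\<close> in any order.\<close>

definition diag_range :: "nat \<Rightarrow> (nat \<Rightarrow> real) \<Rightarrow> ('m::finite \<Rightarrow> complex mat) \<Rightarrow> (real ^ 'm) set" where
  "diag_range n c A = {x. \<exists>U. unitary_mat n U \<and>
     (\<forall>j. vec_nth x j = (\<Sum>i<n. c i * Re ((adj U * A j * U) $$ (i, i))))}"

definition orbit_diagonals :: "nat \<Rightarrow> (nat \<Rightarrow> real) \<Rightarrow> (nat \<Rightarrow> real) set" where
  "orbit_diagonals n c =
     {z. \<exists>U. unitary_mat n U \<and> (\<forall>i<n. z i = Re ((adj U * rdiag n c * U) $$ (i, i)))}"

lemma sum_two:
  fixes p q n :: nat
  assumes "p < n" "q < n" "p \<noteq> q" "\<And>l. l < n \<Longrightarrow> l \<noteq> p \<Longrightarrow> l \<noteq> q \<Longrightarrow> f l = 0"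
  shows "(\<Sum>l<n. f l) = f p + (f q :: 'a :: comm_monoid_add)"
proof -
  have "(\<Sum>l<n. f l) = (\<Sum>l\<in>{p, q}. f l)"
    using assms by (intro sum.mono_neutral_right) auto
  then show ?thesis using assms by simp
qed

text \<open>The phase \<open>w\<close> makes the cross term \<open>w * B $$ (p, q)\<close> purely imaginary, so that the
  plane rotation acts on the diagonal as the averaging \<open>t\<close> prescribes.\<close>

lemma rotation_diagonal:
  assumes B: "hermitian_mat n B" and pq: "p < n" "q < n" "p \<noteq> q" and t: "0 \<le> t" "t \<le> 1"
  obtains X where "unitary_mat n X"
    "Re ((adj X * B * X) $$ (p, p)) = (1 - t) * Re (B $$ (p, p)) + t * Re (B $$ (q, q))"
    "Re ((adj X * B * X) $$ (q, q)) = t * Re (B $$ (p, p)) + (1 - t) * Re (B $$ (q, q))"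
    "\<And>i. i < n \<Longrightarrow> i \<noteq> p \<Longrightarrow> i \<noteq> q \<Longrightarrow> (adj X * B * X) $$ (i, i) = B $$ (i, i)"
proof -
  note Bc = hermitianD(1)[OF B]
  define s r where "s = sqrt (1 - t)" and "r = sqrt t"
  have sr: "s * s = 1 - t" "r * r = t" using t by (auto simp: s_def r_def)
  define w where "w = (if B $$ (p, q) = 0 then 1 else \<i> * cnj (B $$ (p, q)) / cmod (B $$ (p, q)))"
  have w: "w * cnj w = 1"
    unfolding complex_norm_square[symmetric] by (auto simp: w_def norm_mult norm_divide)
  have "cnj (B $$ (p, q)) * B $$ (p, q) = cmod (B $$ (p, q)) * cmod (B $$ (p, q))"
    by (metis complex_norm_square mult.commute of_real_mult power2_eq_square)
  then have "w * B $$ (p, q) = \<i> * cmod (B $$ (p, q))" by (auto simp: w_def mult.assoc)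
  then have wB: "Re (w * B $$ (p, q)) = 0" by simp
  have Bqp: "B $$ (q, p) = cnj (B $$ (p, q))" using hermitianD(3)[OF B pq(1,2)] .
  define X where "X = Matrix.mat n n (\<lambda>(i, j).
    if j = p then (if i = p then s else if i = q then w * r else 0)
    else if j = q then (if i = p then - cnj w * r else if i = q then s else 0)
    else if i = j then 1 else 0)"
  have Xc: "X \<in> carrier_mat n n" by (simp add: X_def)
  have Xp: "X $$ (i, p) = (if i = p then s else if i = q then w * r else 0)"
    and Xq: "X $$ (i, q) = (if i = p then - cnj w * r else if i = q then s else 0)" if "i < n" for i
    using that pq by (auto simp: X_def)
  have Xj: "X $$ (i, j) = (if i = j then 1 else 0)" if "i < n" "j < n" "j \<noteq> p" "j \<noteq> q" for i j
    using that by (auto simp: X_def)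
  have Xi: "X $$ (i, j) = (if i = j then 1 else 0)" if "i < n" "j < n" "i \<noteq> p" "i \<noteq> q" for i j
    using that by (auto simp: X_def)
  have sr': "complex_of_real s * s = 1 - t" "complex_of_real r * r = t"
    using sr by (metis of_real_mult of_real_diff of_real_1)+
  have cw: "cnj w * w = 1" using w by (simp add: mult.commute)
  have cw': "cnj w * (w * z) = z" "w * (cnj w * z) = z" for z using w cw by (simp_all flip: mult.assoc)
  have U: "unitary_mat n X"
  proof (rule unitaryI[OF Xc])
    fix i j assume ij: "i < n" "j < n"
    consider "j \<noteq> p" "j \<noteq> q" | "i \<noteq> p" "i \<noteq> q" | "i \<in> {p, q}" "j \<in> {p, q}" by auto
    then show "(\<Sum>l<n. cnj (X $$ (l, i)) * X $$ (l, j)) = (if i = j then 1 else 0)"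
    proof cases
      case 1
      have "(\<Sum>l<n. cnj (X $$ (l, i)) * X $$ (l, j)) = (\<Sum>l<n. if l = j then cnj (X $$ (j, i)) else 0)"
        using 1 ij by (intro sum.cong refl) (auto simp: Xj)
      then show ?thesis using ij 1 by (simp add: Xi)
    next
      case 2
      have "(\<Sum>l<n. cnj (X $$ (l, i)) * X $$ (l, j)) = (\<Sum>l<n. if l = i then X $$ (i, j) else 0)"
        using 2 ij by (intro sum.cong refl) (auto simp: Xj)
      then show ?thesis using ij 2 by (simp add: Xi)
    next
      case 3
      have "(\<Sum>l<n. cnj (X $$ (l, i)) * X $$ (l, j))
        = cnj (X $$ (p, i)) * X $$ (p, j) + cnj (X $$ (q, i)) * X $$ (q, j)"
        using 3 pq by (intro sum_two) (auto simp: Xp Xq)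
      then show ?thesis using 3 pq sr' by (auto simp: Xp Xq cw cw' algebra_simps)
    qed
  qed
  have form: "(adj X * B * X) $$ (i, i)
      = cnj (X $$ (p, i)) * B $$ (p, p) * X $$ (p, i) + cnj (X $$ (p, i)) * B $$ (p, q) * X $$ (q, i)
        + (cnj (X $$ (q, i)) * B $$ (q, p) * X $$ (p, i) + cnj (X $$ (q, i)) * B $$ (q, q) * X $$ (q, i))"
    if "i = p \<or> i = q" for i
  proof -
    have i: "i < n" using that pq by auto
    have z: "X $$ (l, i) = 0" if "l < n" "l \<noteq> p" "l \<noteq> q" for l
      using that i \<open>i = p \<or> i = q\<close> by (auto simp: Xp Xq)
    have inner: "(\<Sum>q'<n. cnj (X $$ (p', i)) * B $$ (p', q') * X $$ (q', i))
      = cnj (X $$ (p', i)) * B $$ (p', p) * X $$ (p, i) + cnj (X $$ (p', i)) * B $$ (p', q) * X $$ (q, i)" for p'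
      using pq z by (intro sum_two) auto
    show ?thesis unfolding conj_index[OF Bc Xc i i] inner
      using pq z by (subst sum_two[of p n q]) auto
  qed
  have wB2: "Re (cnj w * cnj (B $$ (p, q))) = 0"
    using wB by (metis complex_cnj_mult cnj.simps(1))
  have "Re ((adj X * B * X) $$ (p, p)) = Re (s * s * B $$ (p, p) + r * r * B $$ (q, q)
      + s * r * (w * B $$ (p, q)) + s * r * (cnj w * cnj (B $$ (p, q))))"
    unfolding form[OF disjI1[OF refl]] using pq by (simp add: Xp Bqp cw cw' algebra_simps)
  also have "\<dots> = s * s * Re (B $$ (p, p)) + r * r * Re (B $$ (q, q))
      + s * r * Re (w * B $$ (p, q)) + s * r * Re (cnj w * cnj (B $$ (p, q)))"
    by (simp add: algebra_simps)
  finally have P: "Re ((adj X * B * X) $$ (p, p)) = (1 - t) * Re (B $$ (p, p)) + t * Re (B $$ (q, q))"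
    unfolding wB wB2 sr by simp
  have "Re ((adj X * B * X) $$ (q, q)) = Re (r * r * B $$ (p, p) + s * s * B $$ (q, q)
      + (- s * r) * (w * B $$ (p, q)) + (- s * r) * (cnj w * cnj (B $$ (p, q))))"
    unfolding form[OF disjI2[OF refl]] using pq by (simp add: Xq Bqp cw cw' algebra_simps)
  also have "\<dots> = r * r * Re (B $$ (p, p)) + s * s * Re (B $$ (q, q))
      + (- s * r) * Re (w * B $$ (p, q)) + (- s * r) * Re (cnj w * cnj (B $$ (p, q)))"
    by (simp add: algebra_simps)
  finally have Q: "Re ((adj X * B * X) $$ (q, q)) = t * Re (B $$ (p, p)) + (1 - t) * Re (B $$ (q, q))"
    unfolding wB wB2 sr by simp
  have "(adj X * B * X) $$ (i, i) = B $$ (i, i)" if "i < n" "i \<noteq> p" "i \<noteq> q" for i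
  proof -
    have "(adj X * B * X) $$ (i, i) = (\<Sum>p'<n. \<Sum>q'<n. if q' = i then (if p' = i then B $$ (i, i) else 0) else 0)"
      unfolding conj_index[OF Bc Xc that(1) that(1)] using that
      by (intro sum.cong refl) (auto simp: Xj)
    also have "\<dots> = B $$ (i, i)" using that by simp
    finally show ?thesis .
  qed
  then show ?thesis using that U P Q by blast
qed

lemma orbit_diagonals_transfer:
  assumes z: "z \<in> orbit_diagonals n c" and pq: "p < n" "q < n" "p \<noteq> q" and t: "0 \<le> t" "t \<le> 1"
  shows "z(p := (1 - t) * z p + t * z q, q := t * z p + (1 - t) * z q) \<in> orbit_diagonals n c"
proof -
  obtain U where U: "unitary_mat n U" and zU: "\<And>i. i < n \<Longrightarrow> z i = Re ((adj U * rdiag n c * U) $$ (i, i))"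
    using z by (auto simp: orbit_diagonals_def)
  note UD = unitaryD[OF U]
  have "hermitian_mat n (adj U * rdiag n c * U)" by (rule hermitian_conj[OF hermitian_rdiag UD(1)])
  from rotation_diagonal[OF this pq t] obtain X where X: "unitary_mat n X"
    and Xp: "Re ((adj X * (adj U * rdiag n c * U) * X) $$ (p, p)) = (1 - t) * z p + t * z q"
    and Xq: "Re ((adj X * (adj U * rdiag n c * U) * X) $$ (q, q)) = t * z p + (1 - t) * z q"
    and Xi: "\<And>i. i < n \<Longrightarrow> i \<noteq> p \<Longrightarrow> i \<noteq> q \<Longrightarrow> Re ((adj X * (adj U * rdiag n c * U) * X) $$ (i, i)) = z i"
    using zU pq by metis
  note XD = unitaryD[OF X]
  have "adj (U * X) * rdiag n c * (U * X) = adj X * (adj U * rdiag n c * U) * X"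
    by (rule conj_mult) (use UD XD in auto)
  then show ?thesis
    unfolding orbit_diagonals_def using unitary_mult[OF U X] Xp Xq Xi pq
    by (auto intro!: exI[of _ "U * X"])
qed

text \<open>The Hardy-Littlewood-Polya argument: transfers between two coordinates lead from
  \<open>x\<close> to \<open>y\<close>, each reducing the number of disagreeing coordinates. Only
  \<open>y\<close> is sorted; \<open>x\<close> need not stay sorted, since the invariant is the
  dominance of initial sums.\<close>

lemma majorized_reachable:
  fixes x y :: "nat \<Rightarrow> real"
  assumes transfer: "\<And>z p q t. z \<in> S \<Longrightarrow> p < n \<Longrightarrow> q < n \<Longrightarrow> p \<noteq> q \<Longrightarrow> 0 \<le> t \<Longrightarrow> t \<le> 1 \<Longrightarrow>
      z(p := (1 - t) * z p + t * z q, q := t * z p + (1 - t) * z q) \<in> S"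
    and ext: "\<And>z w. z \<in> S \<Longrightarrow> (\<And>i. i < n \<Longrightarrow> z i = w i) \<Longrightarrow> w \<in> S"
    and y: "antitone n y"
    and "x \<in> S" "\<And>t. t \<le> n \<Longrightarrow> (\<Sum>i<t. y i) \<le> (\<Sum>i<t. x i)" "(\<Sum>i<n. y i) = (\<Sum>i<n. x i)"
  shows "y \<in> S"
  using assms(4-6)
proof (induction "card {i. i < n \<and> x i \<noteq> y i}" arbitrary: x rule: less_induct)
  case less
  show ?case
  proof (cases "\<forall>i<n. x i = y i")
    case True
    then show ?thesis using ext less.prems(1) by blast
  next
    case False
    have "\<exists>k<n. x k < y k"
    proof (rule ccontr)
      assume "\<not> (\<exists>k<n. x k < y k)"
      then have ge: "\<And>k. k \<in> {..<n} \<Longrightarrow> 0 \<le> x k - y k" by (meson diff_ge_0_iff_ge lessThan_iff not_less)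
      have "(\<Sum>i<n. x i - y i) = 0" using less.prems(3) by (simp add: sum_subtractf)
      then have "\<forall>k\<in>{..<n}. x k - y k = 0" by (subst (asm) sum_nonneg_eq_0_iff) (use ge in auto)
      then show False using False by auto
    qed
    \<comment> \<open>The first deficient index. Some earlier index has a surplus, for otherwise the
      sums up to and including \<open>k\<close> would violate dominance.\<close>
    define k where "k = (LEAST k. k < n \<and> x k < y k)"
    have k: "k < n" "x k < y k" using LeastI_ex[OF \<open>\<exists>k<n. x k < y k\<close>] by (auto simp: k_def)
    have below: "y i \<le> x i" if "i < k" for i
      using not_less_Least[of i "\<lambda>k. k < n \<and> x k < y k"] that k(1) by (auto simp: k_def not_less)
    have "\<exists>j<k. y j < x j"
    proof (rule ccontr)
      assume "\<not> (\<exists>j<k. y j < x j)"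
      then have "\<forall>j<k. x j = y j" using below by (meson antisym not_less)
      then have "(\<Sum>i<Suc k. x i) < (\<Sum>i<Suc k. y i)" using k by simp
      then show False using less.prems(2)[of "Suc k"] k by simp
    qed
    then obtain j where j: "j < k" "y j < x j" by blast
    have yjk: "y k \<le> y j" using y j k by simp
    \<comment> \<open>The largest amount that overshoots at neither index; it uses up the surplus at
      \<open>j\<close> or the deficit at \<open>k\<close>.\<close>
    define d where "d = min (x j - y j) (y k - x k)"
    have d: "0 < d" "d \<le> x j - y j" "d \<le> y k - x k" using j k by (auto simp: d_def)
    define t where "t = d / (x j - x k)"
    have pos: "0 < x j - x k" using j k yjk by simp
    have t: "0 \<le> t" "t \<le> 1" "t * (x j - x k) = d" using d pos yjk by (auto simp: t_def)
    define x' where "x' = x(j := x j - d, k := x k + d)"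
    have "x' = x(j := (1 - t) * x j + t * x k, k := t * x j + (1 - t) * x k)"
      unfolding x'_def using t(3) by (simp add: algebra_simps)
    then have x'S: "x' \<in> S" using transfer[OF less.prems(1), of j k t] j k t by simp
    have psum: "(\<Sum>i<m. x' i) = (\<Sum>i<m. x i) - (if j < m then d else 0) + (if k < m then d else 0)" for m
    proof -
      have "(\<Sum>i<m. x' i) = (\<Sum>i<m. x i - (if i = j then d else 0) + (if i = k then d else 0))"
        using j by (intro sum.cong) (auto simp: x'_def)
      then show ?thesis by (simp add: sum.distrib sum_subtractf)
    qed
    \<comment> \<open>Only the initial sums with \<open>j < m\<close> and \<open>m \<le> k\<close>
      lose \<open>d\<close>. All indices below \<open>k\<close> satisfy
      \<open>y i \<le> x i\<close>, so the surplus at \<open>j\<close> alone covers the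
      loss.\<close>
    have dom: "(\<Sum>i<m. y i) \<le> (\<Sum>i<m. x' i)" if m: "m \<le> n" for m
    proof (cases "j < m \<and> m \<le> k")
      case True
      have "x j - y j \<le> (\<Sum>i<m. x i - y i)"
        by (rule member_le_sum) (use True below in auto)
      then show ?thesis unfolding psum using True d by (simp add: sum_subtractf)
    next
      case False
      then show ?thesis unfolding psum using less.prems(2)[OF m] j by auto
    qed
    have eq: "(\<Sum>i<n. y i) = (\<Sum>i<n. x' i)" unfolding psum using less.prems(3) j k by simp
    have "{i. i < n \<and> x' i \<noteq> y i} \<subset> {i. i < n \<and> x i \<noteq> y i}"
    proof
      show "{i. i < n \<and> x' i \<noteq> y i} \<subseteq> {i. i < n \<and> x i \<noteq> y i}"
        using j k by (auto simp: x'_def split: if_splits)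
      have "d = x j - y j \<or> d = y k - x k" by (auto simp: d_def min_def)
      then have "x' j = y j \<or> x' k = y k" using j by (auto simp: x'_def)
      then show "{i. i < n \<and> x' i \<noteq> y i} \<noteq> {i. i < n \<and> x i \<noteq> y i}"
      proof
        assume "x' j = y j"
        moreover have "j \<in> {i. i < n \<and> x i \<noteq> y i}" using j k by simp
        ultimately show ?thesis by blast
      next
        assume "x' k = y k"
        moreover have "k \<in> {i. i < n \<and> x i \<noteq> y i}" using k by simp
        ultimately show ?thesis by blast
      qed
    qed
    then have "card {i. i < n \<and> x' i \<noteq> y i} < card {i. i < n \<and> x i \<noteq> y i}"
      by (intro psubset_card_mono) auto
    from less.hyps[OF this x'S dom eq] show ?thesis .
  qed
qed

text \<open>Quantifying over all index sets instead of sorting \<open>z\<close> makes convexity in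
  \<open>z\<close> immediate. The right-hand side is the sum of the largest entries when
  \<open>c\<close> is descending.\<close>

definition majorized :: "nat \<Rightarrow> (nat \<Rightarrow> real) \<Rightarrow> (nat \<Rightarrow> real) \<Rightarrow> bool" where
  "majorized n c z \<longleftrightarrow> (\<forall>I\<subseteq>{..<n}. sum z I \<le> (\<Sum>i<card I. c i)) \<and> (\<Sum>i<n. z i) = (\<Sum>i<n. c i)"

text \<open>The orbit has \<open>c\<close> itself as a diagonal and is closed under transfers by
  plane rotations, so \<open>majorized_reachable\<close> leads to the sorted rearrangement of
  \<open>z\<close>; permuting the columns of the unitary undoes the sorting.\<close>

lemma horn:
  assumes z: "majorized n c z"
  shows "z \<in> orbit_diagonals n c"
proof -
  obtain p where p: "p permutes {..<n}" "\<And>i j. i \<le> j \<Longrightarrow> j < n \<Longrightarrow> z (p j) \<le> z (p i)"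
    using exists_sorting_permutation[of n z] by metis
  have "z \<circ> p \<in> orbit_diagonals n c"
  proof (rule majorized_reachable[where n = n and x = c])
    show "c \<in> orbit_diagonals n c"
      by (auto simp: orbit_diagonals_def mat_diag_def intro!: exI[of _ "1\<^sub>m n"])
    show "w \<in> orbit_diagonals n c" if "v \<in> orbit_diagonals n c" "\<And>i. i < n \<Longrightarrow> v i = w i" for v w
      using that by (auto simp: orbit_diagonals_def)
    show "(\<Sum>i<t. (z \<circ> p) i) \<le> (\<Sum>i<t. c i)" if "t \<le> n" for t
    proof -
      have inj: "inj_on p {..<t}" using permutes_inj[OF p(1)] by (auto intro: inj_on_subset)
      have "p ` {..<t} \<subseteq> {..<n}" using permutes_in_image[OF p(1)] that by fastforce
      then have "sum z (p ` {..<t}) \<le> (\<Sum>i<card (p ` {..<t}). c i)" using z by (simp add: majorized_def)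
      then show ?thesis using inj by (simp add: sum.reindex card_image)
    qed
    show "(\<Sum>i<n. (z \<circ> p) i) = (\<Sum>i<n. c i)"
      using sum.permute[OF p(1), of z] z by (simp add: majorized_def)
  qed (use p orbit_diagonals_transfer in auto)
  then obtain U where U: "unitary_mat n U" and zU: "\<And>i. i < n \<Longrightarrow> z (p i) = Re ((adj U * rdiag n c * U) $$ (i, i))"
    by (auto simp: orbit_diagonals_def)
  have ip: "inv_into UNIV p permutes {..<n}" by (rule permutes_inv[OF p(1)])
  note P = permute_cols[OF U ip]
  have "z i = Re ((adj (permute_cols n (inv_into UNIV p) U) * rdiag n c * permute_cols n (inv_into UNIV p) U) $$ (i, i))" if "i < n" for i
    using zU[of "inv_into UNIV p i"] P(3)[OF mat_diag_dim that that] permutes_in_image[OF ip, of i] that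
      permutes_inverses(1)[OF p(1)] by simp
  then show ?thesis using P(2) by (auto simp: orbit_diagonals_def)
qed

section \<open>Ranges of diagonal families\<close>

definition perm_points :: "nat \<Rightarrow> (nat \<Rightarrow> real) \<Rightarrow> ('m::finite \<Rightarrow> complex mat) \<Rightarrow> (real ^ 'm) set" where
  "perm_points n c D = {x. \<exists>p. p permutes {..<n} \<and>
     (\<forall>j. vec_nth x j = (\<Sum>i<n. c i * Re (D j $$ (p i, p i))))}"

lemma finite_perm_points: "finite (perm_points n c D)"
proof -
  have "perm_points n c D \<subseteq> (\<lambda>p. vec_lambda (\<lambda>j. \<Sum>i<n. c i * Re (D j $$ (p i, p i)))) ` {p. p permutes {..<n}}"
    by (auto simp: perm_points_def image_iff Finite_Cartesian_Product.vec_eq_iff)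
  then show ?thesis by (rule finite_subset) (simp add: finite_permutations)
qed

text \<open>The largest element of \<open>I\<close> is at least \<open>card I - 1\<close>, so its
  value of \<open>c\<close> is at most the last term of the initial sum; removing it gives the
  induction.\<close>

lemma sum_le_sum_initial:
  assumes "antitone n c" "I \<subseteq> {..<n}"
  shows "sum c I \<le> (\<Sum>i<card I. c i)"
  using assms(2)
proof (induction "card I" arbitrary: I)
  case 0
  then have "I = {}" using finite_subset[of I "{..<n}"] by auto
  then show ?case by simp
next
  case (Suc m)
  have fin: "finite I" using Suc.prems finite_subset by blast
  have ne: "I \<noteq> {}" using Suc.hyps(2) by auto
  define x where "x = Max I"
  have x: "x \<in> I" "I \<subseteq> {..x}" using fin ne by (auto simp: x_def)
  have "card I \<le> Suc x" using card_mono[of "{..x}" I] x by simp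
  then have "c x \<le> c m" using assms(1) Suc.hyps(2) x Suc.prems by auto
  moreover have "sum c (I - {x}) \<le> (\<Sum>i<card (I - {x}). c i)"
    using Suc x fin by (intro Suc.hyps) auto
  moreover have "card (I - {x}) = m" using Suc.hyps(2) x fin by simp
  moreover have "sum c I = c x + sum c (I - {x})" using fin x by (simp add: sum.remove)
  ultimately show ?case using Suc.hyps(2) by (metis add.commute add_mono sum.lessThan_Suc)
qed

lemma majorized_permute:
  assumes "antitone n c" "p permutes {..<n}"
  shows "majorized n c (c \<circ> p)"
proof -
  have "sum (c \<circ> p) I \<le> (\<Sum>i<card I. c i)" if "I \<subseteq> {..<n}" for I
  proof -
    have inj: "inj_on p I" using permutes_inj[OF assms(2)] by (auto intro: inj_on_subset)
    have "p ` I \<subseteq> {..<n}" using permutes_in_image[OF assms(2)] that by fastforce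
    from sum_le_sum_initial[OF assms(1) this] show ?thesis using inj by (simp add: sum.reindex card_image)
  qed
  then show ?thesis using sum.permute[OF assms(2), of c] by (simp add: majorized_def)
qed

lemma majorized_convex:
  assumes "majorized n c z" "majorized n c w" "0 \<le> u" "0 \<le> v" "u + v = 1"
  shows "majorized n c (\<lambda>i. u * z i + v * w i)"
proof -
  have "(\<Sum>i\<in>I. u * z i + v * w i) \<le> (\<Sum>i<card I. c i)" if "I \<subseteq> {..<n}" for I
  proof -
    have "(\<Sum>i\<in>I. u * z i + v * w i) = u * sum z I + v * sum w I"
      by (simp add: sum.distrib sum_distrib_left)
    also have "\<dots> \<le> u * (\<Sum>i<card I. c i) + v * (\<Sum>i<card I. c i)"
      using assms that by (intro add_mono mult_left_mono) (auto simp: majorized_def)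
    also have "\<dots> = (\<Sum>i<card I. c i)" using assms(5) by (simp flip: distrib_right)
    finally show ?thesis .
  qed
  moreover have "(\<Sum>i<n. u * z i + v * w i) = u * (\<Sum>i<n. c i) + v * (\<Sum>i<n. c i)"
    using assms by (simp add: sum.distrib sum_distrib_left[symmetric] majorized_def)
  then have "(\<Sum>i<n. u * z i + v * w i) = (\<Sum>i<n. c i)" using assms(5) by (simp flip: distrib_right)
  ultimately show ?thesis by (simp add: majorized_def)
qed

text \<open>Both sides are the double sum of c_i |U_(l,i)|^2 D_(l,l). The exchange turns a point of
  the range of a diagonal family into a diagonal from the orbit of diag(c), where Horn's theorem
  applies.\<close>

lemma diagonal_conj_swap:
  assumes D: "D \<in> carrier_mat n n" "diagonal_mat D" and U: "unitary_mat n U"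
  shows "(\<Sum>i<n. c i * Re ((adj U * D * U) $$ (i, i)))
    = (\<Sum>i<n. Re ((U * rdiag n c * adj U) $$ (i, i)) * Re (D $$ (i, i)))"
proof -
  note UD = unitaryD[OF U]
  have "Re ((adj U * D * U) $$ (i, i)) = (\<Sum>l<n. (cmod (U $$ (l, i)))\<^sup>2 * Re (D $$ (l, l)))" if i: "i < n" for i
  proof -
    have "(adj U * D * U) $$ (i, i)
      = (\<Sum>p<n. \<Sum>q<n. if q = p then complex_of_real ((cmod (U $$ (p, i)))\<^sup>2) * D $$ (p, p) else 0)"
      unfolding conj_index[OF D(1) UD(1) i i]
      using D by (intro sum.cong refl) (auto simp: diagonal_mat_def complex_norm_square simp del: of_real_power)
    then show ?thesis by (simp del: of_real_power)
  qed
  moreover have "Re ((U * rdiag n c * adj U) $$ (i, i)) = (\<Sum>l<n. c l * (cmod (U $$ (i, l)))\<^sup>2)" if i: "i < n" for i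
  proof -
    have "(adj (adj U) * rdiag n c * adj U) $$ (i, i) = (\<Sum>l<n. complex_of_real (c l * (cmod (U $$ (i, l)))\<^sup>2))"
      unfolding rdiag_conj_index[OF adj_carrier[OF UD(1)] i i] of_real_mult complex_norm_square
      using UD(1) i by (intro sum.cong refl) simp
    then show ?thesis by (simp del: of_real_power of_real_mult)
  qed
  ultimately have "(\<Sum>i<n. c i * Re ((adj U * D * U) $$ (i, i)))
      = (\<Sum>i<n. \<Sum>l<n. c i * (cmod (U $$ (l, i)))\<^sup>2 * Re (D $$ (l, l)))"
    and "(\<Sum>i<n. Re ((U * rdiag n c * adj U) $$ (i, i)) * Re (D $$ (i, i)))
      = (\<Sum>i<n. \<Sum>l<n. c l * (cmod (U $$ (i, l)))\<^sup>2 * Re (D $$ (i, i)))"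
    by (simp_all add: sum_distrib_left sum_distrib_right mult.assoc)
  then show ?thesis by (subst (asm) sum.swap) simp
qed

text \<open>The image \<open>T\<close> of the majorized sequences under a linear map is convex and
  contains the permutation points. By \<open>horn\<close> each point of \<open>T\<close> is attained
  by one unitary common to all \<open>j\<close>.\<close>

lemma hull_perm_points_subset:
  fixes D :: "'m::finite \<Rightarrow> complex mat"
  assumes D: "\<And>j. D j \<in> carrier_mat n n" "\<And>j. diagonal_mat (D j)" and c: "antitone n c"
  shows "convex hull (perm_points n c D) \<subseteq> diag_range n c D"
proof -
  define T where "T = {x :: real ^ 'm. \<exists>z. majorized n c z \<and> (\<forall>j. vec_nth x j = (\<Sum>i<n. z i * Re (D j $$ (i, i))))}"
  have "convex hull (perm_points n c D) \<subseteq> T"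
  proof (rule hull_minimal)
    show "perm_points n c D \<subseteq> T"
    proof
      fix x assume "x \<in> perm_points n c D"
      then obtain p where p: "p permutes {..<n}" "\<And>j. vec_nth x j = (\<Sum>i<n. c i * Re (D j $$ (p i, p i)))"
        by (auto simp: perm_points_def)
      have "vec_nth x j = (\<Sum>i<n. (c \<circ> inv_into UNIV p) i * Re (D j $$ (i, i)))" for j
        using sum.permute[OF p(1), of "\<lambda>i. (c \<circ> inv_into UNIV p) i * Re (D j $$ (i, i))"] p(2)
          permutes_inverses(2)[OF p(1)] by (simp add: o_def)
      then show "x \<in> T" using majorized_permute[OF c permutes_inv[OF p(1)]] by (auto simp: T_def)
    qed
    show "convex T"
    proof (rule convexI)
      fix x y :: "real ^ 'm" and u v :: real
      assume "x \<in> T" "y \<in> T" and uv: "0 \<le> u" "0 \<le> v" "u + v = 1"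
      then obtain z w where zw: "majorized n c z" "majorized n c w"
        "\<And>j. vec_nth x j = (\<Sum>i<n. z i * Re (D j $$ (i, i)))" "\<And>j. vec_nth y j = (\<Sum>i<n. w i * Re (D j $$ (i, i)))"
        by (auto simp: T_def)
      have "vec_nth (u *\<^sub>R x + v *\<^sub>R y) j = (\<Sum>i<n. (u * z i + v * w i) * Re (D j $$ (i, i)))" for j
        by (simp add: zw(3,4) distrib_right sum.distrib sum_distrib_left mult.assoc)
      then show "u *\<^sub>R x + v *\<^sub>R y \<in> T"
        using majorized_convex[OF zw(1,2) uv] by (auto simp: T_def)
    qed
  qed
  also have "T \<subseteq> diag_range n c D"
  proof
    fix x assume "x \<in> T"
    then obtain z where z: "majorized n c z" "\<And>j. vec_nth x j = (\<Sum>i<n. z i * Re (D j $$ (i, i)))"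
      by (auto simp: T_def)
    obtain U where U: "unitary_mat n U" "\<And>i. i < n \<Longrightarrow> z i = Re ((adj U * rdiag n c * U) $$ (i, i))"
      using horn[OF z(1)] by (auto simp: orbit_diagonals_def)
    have "vec_nth x j = (\<Sum>i<n. c i * Re ((adj (adj U) * D j * adj U) $$ (i, i)))" for j
      using diagonal_conj_swap[OF D unitary_adj[OF U(1)], of c j] U(2) z(2) by simp
    then show "x \<in> diag_range n c D" using unitary_adj[OF U(1)] unfolding diag_range_def by blast
  qed
  finally show ?thesis .
qed

section \<open>Hermitian pencils and optimal projections\<close>

definition pencil :: "nat \<Rightarrow> ('m::finite \<Rightarrow> complex mat) \<Rightarrow> real ^ 'm \<Rightarrow> complex mat" where
  "pencil n A v = Matrix.mat n n (\<lambda>(i, l). \<Sum>j\<in>UNIV. complex_of_real (vec_nth v j) * A j $$ (i, l))"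

lemma pencil_carrier [simp]: "pencil n A v \<in> carrier_mat n n"
  by (simp add: pencil_def)

lemma pencil_index:
  "i < n \<Longrightarrow> l < n \<Longrightarrow> pencil n A v $$ (i, l) = (\<Sum>j\<in>UNIV. complex_of_real (vec_nth v j) * A j $$ (i, l))"
  by (simp add: pencil_def)

lemma hermitian_pencil:
  assumes "\<And>j. hermitian_mat n (A j)"
  shows "hermitian_mat n (pencil n A v)"
proof (rule hermitianI)
  fix i l assume il: "i < n" "l < n"
  have "pencil n A v $$ (l, i) = (\<Sum>j\<in>UNIV. cnj (complex_of_real (vec_nth v j) * A j $$ (i, l)))"
    unfolding pencil_index[OF il(2,1)]
  proof (rule sum.cong[OF refl])
    fix j
    show "complex_of_real (vec_nth v j) * A j $$ (l, i) = cnj (complex_of_real (vec_nth v j) * A j $$ (i, l))"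
      using hermitianD(3)[OF assms il, of j] by simp
  qed
  then show "pencil n A v $$ (l, i) = cnj (pencil n A v $$ (i, l))"
    using il by (simp add: pencil_index)
qed simp

lemma pencil_conj_index:
  assumes A: "\<And>j. A j \<in> carrier_mat n n" and U: "U \<in> carrier_mat n n" and il: "i < n" "l < n"
  shows "(adj U * pencil n A v * U) $$ (i, l)
    = (\<Sum>j\<in>UNIV. complex_of_real (vec_nth v j) * (adj U * A j * U) $$ (i, l))"
proof -
  have "(adj U * pencil n A v * U) $$ (i, l)
    = (\<Sum>p<n. \<Sum>q<n. \<Sum>j\<in>UNIV. complex_of_real (vec_nth v j) * (cnj (U $$ (p, i)) * A j $$ (p, q) * U $$ (q, l)))"
    unfolding conj_index[OF pencil_carrier U il]
    by (intro sum.cong refl) (simp add: pencil_index sum_distrib_left sum_distrib_right mult_ac)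
  also have "\<dots> = (\<Sum>p<n. \<Sum>j\<in>UNIV. \<Sum>q<n. complex_of_real (vec_nth v j) * (cnj (U $$ (p, i)) * A j $$ (p, q) * U $$ (q, l)))"
    by (intro sum.cong refl sum.swap)
  also have "\<dots> = (\<Sum>j\<in>UNIV. \<Sum>p<n. \<Sum>q<n. complex_of_real (vec_nth v j) * (cnj (U $$ (p, i)) * A j $$ (p, q) * U $$ (q, l)))"
    by (rule sum.swap)
  finally show ?thesis unfolding conj_index[OF A U il] by (simp add: sum_distrib_left)
qed

lemma inner_diag_point:
  fixes x v :: "real ^ 'm::finite"
  assumes A: "\<And>j. A j \<in> carrier_mat n n" and U: "U \<in> carrier_mat n n"
    and x: "\<And>j. vec_nth x j = (\<Sum>i<n. c i * Re ((adj U * A j * U) $$ (i, i)))"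
  shows "inner v x = (\<Sum>i<n. c i * Re ((adj U * pencil n A v * U) $$ (i, i)))"
proof -
  have "inner v x = (\<Sum>j\<in>UNIV. \<Sum>i<n. c i * (vec_nth v j * Re ((adj U * A j * U) $$ (i, i))))"
    by (simp add: inner_vec_def x sum_distrib_left mult_ac)
  also have "\<dots> = (\<Sum>i<n. \<Sum>j\<in>UNIV. c i * (vec_nth v j * Re ((adj U * A j * U) $$ (i, i))))"
    by (rule sum.swap)
  also have "\<dots> = (\<Sum>i<n. c i * Re ((adj U * pencil n A v * U) $$ (i, i)))"
    by (intro sum.cong refl) (simp add: pencil_conj_index[OF A U] Re_sum sum_distrib_left)
  finally show ?thesis .
qed

lemma pencil_add: "pencil n A (u + v) = pencil n A u + pencil n A v"
  by (rule eq_matI) (auto simp: pencil_def sum.distrib distrib_right)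

lemma pencil_scaleR: "pencil n A (r *\<^sub>R v) = complex_of_real r \<cdot>\<^sub>m pencil n A v"
  by (rule eq_matI) (auto simp: pencil_def sum_distrib_left mult.assoc)

lemma pencil_minus: "pencil n A (- v) = - pencil n A v"
  by (rule eq_matI) (auto simp: pencil_def sum_negf)

lemma pencil_zero: "pencil n A 0 = 0\<^sub>m n n"
  by (rule eq_matI) (auto simp: pencil_def)

lemma pencil_axis:
  assumes "A j \<in> carrier_mat n n"
  shows "pencil n A (axis j 1) = A j"
proof (rule eq_matI)
  fix i l assume "i < dim_row (A j)" "l < dim_col (A j)"
  then have "i < n" "l < n" using assms by auto
  then have "pencil n A (axis j 1) $$ (i, l) = (\<Sum>j'\<in>UNIV. if j' = j then A j $$ (i, l) else 0)"
    unfolding pencil_index[OF \<open>i < n\<close> \<open>l < n\<close>] by (intro sum.cong refl) (auto simp: axis_def)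
  then show "pencil n A (axis j 1) $$ (i, l) = A j $$ (i, l)" by simp
qed (use assms in \<open>auto simp: pencil_def\<close>)

text \<open>Commutation with \<open>P\<close> is linear in \<open>v\<close>, so it has to be checked
  only on a spanning set such as a normal cone with interior. \<open>subspace_eigen\<close> does the
  same for having \<open>x\<close> as an eigenvector.\<close>

lemma subspace_commuting:
  assumes P: "P \<in> carrier_mat n n"
  shows "Real_Vector_Spaces.subspace {v. P * pencil n A v = pencil n A v * P}"
proof (rule real_vector.subspaceI)
  show "0 \<in> {v. P * pencil n A v = pencil n A v * P}" using P by (simp add: pencil_zero)
next
  fix u v assume "u \<in> {v. P * pencil n A v = pencil n A v * P}" "v \<in> {v. P * pencil n A v = pencil n A v * P}"
  then show "u + v \<in> {v. P * pencil n A v = pencil n A v * P}"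
    using P by (simp add: pencil_add mult_add_distrib_mat[of _ n n _ n] add_mult_distrib_mat[of _ n n _ _ n])
next
  fix r v assume "v \<in> {v. P * pencil n A v = pencil n A v * P}"
  then show "r *\<^sub>R v \<in> {v. P * pencil n A v = pencil n A v * P}"
    using P by (simp add: pencil_scaleR mult_smult_distrib[of _ n n _ n] mult_smult_assoc_mat[of _ n n _ n])
qed

lemma subspace_eigen:
  assumes x: "x \<in> carrier_vec n"
  shows "Real_Vector_Spaces.subspace {v. \<exists>a. pencil n A v *\<^sub>v x = a \<cdot>\<^sub>v x}"
proof (rule real_vector.subspaceI)
  have "pencil n A 0 *\<^sub>v x = 0 \<cdot>\<^sub>v x"
    using x unfolding pencil_zero by (intro eq_vecI) (auto simp: scalar_prod_def)
  then show "0 \<in> {v. \<exists>a. pencil n A v *\<^sub>v x = a \<cdot>\<^sub>v x}" by blast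
next
  fix u v assume "u \<in> {v. \<exists>a. pencil n A v *\<^sub>v x = a \<cdot>\<^sub>v x}" "v \<in> {v. \<exists>a. pencil n A v *\<^sub>v x = a \<cdot>\<^sub>v x}"
  then obtain a b where "pencil n A u *\<^sub>v x = a \<cdot>\<^sub>v x" "pencil n A v *\<^sub>v x = b \<cdot>\<^sub>v x" by blast
  then have "pencil n A (u + v) *\<^sub>v x = (a + b) \<cdot>\<^sub>v x"
    unfolding pencil_add using x
    by (simp add: add_mult_distrib_mat_vec[of _ n n] add_smult_distrib_vec)
  then show "u + v \<in> {v. \<exists>a. pencil n A v *\<^sub>v x = a \<cdot>\<^sub>v x}" by blast
next
  fix r v assume "v \<in> {v. \<exists>a. pencil n A v *\<^sub>v x = a \<cdot>\<^sub>v x}"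
  then obtain a where a: "pencil n A v *\<^sub>v x = a \<cdot>\<^sub>v x" by blast
  have "pencil n A (r *\<^sub>R v) *\<^sub>v x = complex_of_real r \<cdot>\<^sub>v (pencil n A v *\<^sub>v x)"
    unfolding pencil_scaleR using x by (intro eq_vecI) (auto simp: pencil_def)
  then have "pencil n A (r *\<^sub>R v) *\<^sub>v x = (r * a) \<cdot>\<^sub>v x"
    unfolding a by (simp add: smult_smult_assoc)
  then show "r *\<^sub>R v \<in> {v. \<exists>a. pencil n A v *\<^sub>v x = a \<cdot>\<^sub>v x}" by blast
qed

section \<open>Projections of rank k and the Ky Fan sum\<close>

lemma rdiag_sandwich_index:
  assumes "R \<in> carrier_mat n n" "i < n" "j < n"
  shows "(R * rdiag n b) $$ (i, j) = R $$ (i, j) * b j" "(rdiag n b * R) $$ (i, j) = b i * R $$ (i, j)"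
  using assms by (simp_all add: mat_diag_mult_left[of _ n n] mat_diag_mult_right[of _ n n])

text \<open>Nothing is claimed about eigenvectors for \<open>lam\<close> itself: if the k-th
  eigenvalue is multiple, an optimal projection may cut its eigenspace in many ways.\<close>

definition separates :: "nat \<Rightarrow> complex mat \<Rightarrow> complex mat \<Rightarrow> real \<Rightarrow> bool" where
  "separates n P H lam \<longleftrightarrow> (\<forall>x a. x \<in> carrier_vec n \<longrightarrow> H *\<^sub>v x = complex_of_real a \<cdot>\<^sub>v x \<longrightarrow>
     (lam < a \<longrightarrow> P *\<^sub>v x = x) \<and> (a < lam \<longrightarrow> P *\<^sub>v x = 0\<^sub>v n))"

abbreviation indic :: "nat \<Rightarrow> nat \<Rightarrow> real" where
  "indic k \<equiv> \<lambda>i. if i < k then 1 else 0"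

lemma sum_indic: "k \<le> n \<Longrightarrow> (\<Sum>i<n. indic k i * f i) = (\<Sum>i<k. f i)"
proof -
  assume "k \<le> n"
  then have "(\<Sum>i<n. indic k i * f i) = (\<Sum>i\<in>{..<n} \<inter> {..<k}. f i)"
    by (subst sum.inter_restrict) (auto intro!: sum.cong)
  also have "{..<n} \<inter> {..<k} = {..<k}" using \<open>k \<le> n\<close> by auto
  finally show ?thesis .
qed

lemma projection_facts:
  assumes U: "unitary_mat n U" and P: "P = U * rdiag n (indic k) * adj U"
  shows "P \<in> carrier_mat n n" "adj P = P" "P * P = P"
proof -
  note UD = unitaryD[OF U]
  show Pc: "P \<in> carrier_mat n n" using UD P by auto
  show "adj P = P" unfolding P using UD(1)
    by (simp add: adj_mult[of _ n n _ n] sq_assoc[where n = n] sq_mult[where n = n])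
  have "P * P = U * (rdiag n (indic k) * (adj U * (U * (rdiag n (indic k) * adj U))))"
    unfolding P using UD(1) by (simp add: sq_assoc[where n = n] sq_mult[where n = n])
  also have "\<dots> = U * (rdiag n (indic k) * (rdiag n (indic k) * adj U))"
    using UD(1) by (subst unitary_cancel(1)[OF U, of _ n]) (auto simp: sq_mult[where n = n])
  also have "\<dots> = U * ((rdiag n (indic k) * rdiag n (indic k)) * adj U)"
    using UD(1) sq_assoc[of "rdiag n (indic k)" n "rdiag n (indic k)" "adj U"] by simp
  also have "rdiag n (indic k) * rdiag n (indic k) = rdiag n (indic k)"
    unfolding mat_diag_diag by (rule arg_cong[of _ _ "mat_diag n"]) auto
  finally show "P * P = P" unfolding P using UD(1) by (simp add: sq_assoc[where n = n] sq_mult[where n = n])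
qed

text \<open>A diagonal entry of a projection is the squared norm of its column, its own square
  included. So it lies between 0 and 1, and at either extreme the rest of the column
  vanishes.\<close>

lemma projection_diag:
  assumes R: "R \<in> carrier_mat n n" "adj R = R" "R * R = R" and j: "j < n"
  shows "Re (R $$ (j, j)) = (\<Sum>i<n. (cmod (R $$ (i, j)))\<^sup>2)" "0 \<le> Re (R $$ (j, j))" "Re (R $$ (j, j)) \<le> 1"
    "Re (R $$ (j, j)) = 1 \<Longrightarrow> i < n \<Longrightarrow> R $$ (i, j) = (if i = j then 1 else 0)"
    "Re (R $$ (j, j)) = 0 \<Longrightarrow> i < n \<Longrightarrow> R $$ (i, j) = 0"
proof -
  have herm: "hermitian_mat n R" using R by (simp add: hermitian_mat_def)
  have "R $$ (j, j) = (\<Sum>i<n. R $$ (j, i) * R $$ (i, j))"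
    using mult_index[OF R(1,1) j j] R(3) by simp
  also have "\<dots> = (\<Sum>i<n. complex_of_real ((cmod (R $$ (i, j)))\<^sup>2))"
    unfolding complex_norm_square
  proof (rule sum.cong[OF refl])
    fix i assume "i \<in> {..<n}"
    then show "R $$ (j, i) * R $$ (i, j) = R $$ (i, j) * cnj (R $$ (i, j))"
      using hermitianD(3)[OF herm, of i j] j by simp
  qed
  finally show eq: "Re (R $$ (j, j)) = (\<Sum>i<n. (cmod (R $$ (i, j)))\<^sup>2)"
    by (simp flip: of_real_sum del: of_real_power)
  show ge: "0 \<le> Re (R $$ (j, j))" unfolding eq by (intro sum_nonneg) auto
  have real: "complex_of_real (Re (R $$ (j, j))) = R $$ (j, j)" by (rule hermitian_diag_real[OF herm j])
  have cm: "cmod (R $$ (j, j)) = Re (R $$ (j, j))" using ge real by (metis norm_of_real abs_of_nonneg)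
  have split: "Re (R $$ (j, j)) = (Re (R $$ (j, j)))\<^sup>2 + (\<Sum>i\<in>{..<n} - {j}. (cmod (R $$ (i, j)))\<^sup>2)"
    using j by (subst (1) eq) (simp add: sum.remove[of "{..<n}" j] cm)
  have nn: "0 \<le> (\<Sum>i\<in>{..<n} - {j}. (cmod (R $$ (i, j)))\<^sup>2)" by (intro sum_nonneg) auto
  show "Re (R $$ (j, j)) \<le> 1"
  proof (rule ccontr)
    assume "\<not> Re (R $$ (j, j)) \<le> 1"
    then have "Re (R $$ (j, j)) * 1 < Re (R $$ (j, j)) * Re (R $$ (j, j))"
      by (intro mult_strict_left_mono) auto
    then show False using split nn by (simp add: power2_eq_square)
  qed
  show "R $$ (i, j) = (if i = j then 1 else 0)" if one: "Re (R $$ (j, j)) = 1" and "i < n"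
  proof (cases "i = j")
    case True
    then show ?thesis using real one by simp
  next
    case False
    have "(\<Sum>i\<in>{..<n} - {j}. (cmod (R $$ (i, j)))\<^sup>2) = 0" using split one by simp
    then have "\<forall>i\<in>{..<n} - {j}. (cmod (R $$ (i, j)))\<^sup>2 = 0" by (subst (asm) sum_nonneg_eq_0_iff) auto
    then show ?thesis using False \<open>i < n\<close> by simp
  qed
  show "R $$ (i, j) = 0" if zero: "Re (R $$ (j, j)) = 0" and "i < n"
  proof -
    have "(\<Sum>i<n. (cmod (R $$ (i, j)))\<^sup>2) = 0" using eq zero by simp
    then have "\<forall>i\<in>{..<n}. (cmod (R $$ (i, j)))\<^sup>2 = 0" by (subst (asm) sum_nonneg_eq_0_iff) auto
    then show ?thesis using \<open>i < n\<close> by simp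
  qed
qed

lemma projection_trace:
  assumes U: "unitary_mat n U" and P: "P = U * rdiag n (indic k) * adj U" and k: "k \<le> n"
  shows "(\<Sum>i<n. Re (P $$ (i, i))) = k"
proof -
  have "(\<Sum>i<n. Re ((U * rdiag n (indic k) * adj U) $$ (i, i)) * Re (1\<^sub>m n $$ (i, i)))
      = (\<Sum>i<n. indic k i * Re ((adj U * 1\<^sub>m n * U) $$ (i, i)))"
    by (rule diagonal_conj_swap[symmetric, OF _ _ U]) (auto simp: diagonal_mat_def)
  also have "\<dots> = (\<Sum>i<n. indic k i * 1)"
    using unitaryD[OF U] by (intro sum.cong refl) auto
  also have "\<dots> = k" by (simp only: sum_indic[OF k]) simp
  finally show ?thesis unfolding P by simp
qed

text \<open>This is the equality case of the Ky Fan inequality.\<close>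

lemma optimal_projection:
  assumes dec: "diagonalizes n Y H b" and b: "antitone n b" and U: "unitary_mat n U"
    and k: "1 \<le> k" "k \<le> n" and P: "P = U * rdiag n (indic k) * adj U"
    and opt: "(\<Sum>i<k. Re ((adj U * H * U) $$ (i, i))) = (\<Sum>i<k. b i)"
  shows "P * H = H * P" "separates n P H (b (k - 1))"
proof -
  note Y = diagonalizesD[OF dec] and UD = unitaryD[OF U]
  note YD = unitaryD[OF Y(1)]
  note Pf = projection_facts[OF U P]
  let ?lam = "b (k - 1)"
  define X where "X = adj Y * U"
  have X: "unitary_mat n X" unfolding X_def by (intro unitary_mult unitary_adj Y U)
  note XD = unitaryD[OF X]
  have Xadj: "adj X = adj U * Y" using YD(1) UD(1) by (simp add: X_def adj_mult[of _ n n _ n])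
  define R where "R = X * rdiag n (indic k) * adj X"
  note Rf = projection_facts[OF X R_def]
  have R_eq: "R = adj Y * P * Y" unfolding R_def Xadj P unfolding X_def using YD(1) UD(1)
    by (simp add: sq_assoc[where n = n] sq_mult[where n = n])
  have P_eq: "P = Y * R * adj Y" using conj_cancel(1)[OF Pf(1) Y(1)] R_eq by simp
  define r where "r j = Re (R $$ (j, j))" for j
  have tr_r: "(\<Sum>j<n. r j) = k" using projection_trace[OF X R_def k(2)] by (simp add: r_def)
  have "adj X * rdiag n b * X = adj U * H * U"
    unfolding Xadj unfolding X_def by (subst Y(5)) (use YD(1) UD(1) in
      \<open>simp add: sq_assoc[where n = n] sq_mult[where n = n]\<close>)
  then have "(\<Sum>i<n. indic k i * Re ((adj U * H * U) $$ (i, i)))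
      = (\<Sum>i<n. Re (R $$ (i, i)) * Re (rdiag n b $$ (i, i)))"
    using diagonal_conj_swap[of "rdiag n b" n X "indic k"] X by (simp add: R_def diagonal_mat_def mat_diag_def)
  then have sum_br: "(\<Sum>j<n. b j * r j) = (\<Sum>j<k. b j)"
    using opt unfolding sum_indic[OF k(2)] by (simp add: r_def mat_diag_def mult.commute)
  have r01: "0 \<le> r j" "r j \<le> 1" if "j < n" for j using projection_diag(2,3)[OF Rf that] by (auto simp: r_def)
  \<comment> \<open>The \<open>e j\<close> are nonnegative and sum to zero, because \<open>R\<close>
    attains the optimal value and has trace \<open>k\<close>. Hence \<open>r j\<close> equals the
    indicator wherever \<open>b j\<close> differs from the k-th eigenvalue.\<close>
  define e where "e j = (b j - ?lam) * (indic k j - r j)" for j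
  have e0: "0 \<le> e j" if "j < n" for j
  proof (cases "j < k")
    case True
    then have "?lam \<le> b j" using b k by auto
    then show ?thesis using True r01[OF that] by (simp add: e_def)
  next
    case False
    then have "b j \<le> ?lam" using b that k by auto
    then show ?thesis using False r01[OF that] by (simp add: e_def mult_nonpos_nonneg)
  qed
  have "(\<Sum>j<n. e j) = (\<Sum>j<n. indic k j * b j) - (\<Sum>j<n. b j * r j) - ?lam * ((\<Sum>j<n. indic k j * 1) - (\<Sum>j<n. r j))"
    unfolding sum_distrib_left sum_subtractf[symmetric] by (intro sum.cong refl) (simp add: e_def algebra_simps)
  also have "\<dots> = 0" unfolding sum_indic[OF k(2)] sum_br tr_r by simp
  finally have "\<forall>j\<in>{..<n}. e j = 0" by (subst (asm) sum_nonneg_eq_0_iff) (use e0 in auto)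
  then have e: "e j = 0" if "j < n" for j using that by simp
  have hi: "R $$ (i, j) = (if i = j then 1 else 0)" if "?lam < b j" "i < n" "j < n" for i j
  proof -
    have "j < k" using b that k by (metis (no_types, lifting) One_nat_def Suc_pred not_less less_eq_Suc_le less_le_not_le)
    then have "r j = 1" using e[OF that(3)] that by (simp add: e_def)
    then show ?thesis using projection_diag(4)[OF Rf that(3) _ that(2)] by (simp add: r_def)
  qed
  have lo: "R $$ (i, j) = 0" if "b j < ?lam" "i < n" "j < n" for i j
  proof -
    have "\<not> j < k"
    proof
      assume "j < k"
      then have "?lam \<le> b j" using b k by auto
      then show False using that by simp
    qed
    then have "r j = 0" using e[OF that(3)] that by (simp add: e_def)
    then show ?thesis using projection_diag(5)[OF Rf that(3) _ that(2)] by (simp add: r_def)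
  qed
  have hR: "hermitian_mat n R" using Rf by (simp add: hermitian_mat_def)
  have "R * rdiag n b = rdiag n b * R"
  proof (rule eq_matI)
    fix i j assume "i < dim_row (rdiag n b * R)" "j < dim_col (rdiag n b * R)"
    then have ij: "i < n" "j < n" using Rf(1) by (auto simp: mat_diag_def)
    \<comment> \<open>If \<open>b i\<close> and \<open>b j\<close> differ, one of them is not the
      k-th eigenvalue. The corresponding column of \<open>R\<close> has no off-diagonal entries, and
      Hermitian symmetry carries this over to the row.\<close>
    have "R $$ (i, j) = 0 \<or> b i = b j"
    proof (cases "i = j")
      case False
      have ji: "R $$ (j, i) = cnj (R $$ (i, j))" by (rule hermitianD(3)[OF hR ij])
      show ?thesis
        using hi[OF _ ij] lo[OF _ ij] hi[OF _ ij(2,1)] lo[OF _ ij(2,1)] ji False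
        by (metis complex_cnj_zero_iff linorder_less_linear)
    qed simp
    then show "(R * rdiag n b) $$ (i, j) = (rdiag n b * R) $$ (i, j)"
      unfolding rdiag_sandwich_index[OF Rf(1) ij] by auto
  qed (use Rf(1) in \<open>auto simp: mat_diag_def\<close>)
  then have "R * rdiag n b * adj Y = rdiag n b * R * adj Y" by simp
  then have comm: "R * (rdiag n b * adj Y) = rdiag n b * (R * adj Y)"
    using Rf(1) YD(1) by (simp add: sq_assoc[where n = n])
  have "P * H = Y * (R * (adj Y * (Y * (rdiag n b * adj Y))))"
    unfolding P_eq by (subst Y(5)) (use Rf(1) YD(1) in \<open>simp add: sq_assoc[where n = n] sq_mult[where n = n]\<close>)
  also have "\<dots> = Y * (rdiag n b * (R * adj Y))"
    using YD(1) comm by (subst unitary_cancel(1)[OF Y(1), of _ n]) (auto simp: sq_mult[where n = n])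
  also have "\<dots> = Y * (rdiag n b * (adj Y * (Y * (R * adj Y))))"
    using YD(1) Rf(1) by (subst unitary_cancel(1)[OF Y(1), of _ n]) (auto simp: sq_mult[where n = n])
  also have "\<dots> = H * P"
    unfolding P_eq by (subst Y(5)) (use Rf(1) YD(1) in \<open>simp add: sq_assoc[where n = n] sq_mult[where n = n]\<close>)
  finally show "P * H = H * P" .
  show "separates n P H ?lam"
    unfolding separates_def
  proof (intro allI impI)
    fix x :: "complex vec" and a :: real
    assume x: "x \<in> carrier_vec n" and ev: "H *\<^sub>v x = complex_of_real a \<cdot>\<^sub>v x"
    define z where "z = adj Y *\<^sub>v x"
    have z: "z \<in> carrier_vec n"
      unfolding z_def by (rule mult_mat_vec_carrier[OF adj_carrier[OF YD(1)] x])
    have Yz: "Y *\<^sub>v z = x" using YD x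
      by (simp add: z_def assoc_mult_mat_vec[of _ n n _ n, symmetric] del: assoc_mult_mat_vec)
    have "rdiag n b *\<^sub>v z = adj Y *\<^sub>v (H *\<^sub>v (Y *\<^sub>v z))"
      unfolding Y(4)[symmetric]
      using assoc_mult_mat_vec[OF sq_mult[OF adj_carrier[OF YD(1)] Y(3)] YD(1) z]
        assoc_mult_mat_vec[OF adj_carrier[OF YD(1)] Y(3) mult_mat_vec_carrier[OF YD(1) z]] by simp
    also have "\<dots> = complex_of_real a \<cdot>\<^sub>v z"
      unfolding Yz ev using YD(1) x by (simp add: mult_mat_vec[of _ n n] z_def)
    finally have "(rdiag n b *\<^sub>v z) $ j = (complex_of_real a \<cdot>\<^sub>v z) $ j" for j by simp
    moreover have "(rdiag n b *\<^sub>v z) $ j = b j * z $ j" if "j < n" for j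
    proof -
      have "(rdiag n b *\<^sub>v z) $ j = (\<Sum>p<n. if p = j then b j * z $ j else 0)"
        unfolding mult_vec_index[OF mat_diag_dim z that] using that
        by (intro sum.cong refl) (auto simp: mat_diag_def)
      then show ?thesis using that by simp
    qed
    ultimately have zb: "z $ j = 0 \<or> b j = a" if "j < n" for j
      using that z by (metis carrier_vecD index_smult_vec(1) mult_cancel_right of_real_eq_iff)
    have Px: "P *\<^sub>v x = Y *\<^sub>v (R *\<^sub>v z)"
      unfolding P_eq z_def
      using assoc_mult_mat_vec[OF sq_mult[OF YD(1) Rf(1)] adj_carrier[OF YD(1)] x]
        assoc_mult_mat_vec[OF YD(1) Rf(1) z] by (simp add: z_def)
    show "(?lam < a \<longrightarrow> P *\<^sub>v x = x) \<and> (a < ?lam \<longrightarrow> P *\<^sub>v x = 0\<^sub>v n)"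
    proof (intro conjI impI)
      assume a: "?lam < a"
      have "R *\<^sub>v z = z"
      proof (rule eq_vecI)
        fix i assume "i < dim_vec z"
        then have i: "i < n" using z by simp
        have "(R *\<^sub>v z) $ i = (\<Sum>p<n. if p = i then z $ i else 0)"
          unfolding mult_vec_index[OF Rf(1) z i] using hi i zb a by (intro sum.cong refl) fastforce
        then show "(R *\<^sub>v z) $ i = z $ i" using i by simp
      qed (use Rf(1) z in auto)
      then show "P *\<^sub>v x = x" using Px Yz by simp
    next
      assume a: "a < ?lam"
      have "R *\<^sub>v z = 0\<^sub>v n"
      proof (rule eq_vecI)
        fix i assume "i < dim_vec (0\<^sub>v n :: complex vec)"
        then have i: "i < n" by simp
        have "(R *\<^sub>v z) $ i = (\<Sum>p<n. 0)"
          unfolding mult_vec_index[OF Rf(1) z i] using lo i zb a by (intro sum.cong refl) fastforce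
        then show "(R *\<^sub>v z) $ i = 0\<^sub>v n $ i" using i by simp
      qed (use Rf(1) in auto)
      moreover have "Y *\<^sub>v 0\<^sub>v n = 0\<^sub>v n" using YD(1) by (intro eq_vecI) auto
      ultimately show "P *\<^sub>v x = 0\<^sub>v n" using Px by simp
    qed
  qed
qed

section \<open>Normal cones of a polyhedral range\<close>

lemma interior_Union_empty:
  assumes "finite F" "\<And>S. S \<in> F \<Longrightarrow> closed S" "\<And>S. S \<in> F \<Longrightarrow> interior S = {}"
  shows "interior (\<Union>F) = {}"
  using assms by (induction F rule: finite_induct) (simp_all add: interior_closed_Un_empty_interior)

abbreviation rspan :: "'a::real_vector set \<Rightarrow> 'a set" where
  "rspan \<equiv> Real_Vector_Spaces.span"

lemma span_UNIV_of_interior: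
  fixes S :: "'a::euclidean_space set"
  assumes "interior S \<noteq> {}"
  shows "rspan S = UNIV"
proof -
  have "\<not> dim S < DIM('a)" using empty_interior_lowdim[of S] assms by blast
  then have "dim S = DIM('a)" using dim_subset_UNIV[of S] by simp
  then show ?thesis by (simp add: dim_eq_full)
qed

lemma interior_proper_span:
  fixes S :: "'a::euclidean_space set"
  assumes "rspan S \<noteq> UNIV"
  shows "interior (rspan S) = {}"
  using span_UNIV_of_interior[of "rspan S"] assms by (auto simp: real_vector.span_span)

lemma convex_hull_inner_le:
  assumes "\<And>x. x \<in> S \<Longrightarrow> inner v x \<le> b" "x \<in> convex hull S"
  shows "inner v x \<le> b"
proof -
  have "convex hull S \<subseteq> {x. inner v x \<le> b}"
    by (rule hull_minimal) (use assms(1) convex_halfspace_le in auto)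
  then show ?thesis using assms(2) by blast
qed

lemma mult_zero_vec: "M \<in> carrier_mat n n \<Longrightarrow> M *\<^sub>v 0\<^sub>v n = (0\<^sub>v n :: complex vec)"
  by (rule eq_vecI) auto

lemma smult_mat_mult_vec:
  fixes M :: "complex mat"
  assumes M: "M \<in> carrier_mat n n" and y: "y \<in> carrier_vec n"
  shows "(a \<cdot>\<^sub>m M) *\<^sub>v y = a \<cdot>\<^sub>v (M *\<^sub>v y)"
proof (rule eq_vecI)
  fix i assume "i < dim_vec (a \<cdot>\<^sub>v (M *\<^sub>v y))"
  then have i: "i < n" using M by simp
  have "((a \<cdot>\<^sub>m M) *\<^sub>v y) $ i = (\<Sum>p<n. a * (M $$ (i, p) * y $ p))"
    using M i by (subst mult_vec_index[OF _ y i]) (auto simp: mult.assoc intro!: sum.cong)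
  then show "((a \<cdot>\<^sub>m M) *\<^sub>v y) $ i = (a \<cdot>\<^sub>v (M *\<^sub>v y)) $ i"
    using mult_vec_index[OF M y i] M i by (simp add: sum_distrib_left)
qed (use M in auto)

lemma mat_eq_on_columns:
  assumes Y: "unitary_mat n Y" and M: "M \<in> carrier_mat n n" "N \<in> carrier_mat n n"
    and eq: "\<And>j. j < n \<Longrightarrow> M *\<^sub>v col Y j = N *\<^sub>v col Y j"
  shows "M = N"
proof -
  note YD = unitaryD[OF Y]
  have "M * Y = N * Y"
  proof (rule mat_col_eqI)
    fix j assume "j < dim_col (N * Y)"
    then have j: "j < n" using YD(1) by simp
    show "col (M * Y) j = col (N * Y) j"
      unfolding col_mult2[OF M(1) YD(1) j] col_mult2[OF M(2) YD(1) j] by (rule eq[OF j])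
  qed (use M in auto)
  then have "M * Y * adj Y = N * Y * adj Y" by simp
  then show ?thesis using M YD by (simp add: sq_assoc[where n = n])
qed

lemma diagonalizes_column:
  assumes "diagonalizes n Y H b" "j < n"
  shows "col Y j \<in> carrier_vec n" "H *\<^sub>v col Y j = complex_of_real (b j) \<cdot>\<^sub>v col Y j"
proof -
  note Y = diagonalizesD[OF assms(1)]
  show "col Y j \<in> carrier_vec n" using Y(2) by auto
  have "H *\<^sub>v col Y j = col (H * Y) j" by (rule col_mult2[OF Y(3,2) assms(2), symmetric])
  also have "\<dots> = col (Y * rdiag n b) j" using Y(6) by simp
  also have "\<dots> = complex_of_real (b j) \<cdot>\<^sub>v col Y j"
    using Y(2) assms(2) rdiag_sandwich_index(1)[OF Y(2) _ assms(2)]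
    by (intro eq_vecI) (auto simp: mat_diag_def)
  finally show "H *\<^sub>v col Y j = complex_of_real (b j) \<cdot>\<^sub>v col Y j" .
qed

lemma commuting_eigen:
  fixes M H :: "complex mat"
  assumes "M \<in> carrier_mat n n" "H \<in> carrier_mat n n" "H * M = M * H" "x \<in> carrier_vec n"
    "H *\<^sub>v x = a \<cdot>\<^sub>v x"
  shows "H *\<^sub>v (M *\<^sub>v x) = a \<cdot>\<^sub>v (M *\<^sub>v x)"
proof -
  have "H *\<^sub>v (M *\<^sub>v x) = M *\<^sub>v (H *\<^sub>v x)"
    using assms by (metis assoc_mult_mat_vec)
  then show ?thesis unfolding assms(5) mult_mat_vec[OF assms(1,4)] .
qed

text \<open>The situation after conjugation by the unitary of \<open>joint_diag\<close>: the first
  \<open>l\<close> unit vectors are joint eigenvectors and, by \<open>nj\<close>, none is left in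
  their complement. As \<open>c\<close> is indexed from 0, \<open>gap\<close> reads c_k > c_(k+1).
  Only the convex hull of the range is assumed to be polyhedral.\<close>

locale polyhedral_core =
  fixes n k l :: nat and A :: "'m::finite \<Rightarrow> complex mat" and c :: "nat \<Rightarrow> real" and T :: "(real ^ 'm) set"
  assumes herm: "\<And>j. hermitian_mat n (A j)" and dg: "\<And>j. diag_upto n l (A j)" and l: "l \<le> n"
    and nj: "\<And>x. \<not> joint_ev n l A x" and c: "antitone n c" and k: "1 \<le> k" "2 * k \<le> n"
    and gap: "c k < c (k - 1)" and T: "finite T" "convex hull (diag_range n c A) = convex hull T"
begin

abbreviation H :: "real ^ 'm \<Rightarrow> complex mat" where "H v \<equiv> pencil n A v"

lemma A_carrier: "A j \<in> carrier_mat n n" using hermitianD(1)[OF herm] .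

lemma H_herm: "hermitian_mat n (H v)" by (rule hermitian_pencil[OF herm])

section \<open>Vertices of the hull and their projections\<close>

definition normal_cone :: "real ^ 'm \<Rightarrow> (real ^ 'm) set" where
  "normal_cone p = {v. \<forall>q\<in>T. inner v q \<le> inner v p}"

text \<open>\<open>T\<close> may contain redundant points. A cone with interior spans the space, as
  the linearity arguments require, and this forces \<open>p\<close> to be extreme
  (\<open>vertex_in_range\<close>).\<close>

definition vertices :: "(real ^ 'm) set" where
  "vertices = {p \<in> T. interior (normal_cone p) \<noteq> {}}"

lemma finite_vertices: "finite vertices" using T by (simp add: vertices_def)

lemma closed_normal_cone: "closed (normal_cone p)"
proof -
  have "normal_cone p = (\<Inter>q\<in>T. {v. inner v q \<le> inner v p})" by (auto simp: normal_cone_def)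
  moreover have "closed {v. inner v q \<le> inner v p}" for q
    by (intro closed_Collect_le continuous_intros)
  ultimately show ?thesis by auto
qed

lemma diag_range_point: "unitary_mat n U \<Longrightarrow>
    vec_lambda (\<lambda>j. \<Sum>i<n. c i * Re ((adj U * A j * U) $$ (i, i))) \<in> diag_range n c A"
  unfolding diag_range_def by auto

lemma T_nonempty: "T \<noteq> {}"
  using diag_range_point[OF unitary_one] T(2) hull_subset[of "diag_range n c A" convex] by auto

text \<open>Every linear functional attains its maximum on the finite set \<open>T\<close>, so all
  cones together cover. The complement of the cones of the vertices is open and lies in a finite
  union of closed sets without interior, hence is empty.\<close>

lemma cones_cover: "\<exists>p\<in>vertices. v \<in> normal_cone p"
proof -
  have all: "\<exists>p\<in>T. v \<in> normal_cone p" for v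
  proof -
    have "Max (inner v ` T) \<in> inner v ` T" using T T_nonempty by (intro Max_in) auto
    then obtain p where p: "p \<in> T" "inner v p = Max (inner v ` T)" by auto
    have "inner v q \<le> inner v p" if "q \<in> T" for q
      unfolding p(2) using T that by (intro Max_ge) auto
    then show ?thesis using p(1) unfolding normal_cone_def by blast
  qed
  show ?thesis
  proof (rule ccontr)
    assume neg: "\<not> ?thesis"
    define G where "G = (\<Union>p\<in>vertices. normal_cone p)"
    have "closed G" unfolding G_def using finite_vertices closed_normal_cone by (intro closed_UN) auto
    then have op: "open (- G)" by (simp add: open_Compl)
    have "- G \<subseteq> \<Union>(normal_cone ` (T - vertices))" using all unfolding G_def by blast
    moreover have "interior (\<Union>(normal_cone ` (T - vertices))) = {}"
      using T closed_normal_cone by (intro interior_Union_empty) (auto simp: vertices_def)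
    ultimately have "- G = {}" using op interior_maximal by blast
    then show False using neg by (auto simp: G_def)
  qed
qed

lemma normal_cone_max:
  assumes "v \<in> normal_cone p" "w \<in> convex hull (diag_range n c A)"
  shows "inner v w \<le> inner v p"
  using convex_hull_inner_le[of T v "inner v p" w] assms T(2) by (auto simp: normal_cone_def)

lemma vertex_span: "p \<in> vertices \<Longrightarrow> rspan (normal_cone p) = UNIV"
  by (rule span_UNIV_of_interior) (simp add: vertices_def)

text \<open>If \<open>p\<close> were inside a segment of the hull, every \<open>v\<close> of its
  cone would be constant on the segment; as the cone spans, the segment degenerates. An extreme
  point of a hull belongs to the original set, so a unitary realizes \<open>p\<close> although only
  the hull is known to be polyhedral.\<close>

lemma vertex_in_range:
  assumes p: "p \<in> vertices"
  shows "p \<in> diag_range n c A"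
proof -
  have pT: "p \<in> convex hull T" using p by (auto simp: vertices_def hull_inc)
  have "p extreme_point_of (convex hull (diag_range n c A))"
    unfolding extreme_point_of_def
  proof (intro conjI ballI)
    show "p \<in> convex hull diag_range n c A" using pT T(2) by simp
    fix a b assume a: "a \<in> convex hull diag_range n c A" and b: "b \<in> convex hull diag_range n c A"
    show "p \<notin> open_segment a b"
    proof
      assume "p \<in> open_segment a b"
      then obtain u where ne: "a \<noteq> b" and u: "0 < u" "u < 1" and pu: "p = (1 - u) *\<^sub>R a + u *\<^sub>R b"
        by (auto simp: in_segment)
      have "normal_cone p \<subseteq> {v. inner (b - a) v = 0}"
      proof
        fix v assume v: "v \<in> normal_cone p"
        have le: "inner v a \<le> inner v p" "inner v b \<le> inner v p"
          using normal_cone_max[OF v] a b by auto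
        have "inner v p = (1 - u) * inner v a + u * inner v b" by (simp add: pu inner_simps)
        then have "(1 - u) * (inner v p - inner v a) + u * (inner v p - inner v b) = 0"
          by (simp add: algebra_simps)
        moreover have "0 \<le> (1 - u) * (inner v p - inner v a)" "0 \<le> u * (inner v p - inner v b)"
          using u le by auto
        ultimately have "(1 - u) * (inner v p - inner v a) = 0" "u * (inner v p - inner v b) = 0" by linarith+
        then have "inner v b = inner v a" using u by simp
        then show "v \<in> {v. inner (b - a) v = 0}" by (simp add: inner_commute inner_diff_right)
      qed
      then have "rspan (normal_cone p) \<subseteq> {v. inner (b - a) v = 0}"
        by (rule real_vector.span_minimal) (rule subspace_hyperplane)
      then have "inner (b - a) (b - a) = 0" using vertex_span[OF p] by blast
      then show False using ne by simp
    qed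
  qed
  then show ?thesis by (rule extreme_point_of_convex_hull)
qed

definition vertex_unitary :: "real ^ 'm \<Rightarrow> complex mat" where
  "vertex_unitary p = (SOME U. unitary_mat n U \<and>
     (\<forall>j. vec_nth p j = (\<Sum>i<n. c i * Re ((adj U * A j * U) $$ (i, i)))))"

definition proj :: "real ^ 'm \<Rightarrow> complex mat" where
  "proj p = vertex_unitary p * rdiag n (indic k) * adj (vertex_unitary p)"

lemma vertex_unitary:
  assumes "p \<in> vertices"
  shows "unitary_mat n (vertex_unitary p)"
    "vec_nth p j = (\<Sum>i<n. c i * Re ((adj (vertex_unitary p) * A j * vertex_unitary p) $$ (i, i)))"
proof -
  have "\<exists>U. unitary_mat n U \<and> (\<forall>j. vec_nth p j = (\<Sum>i<n. c i * Re ((adj U * A j * U) $$ (i, i))))"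
    using vertex_in_range[OF assms] by (simp add: diag_range_def)
  from someI_ex[OF this, folded vertex_unitary_def] show "unitary_mat n (vertex_unitary p)"
    "vec_nth p j = (\<Sum>i<n. c i * Re ((adj (vertex_unitary p) * A j * vertex_unitary p) $$ (i, i)))"
    by blast+
qed

lemma proj_facts:
  assumes "p \<in> vertices"
  shows "proj p \<in> carrier_mat n n" "adj (proj p) = proj p" "proj p * proj p = proj p"
  using projection_facts[OF vertex_unitary(1)[OF assms] proj_def] by auto

text \<open>Optimality for \<open>c\<close> passes to optimality for the indicator of the first \<open>k\<close> indices,
  because \<open>c\<close> minus a small multiple of that indicator is still antitone.\<close>

lemma vertex_optimal:
  assumes p: "p \<in> vertices" and v: "v \<in> normal_cone p" and dec: "diagonalizes n Y (H v) b" and b: "antitone n b"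
  shows "(\<Sum>i<k. Re ((adj (vertex_unitary p) * H v * vertex_unitary p) $$ (i, i))) = (\<Sum>i<k. b i)"
proof -
  let ?U = "vertex_unitary p"
  note U = vertex_unitary[OF p]
  note Y = diagonalizesD[OF dec]
  define h where "h i = Re ((adj ?U * H v * ?U) $$ (i, i))" for i
  \<comment> \<open>The range point of an eigenbasis of \<open>H v\<close>. It attains the bound of
    the trace inequality, so the maximizer \<open>p\<close> attains it too.\<close>
  define w :: "real ^ 'm" where "w = vec_lambda (\<lambda>j. \<Sum>i<n. c i * Re ((adj Y * A j * Y) $$ (i, i)))"
  have kn: "k \<le> n" "k - 1 < k" "k < n" using k by auto
  have "inner v w = (\<Sum>i<n. c i * Re ((adj Y * H v * Y) $$ (i, i)))"
    by (rule inner_diag_point[OF A_carrier Y(2)]) (simp add: w_def)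
  also have "\<dots> = (\<Sum>i<n. c i * b i)" unfolding Y(4) by (simp add: mat_diag_def)
  finally have vw: "inner v w = (\<Sum>i<n. c i * b i)" .
  have "w \<in> convex hull diag_range n c A" unfolding w_def by (rule hull_inc[OF diag_range_point[OF Y(1)]])
  from normal_cone_max[OF v this] have "(\<Sum>i<n. c i * b i) \<le> inner v p" by (simp add: vw)
  also have "inner v p = (\<Sum>i<n. c i * h i)"
    unfolding h_def by (rule inner_diag_point[OF A_carrier _ U(2)]) (rule unitaryD(1)[OF U(1)])
  finally have le: "(\<Sum>i<n. c i * b i) \<le> (\<Sum>i<n. c i * h i)" .
  define g where "g = c (k - 1) - c k"
  have g: "0 < g" using gap by (simp add: g_def)
  define c' where "c' i = c i - g * indic k i" for i
  have c': "antitone n c'"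
  proof (intro allI impI)
    fix i j assume ij: "i \<le> j" "j < n"
    have cij: "c j \<le> c i" using c ij by auto
    show "c' j \<le> c' i"
    proof (cases "i < k \<and> \<not> j < k")
      case True
      then have "c (k - 1) \<le> c i" "c j \<le> c k" using c ij kn by auto
      then show ?thesis using True by (simp add: c'_def g_def)
    next
      case False
      then show ?thesis using cij ij by (auto simp: c'_def)
    qed
  qed
  have le1: "(\<Sum>i<n. c' i * h i) \<le> (\<Sum>i<n. c' i * b i)"
    unfolding h_def by (rule trace_rearrangement[OF dec U(1) antitone_similarly_ordered[OF c' b]])
  have anti: "antitone n (indic k)" by auto
  have "(\<Sum>i<n. indic k i * h i) \<le> (\<Sum>i<n. indic k i * b i)"
    unfolding h_def by (rule trace_rearrangement[OF dec U(1) antitone_similarly_ordered[OF anti b]])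
  then have le2: "(\<Sum>i<k. h i) \<le> (\<Sum>i<k. b i)" unfolding sum_indic[OF kn(1)] .
  have split: "(\<Sum>i<n. c i * f i) = (\<Sum>i<n. c' i * f i) + g * (\<Sum>i<k. f i)" for f
    unfolding sum_indic[OF kn(1), symmetric] sum_distrib_left sum.distrib[symmetric]
    by (intro sum.cong refl) (simp add: c'_def algebra_simps)
  have "g * (\<Sum>i<k. b i) \<le> g * (\<Sum>i<k. h i)" using le le1 unfolding split by linarith
  then have "(\<Sum>i<k. b i) \<le> (\<Sum>i<k. h i)" using g by simp
  then show ?thesis using le2 by (simp add: h_def)
qed

lemma proj_separates:
  assumes "p \<in> vertices" "v \<in> normal_cone p" "diagonalizes n Y (H v) b" "antitone n b"
  shows "separates n (proj p) (H v) (b (k - 1))"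
  by (rule optimal_projection(2)[OF assms(3,4) vertex_unitary(1)[OF assms(1)] _ _ proj_def vertex_optimal[OF assms]])
     (use k in auto)

text \<open>For \<open>v\<close> in the cone of \<open>p\<close> this is the equality case of Ky
  Fan. The projection does not depend on \<open>v\<close> and the cone spans, so linearity extends
  it to all \<open>v\<close>.\<close>

lemma proj_commutes:
  assumes p: "p \<in> vertices"
  shows "proj p * H v = H v * proj p"
proof -
  have "normal_cone p \<subseteq> {v. proj p * H v = H v * proj p}"
  proof
    fix v assume v: "v \<in> normal_cone p"
    obtain Y b where Y: "diagonalizes n Y (H v) b" "antitone n b" using spectral_sorted[OF H_herm] by blast
    have "proj p * H v = H v * proj p"
      by (rule optimal_projection(1)[OF Y vertex_unitary(1)[OF p] _ _ proj_def vertex_optimal[OF p v Y]])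
         (use k in auto)
    then show "v \<in> {v. proj p * H v = H v * proj p}" by simp
  qed
  then have "rspan (normal_cone p) \<subseteq> {v. proj p * H v = H v * proj p}"
    by (rule real_vector.span_minimal) (rule subspace_commuting[OF proj_facts(1)[OF p]])
  then show ?thesis using vertex_span[OF p] by auto
qed

section \<open>The complement of the joint eigenvectors\<close>

definition F :: "complex mat" where "F = rdiag n (\<lambda>i. if i < l then 0 else 1)"

lemma F_facts: "F \<in> carrier_mat n n" "adj F = F" "F * F = F"
proof -
  show "F \<in> carrier_mat n n" "adj F = F" by (auto simp: F_def)
  show "F * F = F" unfolding F_def mat_diag_diag by (rule arg_cong[of _ _ "mat_diag n"]) auto
qed

lemma H_off_diag:
  assumes "i < n" "t < l" "i \<noteq> t"
  shows "H v $$ (i, t) = 0" "H v $$ (t, i) = 0"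
proof -
  have t: "t < n" using assms l by simp
  show "H v $$ (i, t) = 0" unfolding pencil_index[OF assms(1) t]
    using dg assms by (intro sum.neutral) (auto simp: diag_upto_def)
  show "H v $$ (t, i) = 0" unfolding pencil_index[OF t assms(1)]
    using hermitian_diag_upto_row[OF herm dg l assms] by (intro sum.neutral) auto
qed

lemma F_commutes: "F * H v = H v * F"
proof (rule eq_matI)
  fix i j assume "i < dim_row (H v * F)" "j < dim_col (H v * F)"
  then have ij: "i < n" "j < n" using F_facts(1) by (auto simp: pencil_def)
  show "(F * H v) $$ (i, j) = (H v * F) $$ (i, j)"
    unfolding F_def rdiag_sandwich_index[OF pencil_carrier ij]
    using H_off_diag[of i j v] H_off_diag[of j i v] ij by (cases "i < l"; cases "j < l"; cases "i = j") auto
qed (use F_facts in \<open>auto simp: pencil_def\<close>)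

lemma F_row: "M \<in> carrier_mat n m \<Longrightarrow> i < l \<Longrightarrow> j < m \<Longrightarrow> (F * M) $$ (i, j) = 0"
  using l unfolding F_def by (subst mat_diag_mult_left[of _ n m]) auto

lemma F_fix:
  assumes "x \<in> carrier_vec n" "\<And>i. i < l \<Longrightarrow> x $ i = 0"
  shows "F *\<^sub>v x = x"
proof (rule eq_vecI)
  fix i assume "i < dim_vec x"
  then have i: "i < n" using assms by simp
  have "(F *\<^sub>v x) $ i = (\<Sum>p<n. if p = i then (if i < l then 0 else x $ i) else 0)"
    unfolding mult_vec_index[OF F_facts(1) assms(1) i] using i
    by (intro sum.cong refl) (auto simp: F_def mat_diag_def)
  then show "(F *\<^sub>v x) $ i = x $ i" using i assms(2) by simp
qed (use assms F_facts in auto)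

lemma no_common_eigenvector:
  assumes x: "x \<in> carrier_vec n" "\<And>i. i < l \<Longrightarrow> x $ i = 0" and ev: "\<And>v. \<exists>a. H v *\<^sub>v x = a \<cdot>\<^sub>v x"
  shows "x = 0\<^sub>v n"
proof (rule ccontr)
  assume "x \<noteq> 0\<^sub>v n"
  moreover have "\<exists>a. A j *\<^sub>v x = a \<cdot>\<^sub>v x" for j
    using ev[of "axis j 1"] unfolding pencil_axis[OF A_carrier] .
  ultimately have "joint_ev n l A x" using x by (auto simp: joint_ev_def)
  then show False using nj by blast
qed

text \<open>If y is an eigenvector of the single matrix \<open>H a\<close>, then \<open>M\<close> y
  is one as well or zero, and every \<open>H v\<close> with \<open>v\<close> in \<open>S\<close>
  acts on it by a scalar; by linearity so does the whole pencil. As it vanishes on the first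
  \<open>l\<close> coordinates, maximality of \<open>l\<close> makes it zero. One direction outside
  \<open>S\<close> thus comes for free, and a spanning subset of a hyperplane suffices for
  \<open>S\<close>.\<close>

lemma scalar_on_span_zero:
  assumes M: "M \<in> carrier_mat n n" and comm: "\<And>v. H v * M = M * H v"
    and rows: "\<And>i j. i < l \<Longrightarrow> j < n \<Longrightarrow> M $$ (i, j) = 0"
    and S: "\<And>v. v \<in> S \<Longrightarrow> \<exists>lam. H v * M = lam \<cdot>\<^sub>m M"
    and span: "rspan (insert a S) = UNIV"
  shows "M = 0\<^sub>m n n"
proof -
  obtain Y b where Y: "diagonalizes n Y (H a) b" and "antitone n b"
    using spectral_sorted[OF H_herm] by blast
  note YD = diagonalizesD[OF Y]
  show ?thesis
  proof (rule mat_eq_on_columns[OF YD(1) M])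
    fix j assume j: "j < n"
    let ?y = "col Y j" and ?x = "M *\<^sub>v col Y j"
    note y = diagonalizes_column[OF Y j]
    have x: "?x \<in> carrier_vec n" using M y(1) by auto
    have "insert a S \<subseteq> {v. \<exists>r. H v *\<^sub>v ?x = r \<cdot>\<^sub>v ?x}"
    proof
      fix v assume "v \<in> insert a S"
      then consider "v = a" | "v \<in> S" by blast
      then show "v \<in> {v. \<exists>r. H v *\<^sub>v ?x = r \<cdot>\<^sub>v ?x}"
      proof cases
        case 1
        then show ?thesis using commuting_eigen[OF M pencil_carrier comm y] by blast
      next
        case 2
        then obtain lam where lam: "H v * M = lam \<cdot>\<^sub>m M" using S by blast
        have "H v *\<^sub>v ?x = (lam \<cdot>\<^sub>m M) *\<^sub>v ?y"
          unfolding lam[symmetric] by (rule assoc_mult_mat_vec[OF pencil_carrier M y(1), symmetric])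
        also have "\<dots> = lam \<cdot>\<^sub>v ?x" by (rule smult_mat_mult_vec[OF M y(1)])
        finally show ?thesis by blast
      qed
    qed
    then have "rspan (insert a S) \<subseteq> {v. \<exists>r. H v *\<^sub>v ?x = r \<cdot>\<^sub>v ?x}"
      by (rule real_vector.span_minimal) (rule subspace_eigen[OF x])
    then have "\<exists>r. H v *\<^sub>v ?x = r \<cdot>\<^sub>v ?x" for v using span by auto
    moreover have "?x $ i = 0" if "i < l" for i
      using that l rows y(1) by (subst mult_vec_index[OF M]) (auto intro!: sum.neutral)
    ultimately have "?x = 0\<^sub>v n" by (intro no_common_eigenvector[OF x]) auto
    also have "\<dots> = 0\<^sub>m n n *\<^sub>v ?y" using y(1) by (intro eq_vecI) auto
    finally show "?x = 0\<^sub>m n n *\<^sub>v ?y" .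
  qed auto
qed

end

lemma commute_mult:
  fixes M N H :: "complex mat"
  assumes "M \<in> carrier_mat n n" "N \<in> carrier_mat n n" "H \<in> carrier_mat n n"
    "M * H = H * M" "N * H = H * N"
  shows "M * N * H = H * (M * N)"
proof -
  have "M * N * H = M * (N * H)" using assms(1-3) by (rule sq_assoc)
  also have "\<dots> = M * H * N" unfolding assms(5) using sq_assoc[OF assms(1,3,2)] by simp
  also have "\<dots> = H * (M * N)" unfolding assms(4) using assms(3,1,2) by (rule sq_assoc)
  finally show ?thesis .
qed

lemma commute_minus:
  fixes M N H :: "complex mat"
  assumes "M \<in> carrier_mat n n" "N \<in> carrier_mat n n" "H \<in> carrier_mat n n"
    "M * H = H * M" "N * H = H * N"
  shows "(M - N) * H = H * (M - N)"
  unfolding minus_mult_distrib_mat[OF assms(1-3)] mult_minus_distrib_mat[OF assms(3,1,2)] assms(4,5) ..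

lemma mat_minus_eq_0:
  fixes M N :: "complex mat"
  assumes "M \<in> carrier_mat n n" "N \<in> carrier_mat n n" "M - N = 0\<^sub>m n n"
  shows "M = N"
proof (rule eq_matI)
  fix i j assume "i < dim_row N" "j < dim_col N"
  then have "i < n" "j < n" using assms(2) by auto
  then have "(M - N) $$ (i, j) = 0" using assms(3) by simp
  then show "M $$ (i, j) = N $$ (i, j)" using assms(1,2) \<open>i < n\<close> \<open>j < n\<close> by simp
qed (use assms in auto)

lemma separatesD:
  assumes "separates n P H lam" "x \<in> carrier_vec n" "H *\<^sub>v x = complex_of_real a \<cdot>\<^sub>v x"
  shows "lam < a \<Longrightarrow> P *\<^sub>v x = x" "a < lam \<Longrightarrow> P *\<^sub>v x = 0\<^sub>v n"
  using assms unfolding separates_def by blast+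

lemma smult_zero_vec_mat: "a \<cdot>\<^sub>v 0\<^sub>v n = (0\<^sub>v n :: complex vec)"
  by (rule eq_vecI) auto

lemma mult_unit_vec:
  fixes M :: "complex mat"
  assumes "M \<in> carrier_mat n n" "t < n" "i < n"
  shows "(M *\<^sub>v unit_vec n t) $ i = M $$ (i, t)"
proof -
  have "(M *\<^sub>v unit_vec n t) $ i = (\<Sum>p<n. if p = t then M $$ (i, t) else 0)"
    unfolding mult_vec_index[OF assms(1) unit_vec_carrier assms(3)]
    using assms by (intro sum.cong refl) (auto simp: unit_vec_def)
  then show ?thesis using assms by simp
qed

lemma diagonalizes_uminus:
  assumes "diagonalizes n Y H b"
  shows "diagonalizes n Y (- H) (\<lambda>i. - b i)"
proof -
  note Y = diagonalizesD[OF assms]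
  have "adj Y * (- H) * Y = rdiag n (\<lambda>i. - b i)"
  proof (rule eq_matI)
    fix i j assume "i < dim_row (rdiag n (\<lambda>i. - b i))" "j < dim_col (rdiag n (\<lambda>i. - b i))"
    then have ij: "i < n" "j < n" by (auto simp: mat_diag_def)
    have "(adj Y * (- H) * Y) $$ (i, j) = - (adj Y * H * Y) $$ (i, j)"
      unfolding conj_index[OF uminus_carrier_mat[OF Y(3)] Y(2) ij] conj_index[OF Y(3,2) ij] sum_negf[symmetric]
      using Y(3) by (intro sum.cong refl) auto
    then show "(adj Y * (- H) * Y) $$ (i, j) = rdiag n (\<lambda>i. - b i) $$ (i, j)"
      unfolding Y(4) using ij by (simp add: mat_diag_def)
  qed (use Y in \<open>auto simp: mat_diag_def\<close>)
  then show ?thesis using Y by (simp add: diagonalizes_def)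
qed

definition reversal :: "nat \<Rightarrow> nat \<Rightarrow> nat" where
  "reversal n i = (if i < n then n - Suc i else i)"

lemma reversal_permutes: "reversal n permutes {..<n}"
proof (rule bij_imp_permutes)
  show "bij_betw (reversal n) {..<n} {..<n}"
    by (rule bij_betw_byWitness[where f' = "reversal n"]) (auto simp: reversal_def)
qed (simp add: reversal_def)

text \<open>If the first \<open>l\<close> columns of \<open>H\<close> are diagonal, the eigenvectors vanishing on the first
  \<open>l\<close> coordinates are those of the complementary block.\<close>

definition dominated_below :: "nat \<Rightarrow> nat \<Rightarrow> nat \<Rightarrow> complex mat \<Rightarrow> bool" where
  "dominated_below n k l H \<longleftrightarrow> (\<exists>lam. k \<le> card {i. i < l \<and> lam \<le> Re (H $$ (i, i))} \<and>
     (\<forall>x a. x \<in> carrier_vec n \<longrightarrow> x \<noteq> 0\<^sub>v n \<longrightarrow> (\<forall>i<l. x $ i = 0) \<longrightarrow>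
        H *\<^sub>v x = complex_of_real a \<cdot>\<^sub>v x \<longrightarrow> a \<le> lam))"

text \<open>These columns are the test vectors for \<open>dominated_below\<close>: an orthonormal
  eigenbasis of the complement of the first \<open>l\<close> coordinates.\<close>

lemma lower_eigencolumn:
  assumes V: "diagonalizes n V H b" and l: "l \<le> n" and i: "i < n" "l \<le> i"
    and Vt: "\<And>i t. i < n \<Longrightarrow> t < l \<Longrightarrow> V $$ (i, t) = (if i = t then 1 else 0)"
  shows "col V i \<in> carrier_vec n" "col V i \<noteq> 0\<^sub>v n" "\<forall>t<l. col V i $ t = 0"
    "H *\<^sub>v col V i = complex_of_real (b i) \<cdot>\<^sub>v col V i"
proof -
  note VD = diagonalizesD[OF V]
  show "col V i \<in> carrier_vec n" "H *\<^sub>v col V i = complex_of_real (b i) \<cdot>\<^sub>v col V i"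
    using diagonalizes_column[OF V i(1)] by auto
  show "\<forall>t<l. col V i $ t = 0"
    using fixed_columns_adj[OF VD(1) l Vt i(1)] VD(2) i l by auto
  show "col V i \<noteq> 0\<^sub>v n"
  proof
    assume z: "col V i = 0\<^sub>v n"
    have "V $$ (t, i) = 0" if "t < n" for t
    proof -
      have "col V i $ t = 0" using z that by simp
      then show ?thesis using VD(2) that i(1) by simp
    qed
    then show False using unitary_sums(1)[OF VD(1) i(1) i(1)] by simp
  qed
qed

section \<open>Scalar action on walls and between antipodal cones\<close>

context polyhedral_core
begin

lemma H_unit_vec:
  assumes "t < l"
  shows "H v *\<^sub>v unit_vec n t = complex_of_real (Re (H v $$ (t, t))) \<cdot>\<^sub>v unit_vec n t"
proof (rule eq_vecI)
  have t: "t < n" using assms l by simp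
  fix i assume "i < dim_vec (complex_of_real (Re (H v $$ (t, t))) \<cdot>\<^sub>v unit_vec n t)"
  then have i: "i < n" by simp
  show "(H v *\<^sub>v unit_vec n t) $ i = (complex_of_real (Re (H v $$ (t, t))) \<cdot>\<^sub>v unit_vec n t) $ i"
    unfolding mult_unit_vec[OF pencil_carrier t i]
    using H_off_diag(1)[OF i assms] hermitian_diag_real[OF H_herm t] i t by (cases "i = t") auto
qed (simp add: pencil_def)

text \<open>\<open>proj p\<close> commutes with the pencil, so \<open>F * proj p\<close> maps a
  split-off unit vector to a joint eigenvector in the complement or to zero, hence to zero. This
  says F P = F P F, and taking adjoints gives the claim.\<close>

lemma F_proj_commute:
  assumes p: "p \<in> vertices"
  shows "F * proj p = proj p * F"
proof -
  let ?P = "proj p"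
  note P = proj_facts[OF p] and Fc = F_facts(1)
  have FP: "F * ?P \<in> carrier_mat n n" by (rule sq_mult[OF Fc P(1)])
  have comm: "H v * (F * ?P) = F * ?P * H v" for v
    by (rule commute_mult[symmetric, OF Fc P(1) pencil_carrier F_commutes proj_commutes[OF p]])
  have zero: "(F * ?P) $$ (i, t) = 0" if t: "t < l" and i: "i < n" for i t
  proof -
    have tn: "t < n" using t l by simp
    have "F * ?P *\<^sub>v unit_vec n t = 0\<^sub>v n"
    proof (rule no_common_eigenvector)
      show "F * ?P *\<^sub>v unit_vec n t \<in> carrier_vec n" by (rule mult_mat_vec_carrier[OF FP unit_vec_carrier])
      show "(F * ?P *\<^sub>v unit_vec n t) $ i = 0" if "i < l" for i
        using mult_unit_vec[OF FP tn, of i] F_row[OF P(1) that tn] that l by simp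
      show "\<exists>a. H v *\<^sub>v (F * ?P *\<^sub>v unit_vec n t) = a \<cdot>\<^sub>v (F * ?P *\<^sub>v unit_vec n t)" for v
        using commuting_eigen[OF FP pencil_carrier comm unit_vec_carrier H_unit_vec[OF t]] by blast
    qed
    then show ?thesis using mult_unit_vec[OF FP tn i] i by simp
  qed
  have FPF: "F * ?P * F = F * ?P"
  proof (rule eq_matI)
    fix i j assume "i < dim_row (F * ?P)" "j < dim_col (F * ?P)"
    then have "i < n" "j < n" using FP by auto
    then show "(F * ?P * F) $$ (i, j) = (F * ?P) $$ (i, j)"
      using rdiag_sandwich_index(1)[OF FP, of i j] zero unfolding F_def[symmetric]
      by (subst (2) F_def) (simp add: rdiag_sandwich_index(1)[OF FP])
  qed (use FP Fc in auto)
  have "adj (F * ?P * F) = F * ?P * F"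
    using adj_mult[OF FP Fc] adj_mult[OF Fc P(1)] P(2) F_facts(2) sq_assoc[OF Fc P(1) Fc] by simp
  moreover have "adj (F * ?P) = ?P * F" using adj_mult[OF Fc P(1)] P(2) F_facts(2) by simp
  ultimately show ?thesis using FPF by simp
qed

text \<open>Both projections separate the same \<open>H v\<close> at the same k-th eigenvalue.
  Eigenvectors above it are fixed by both and those below it are killed by \<open>proj p\<close>, so
  the difference lives on that one eigenspace.\<close>

lemma wall_scalar:
  assumes p: "p \<in> vertices" and q: "q \<in> vertices" and v: "v \<in> normal_cone p" "v \<in> normal_cone q"
  shows "\<exists>lam. H v * (proj p - proj q * proj p) = lam \<cdot>\<^sub>m (proj p - proj q * proj p)"
proof -
  obtain Y b where Y: "diagonalizes n Y (H v) b" and b: "antitone n b"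
    using spectral_sorted[OF H_herm] by blast
  let ?P = "proj p" and ?Q = "proj q" and ?lam = "b (k - 1)"
  let ?Z = "?P - ?Q * ?P"
  note P = proj_facts(1)[OF p] and Q = proj_facts(1)[OF q]
  have QP: "?Q * ?P \<in> carrier_mat n n" by (rule sq_mult[OF Q P])
  have Z: "?Z \<in> carrier_mat n n" by (rule minus_carrier_mat[OF QP])
  have comm: "H v * ?Z = ?Z * H v"
    by (rule commute_minus[symmetric, OF P QP pencil_carrier proj_commutes[OF p]
          commute_mult[OF Q P pencil_carrier proj_commutes[OF q] proj_commutes[OF p]]])
  have "H v * ?Z = complex_of_real ?lam \<cdot>\<^sub>m ?Z"
  proof (rule mat_eq_on_columns[OF diagonalizesD(1)[OF Y]])
    show "H v * ?Z \<in> carrier_mat n n" by (rule sq_mult[OF pencil_carrier Z])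
    show "complex_of_real ?lam \<cdot>\<^sub>m ?Z \<in> carrier_mat n n" using Z by simp
    fix j assume j: "j < n"
    let ?y = "col Y j"
    note y = diagonalizes_column[OF Y j]
    have Zy: "?Z *\<^sub>v ?y = ?P *\<^sub>v ?y - ?Q *\<^sub>v (?P *\<^sub>v ?y)"
      unfolding minus_mult_distrib_mat_vec[OF P QP y(1)] assoc_mult_mat_vec[OF Q P y(1)] ..
    have "H v *\<^sub>v (?Z *\<^sub>v ?y) = complex_of_real ?lam \<cdot>\<^sub>v (?Z *\<^sub>v ?y)"
    proof (cases "b j = ?lam")
      case True
      then show ?thesis using commuting_eigen[OF Z pencil_carrier comm y] by simp
    next
      case False
      have "?Z *\<^sub>v ?y = 0\<^sub>v n"
      proof (cases "?lam < b j")
        case True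
        note sP = separatesD(1)[OF proj_separates[OF p v(1) Y b] y True]
        note sQ = separatesD(1)[OF proj_separates[OF q v(2) Y b] y True]
        show ?thesis unfolding Zy sP sQ using y(1) by simp
      next
        case False
        then have "b j < ?lam" using \<open>b j \<noteq> ?lam\<close> by simp
        note sP = separatesD(2)[OF proj_separates[OF p v(1) Y b] y this]
        show ?thesis unfolding Zy sP mult_zero_vec[OF Q] by simp
      qed
      then show ?thesis by (simp add: mult_zero_vec[OF pencil_carrier] smult_zero_vec_mat)
    qed
    then show "H v * ?Z *\<^sub>v ?y = (complex_of_real ?lam \<cdot>\<^sub>m ?Z) *\<^sub>v ?y"
      unfolding smult_mat_mult_vec[OF Z y(1)] assoc_mult_mat_vec[OF pencil_carrier Z y(1)] .
  qed
  then show ?thesis by blast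
qed

text \<open>The top \<open>k\<close> and the bottom \<open>k\<close> eigenvalues of \<open>H v\<close> meet at most in one value,
  since \<open>2 * k \<le> n\<close>.\<close>

lemma antipodal_scalar:
  assumes p: "p \<in> vertices" and q: "q \<in> vertices" and v: "v \<in> normal_cone p" "- v \<in> normal_cone q"
  shows "\<exists>lam. H v * (proj p * proj q) = lam \<cdot>\<^sub>m (proj p * proj q)"
proof -
  obtain Y b where Y: "diagonalizes n Y (H v) b" and b: "antitone n b"
    using spectral_sorted[OF H_herm] by blast
  have Y': "diagonalizes n Y (H (- v)) (\<lambda>i. - b i)"
    unfolding pencil_minus by (rule diagonalizes_uminus[OF Y])
  have Yr: "diagonalizes n (permute_cols n (reversal n) Y) (H (- v)) ((\<lambda>i. - b i) \<circ> reversal n)"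
    by (rule diagonalizes_permute[OF Y' reversal_permutes])
  have br: "antitone n ((\<lambda>i. - b i) \<circ> reversal n)" using b by (auto simp: reversal_def)
  let ?P = "proj p" and ?Q = "proj q" and ?lam = "b (k - 1)"
  let ?mu = "((\<lambda>i. - b i) \<circ> reversal n) (k - 1)"
  \<comment> \<open>Negation reverses the order, so position k - 1 for \<open>- v\<close> is
    position n - k of \<open>b\<close>. As 2 k is at most n, \<open>b (n - k)\<close> does not
    exceed \<open>b (k - 1)\<close>; an eigenvector of \<open>H v\<close> above the latter is
    therefore killed by the projection for \<open>- v\<close>.\<close>
  have mu: "?mu = - b (n - k)" using k by (simp add: reversal_def)
  have lam: "b (n - k) \<le> ?lam" using b k by auto
  note sepP = proj_separates[OF p v(1) Y b] and sepQ = proj_separates[OF q v(2) Yr br]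
  note P = proj_facts(1)[OF p] and Q = proj_facts(1)[OF q]
  have PQ: "?P * ?Q \<in> carrier_mat n n" by (rule sq_mult[OF P Q])
  have comm: "H v * (?P * ?Q) = ?P * ?Q * H v"
    by (rule commute_mult[symmetric, OF P Q pencil_carrier proj_commutes[OF p] proj_commutes[OF q]])
  have "H v * (?P * ?Q) = complex_of_real ?lam \<cdot>\<^sub>m (?P * ?Q)"
  proof (rule mat_eq_on_columns[OF diagonalizesD(1)[OF Y]])
    show "H v * (?P * ?Q) \<in> carrier_mat n n" by (rule sq_mult[OF pencil_carrier PQ])
    show "complex_of_real ?lam \<cdot>\<^sub>m (?P * ?Q) \<in> carrier_mat n n" using PQ by simp
    fix j assume j: "j < n"
    let ?y = "col Y j"
    note y = diagonalizes_column[OF Y j] and y' = diagonalizes_column[OF Y' j]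
    have "H v *\<^sub>v (?P * ?Q *\<^sub>v ?y) = complex_of_real ?lam \<cdot>\<^sub>v (?P * ?Q *\<^sub>v ?y)"
    proof (cases "b j = ?lam")
      case True
      then show ?thesis using commuting_eigen[OF PQ pencil_carrier comm y] by simp
    next
      case False
      have "?P *\<^sub>v (?Q *\<^sub>v ?y) = 0\<^sub>v n"
      proof (cases "?lam < b j")
        case True
        then have "- b j < ?mu" unfolding mu using lam by simp
        note sQ = separatesD(2)[OF sepQ y' this]
        show ?thesis unfolding sQ mult_zero_vec[OF P] ..
      next
        case False
        then have lt: "b j < ?lam" using \<open>b j \<noteq> ?lam\<close> by simp
        have Qy: "?Q *\<^sub>v ?y \<in> carrier_vec n" by (rule mult_mat_vec_carrier[OF Q y(1)])
        have "H v *\<^sub>v (?Q *\<^sub>v ?y) = complex_of_real (b j) \<cdot>\<^sub>v (?Q *\<^sub>v ?y)"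
          by (rule commuting_eigen[OF Q pencil_carrier proj_commutes[OF q, symmetric] y])
        from separatesD(2)[OF sepP Qy this lt] show ?thesis .
      qed
      then show ?thesis unfolding assoc_mult_mat_vec[OF P Q y(1)]
        by (simp add: mult_zero_vec[OF pencil_carrier] smult_zero_vec_mat)
    qed
    then show "H v * (?P * ?Q) *\<^sub>v ?y = (complex_of_real ?lam \<cdot>\<^sub>m (?P * ?Q)) *\<^sub>v ?y"
      unfolding smult_mat_mult_vec[OF PQ y(1)] assoc_mult_mat_vec[OF pencil_carrier PQ y(1)] .
  qed
  then show ?thesis by blast
qed

text \<open>On the split-off joint eigenvectors the two projections may differ; multiplying by
  \<open>F\<close> removes these. What remains is scalar for all \<open>v\<close> in the wall, so
  \<open>scalar_on_span_zero\<close> applies once the wall and \<open>a\<close> span.\<close>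

lemma wall_absorb:
  assumes p: "p \<in> vertices" and q: "q \<in> vertices"
    and span: "rspan (insert a (normal_cone p \<inter> normal_cone q)) = UNIV"
  shows "proj q * (proj p * F) = proj p * F"
proof -
  let ?P = "proj p" and ?Q = "proj q"
  let ?Z = "?P - ?Q * ?P"
  note P = proj_facts(1)[OF p] and Q = proj_facts(1)[OF q] and Fc = F_facts(1)
  have QP: "?Q * ?P \<in> carrier_mat n n" by (rule sq_mult[OF Q P])
  have Z: "?Z \<in> carrier_mat n n" by (rule minus_carrier_mat[OF QP])
  have FZ: "F * ?Z \<in> carrier_mat n n" by (rule sq_mult[OF Fc Z])
  have ZH: "?Z * H v = H v * ?Z" for v
    by (rule commute_minus[OF P QP pencil_carrier proj_commutes[OF p]
          commute_mult[OF Q P pencil_carrier proj_commutes[OF q] proj_commutes[OF p]]])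
  have ZF: "?Z * F = F * ?Z"
    by (rule commute_minus[OF P QP Fc F_proj_commute[OF p, symmetric]
          commute_mult[OF Q P Fc F_proj_commute[OF q, symmetric] F_proj_commute[OF p, symmetric]]])
  have "F * ?Z = 0\<^sub>m n n"
  proof (rule scalar_on_span_zero[OF FZ _ _ _ span])
    show "H v * (F * ?Z) = F * ?Z * H v" for v
      by (rule commute_mult[symmetric, OF Fc Z pencil_carrier F_commutes ZH])
    show "(F * ?Z) $$ (i, j) = 0" if "i < l" "j < n" for i j by (rule F_row[OF Z that])
    fix v assume "v \<in> normal_cone p \<inter> normal_cone q"
    then obtain lam where lam: "H v * ?Z = lam \<cdot>\<^sub>m ?Z" using wall_scalar[OF p q] by blast
    have "H v * (F * ?Z) = H v * F * ?Z" by (rule sq_assoc[symmetric, OF pencil_carrier Fc Z])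
    also have "\<dots> = F * (H v * ?Z)" unfolding F_commutes[symmetric] by (rule sq_assoc[OF Fc pencil_carrier Z])
    also have "\<dots> = lam \<cdot>\<^sub>m (F * ?Z)" unfolding lam by (rule mult_smult_distrib[OF Fc Z])
    finally show "\<exists>lam. H v * (F * ?Z) = lam \<cdot>\<^sub>m (F * ?Z)" by blast
  qed
  then have "?P * F - ?Q * ?P * F = 0\<^sub>m n n"
    unfolding ZF[symmetric] minus_mult_distrib_mat[OF P QP Fc] .
  then have "?P * F = ?Q * ?P * F"
    by (rule mat_minus_eq_0[OF sq_mult[OF P Fc] sq_mult[OF QP Fc]])
  then show ?thesis using sq_assoc[OF Q P Fc] by simp
qed

text \<open>If some vertex failed, the cone over the walls between good and bad vertices, seen from an
  interior point \<open>a\<close> of a good cone, would cover a ball inside a bad cone. Hence one of these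
  walls spans a hyperplane, and \<open>wall_absorb\<close> transports goodness across it.\<close>

lemma all_absorb:
  assumes p0: "p0 \<in> vertices" and q0: "q0 \<in> vertices"
  shows "proj q0 * (proj p0 * F) = proj p0 * F"
proof (rule ccontr)
  assume bad0: "\<not> ?thesis"
  define M where "M = proj p0 * F"
  define good where "good = {q \<in> vertices. proj q * M = M}"
  define bad where "bad = vertices - good"
  have M: "M \<in> carrier_mat n n" unfolding M_def by (rule sq_mult[OF proj_facts(1)[OF p0] F_facts(1)])
  have p0g: "p0 \<in> good"
    unfolding good_def M_def using p0 proj_facts(3)[OF p0]
      sq_assoc[OF proj_facts(1)[OF p0] proj_facts(1)[OF p0] F_facts(1)] by simp
  have q0b: "q0 \<in> bad" using q0 bad0 by (simp add: bad_def good_def M_def)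
  have fin: "finite good" "finite bad" using finite_vertices by (auto simp: good_def bad_def)
  define G where "G = (\<Union>p\<in>good. normal_cone p)"
  define B where "B = (\<Union>q\<in>bad. normal_cone q)"
  have cl: "closed G" "closed B" unfolding G_def B_def using fin closed_normal_cone by auto
  have cover: "G \<union> B = UNIV" using cones_cover unfolding G_def B_def bad_def by blast
  obtain a where a: "a \<in> interior (normal_cone p0)" using p0 by (auto simp: vertices_def)
  obtain b0 where b0: "b0 \<in> interior (normal_cone q0)" using q0 by (auto simp: vertices_def)
  have aG: "a \<in> G" using a interior_subset p0g by (auto simp: G_def)
  \<comment> \<open>Otherwise \<open>q\<close> and \<open>p0\<close> both maximize the inner product
    with \<open>a\<close>. A small move of \<open>a\<close> in the direction \<open>q - p0\<close>
    stays in the cone of \<open>p0\<close> yet favours \<open>q\<close>, unless the two points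
    coincide.\<close>
  have aB: "a \<notin> B"
  proof
    assume "a \<in> B"
    then obtain q where q: "q \<in> bad" "a \<in> normal_cone q" by (auto simp: B_def)
    have ap: "a \<in> normal_cone p0" using a interior_subset by blast
    have pT: "p0 \<in> T" "q \<in> T" using p0 q by (auto simp: vertices_def bad_def)
    have eq: "inner a q = inner a p0"
      using ap q(2) pT by (intro antisym) (auto simp: normal_cone_def)
    obtain e where e: "0 < e" "ball a e \<subseteq> normal_cone p0" using a by (auto simp: mem_interior)
    \<comment> \<open>The resulting move has length at most \<open>e / 2\<close>; the added 1 keeps
      the denominator positive.\<close>
    define s where "s = e / (2 * (norm (q - p0) + 1))"
    have s: "0 < s" using e by (simp add: s_def add_nonneg_pos)
    have "norm (s *\<^sub>R (q - p0)) < e"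
    proof -
      have "s * norm (q - p0) \<le> s * (norm (q - p0) + 1)" using s by simp
      also have "\<dots> = e / 2" unfolding s_def by (simp add: field_simps add_nonneg_eq_0_iff)
      finally show ?thesis using s e by simp
    qed
    then have "a + s *\<^sub>R (q - p0) \<in> normal_cone p0" using e by (intro subsetD[OF e(2)]) (simp add: dist_norm)
    then have "inner (a + s *\<^sub>R (q - p0)) q \<le> inner (a + s *\<^sub>R (q - p0)) p0"
      using pT by (auto simp: normal_cone_def)
    then have "s * inner (q - p0) (q - p0) \<le> 0"
      using eq by (simp add: inner_simps algebra_simps)
    then have "inner (q - p0) (q - p0) \<le> 0" using s by (simp add: mult_le_0_iff)
    then have "(norm (q - p0))\<^sup>2 \<le> 0" by (simp only: power2_norm_eq_inner)
    then have "q = p0" by simp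
    then show False using q p0g by (simp add: bad_def)
  qed
  define W where "W = (\<lambda>(p, q). rspan (insert a (normal_cone p \<inter> normal_cone q))) ` (good \<times> bad)"
  have "interior (normal_cone q0) \<subseteq> \<Union>W"
  proof
    fix b assume "b \<in> interior (normal_cone q0)"
    then have "b \<in> B" using interior_subset q0b by (auto simp: B_def)
    \<comment> \<open>The segment is connected and covered by the closed sets \<open>G\<close> and
      \<open>B\<close>, both of which it meets, so it passes through a wall.\<close>
    have "\<exists>z \<in> closed_segment a b. z \<in> G \<and> z \<in> B"
    proof (rule ccontr)
      assume no: "\<not> ?thesis"
      have "G \<inter> closed_segment a b = {} \<or> B \<inter> closed_segment a b = {}"
        by (rule connected_closedD[OF connected_segment(1)]) (use no cl cover in auto)
      then show False using aG \<open>b \<in> B\<close> by auto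
    qed
    then obtain z u where zGB: "z \<in> G" "z \<in> B" and u: "0 \<le> u" "u \<le> 1" and z: "z = (1 - u) *\<^sub>R a + u *\<^sub>R b"
      by (auto simp: in_segment)
    obtain p q where pq: "p \<in> good" "q \<in> bad" "z \<in> normal_cone p" "z \<in> normal_cone q"
      using zGB by (auto simp: G_def B_def)
    \<comment> \<open>As \<open>a\<close> is not in \<open>B\<close>, the point \<open>z\<close> on
      the wall is not \<open>a\<close>, and \<open>b\<close> can be recovered as a combination of
      \<open>z\<close> and \<open>a\<close>.\<close>
    have "u \<noteq> 0" using z zGB aB by auto
    then have bz: "b = (1 / u) *\<^sub>R z - ((1 - u) / u) *\<^sub>R a"
      by (simp add: z scaleR_add_right)
    have "b \<in> rspan (insert a (normal_cone p \<inter> normal_cone q))"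
      unfolding bz using pq
      by (intro real_vector.span_diff real_vector.span_scale real_vector.span_base) auto
    then show "b \<in> \<Union>W" using pq by (auto simp: W_def)
  qed
  then have "interior (normal_cone q0) \<subseteq> interior (\<Union>W)" by (simp add: interior_maximal)
  then have "interior (\<Union>W) \<noteq> {}" using b0 by auto
  moreover have "finite W" using fin by (simp add: W_def)
  moreover have "closed S" if "S \<in> W" for S using that by (auto simp: W_def)
  \<comment> \<open>Finitely many subspaces cover a nonempty open set, so one of them has interior
    and is the whole space.\<close>
  ultimately obtain S where S: "S \<in> W" "interior S \<noteq> {}" using interior_Union_empty by metis
  then obtain p q where pq: "p \<in> good" "q \<in> bad"
    and Seq: "S = rspan (insert a (normal_cone p \<inter> normal_cone q))" by (auto simp: W_def)
  have "rspan (insert a (normal_cone p \<inter> normal_cone q)) = UNIV"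
    using S interior_proper_span Seq by blast
  moreover have pv: "p \<in> vertices" and qv: "q \<in> vertices" and pM: "proj p * M = M"
    using pq by (auto simp: good_def bad_def)
  ultimately have abs: "proj q * (proj p * F) = proj p * F" by (intro wall_absorb)
  \<comment> \<open>As \<open>F\<close> commutes with \<open>proj p0\<close>, it may be inserted
    between \<open>proj p\<close> and \<open>M\<close>. This brings \<open>wall_absorb\<close> to
    bear on \<open>M\<close> and passes goodness from \<open>p\<close> to \<open>q\<close>.\<close>
  have "F * M = M"
    unfolding M_def using sq_assoc[OF F_facts(1) proj_facts(1)[OF p0] F_facts(1)]
      sq_assoc[OF proj_facts(1)[OF p0] F_facts(1) F_facts(1)] F_proj_commute[OF p0] F_facts(3) by simp
  then have pFM: "proj p * F * M = M" using sq_assoc[OF proj_facts(1)[OF pv] F_facts(1) M] pM by simp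
  have "proj q * M = proj q * (proj p * F * M)" using pFM by simp
  also have "\<dots> = proj q * (proj p * F) * M"
    by (rule sq_assoc[symmetric, OF proj_facts(1)[OF qv] sq_mult[OF proj_facts(1)[OF pv] F_facts(1)] M])
  also have "\<dots> = M" unfolding abs by (rule pFM)
  finally show False using pq qv by (simp add: good_def bad_def)
qed

text \<open>By \<open>all_absorb\<close> the range of \<open>proj p0 * F\<close> is fixed by the
  projections of all vertices. Vertices chosen for \<open>v\<close> and for \<open>- v\<close> make
  \<open>H v\<close> scalar there by \<open>antipodal_scalar\<close>, so every nonzero vector of the
  range would be a joint eigenvector in the complement.\<close>

lemma proj_F_zero:
  assumes p0: "p0 \<in> vertices"
  shows "proj p0 * F = 0\<^sub>m n n"
proof (rule scalar_on_span_zero[where S = UNIV and a = 0])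
  let ?M = "proj p0 * F"
  note P0 = proj_facts(1)[OF p0] and Fc = F_facts(1)
  show M: "?M \<in> carrier_mat n n" by (rule sq_mult[OF P0 Fc])
  show "H v * ?M = ?M * H v" for v
    by (rule commute_mult[symmetric, OF P0 Fc pencil_carrier proj_commutes[OF p0] F_commutes])
  show "?M $$ (i, j) = 0" if "i < l" "j < n" for i j
    unfolding F_proj_commute[OF p0, symmetric] by (rule F_row[OF P0 that])
  show "rspan (insert 0 UNIV) = (UNIV :: (real ^ 'm) set)" by simp
  fix v :: "real ^ 'm"
  obtain p where p: "p \<in> vertices" "v \<in> normal_cone p" using cones_cover by blast
  obtain q where q: "q \<in> vertices" "- v \<in> normal_cone q" using cones_cover by blast
  obtain lam where lam: "H v * (proj p * proj q) = lam \<cdot>\<^sub>m (proj p * proj q)"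
    using antipodal_scalar[OF p(1) q(1) p(2) q(2)] by blast
  note P = proj_facts(1)[OF p(1)] and Q = proj_facts(1)[OF q(1)]
  have PQM: "proj p * proj q * ?M = ?M"
    unfolding sq_assoc[OF P Q M] all_absorb[OF p0 q(1)] all_absorb[OF p0 p(1)] ..
  have "H v * ?M = H v * (proj p * proj q * ?M)" using PQM by simp
  also have "\<dots> = H v * (proj p * proj q) * ?M" by (rule sq_assoc[symmetric, OF pencil_carrier sq_mult[OF P Q] M])
  also have "\<dots> = lam \<cdot>\<^sub>m ?M" unfolding lam mult_smult_assoc_mat[OF sq_mult[OF P Q] M] PQM ..
  finally show "\<exists>lam. H v * ?M = lam \<cdot>\<^sub>m ?M" by blast
qed

text \<open>The threshold is the k-th eigenvalue. A complementary eigenvector above it would be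
  fixed by the projection, yet killed by \<open>proj_F_zero\<close>. The diagonal of the projection
  sums to \<open>k\<close>, is at most 1 and vanishes except where an index below \<open>l\<close>
  reaches the threshold, so there are at least \<open>k\<close> such indices.\<close>

lemma dominated: "dominated_below n k l (H v)"
proof -
  obtain p where p: "p \<in> vertices" "v \<in> normal_cone p" using cones_cover by blast
  obtain Y b where Y: "diagonalizes n Y (H v) b" and b: "antitone n b"
    using spectral_sorted[OF H_herm] by blast
  let ?P = "proj p" and ?lam = "b (k - 1)"
  note P = proj_facts[OF p(1)] and Fc = F_facts(1)
  note sep = proj_separates[OF p Y b]
  have "a \<le> ?lam" if x: "x \<in> carrier_vec n" "x \<noteq> 0\<^sub>v n" "\<forall>i<l. x $ i = 0"
    and ev: "H v *\<^sub>v x = complex_of_real a \<cdot>\<^sub>v x" for x a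
  proof (rule ccontr)
    assume "\<not> a \<le> ?lam"
    then have "?P *\<^sub>v x = x" using separatesD(1)[OF sep x(1) ev] by simp
    moreover have "?P *\<^sub>v x = ?P *\<^sub>v (F *\<^sub>v x)" using F_fix x by simp
    moreover have "?P *\<^sub>v (F *\<^sub>v x) = 0\<^sub>m n n *\<^sub>v x"
      unfolding assoc_mult_mat_vec[OF P(1) Fc x(1), symmetric] proj_F_zero[OF p(1)] ..
    moreover have "0\<^sub>m n n *\<^sub>v x = 0\<^sub>v n" using x(1) by (intro eq_vecI) auto
    ultimately show False using x(2) by simp
  qed
  moreover have "k \<le> card {i. i < l \<and> ?lam \<le> Re (H v $$ (i, i))}"
  proof -
    let ?J = "{i. i < l \<and> ?lam \<le> Re (H v $$ (i, i))}"
    have J: "?J \<subseteq> {..<n}" using l by auto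
    have "real k = (\<Sum>i<n. Re (?P $$ (i, i)))"
      using projection_trace[OF vertex_unitary(1)[OF p(1)] proj_def] k by simp
    also have "\<dots> = (\<Sum>i\<in>?J. Re (?P $$ (i, i)))"
    proof (rule sum.mono_neutral_right)
      show "\<forall>i\<in>{..<n} - ?J. Re (?P $$ (i, i)) = 0"
      proof
        fix i assume i: "i \<in> {..<n} - ?J"
        then have i': "i < n" by simp
        show "Re (?P $$ (i, i)) = 0"
        proof (cases "i < l")
          case True
          then have "Re (H v $$ (i, i)) < ?lam" using i by auto
          from separatesD(2)[OF sep unit_vec_carrier H_unit_vec[OF True] this]
          have "(?P *\<^sub>v unit_vec n i) $ i = 0\<^sub>v n $ i" by simp
          then show ?thesis using mult_unit_vec[OF P(1) i' i'] i' by simp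
        next
          case False
          have "(?P * F) $$ (i, i) = ?P $$ (i, i)"
            unfolding F_def rdiag_sandwich_index(1)[OF P(1) i' i'] using False by simp
          then show ?thesis using proj_F_zero[OF p(1)] i' by simp
        qed
      qed
    qed (use J in auto)
    also have "\<dots> \<le> (\<Sum>i\<in>?J. 1)"
      using J projection_diag(3)[OF P] by (intro sum_mono) auto
    finally show ?thesis by simp
  qed
  ultimately show ?thesis unfolding dominated_below_def by blast
qed

text \<open>If \<open>l < 2 * k\<close>, the index sets for \<open>v\<close> and \<open>- v\<close>
  share an index, which gives \<open>lam \<le> - mu\<close>. The complementary eigenvalues of
  \<open>H v\<close> are at least \<open>- mu\<close> and at most \<open>lam\<close>, hence all
  equal \<open>lam\<close>. The complementary block is then scalar for every \<open>v\<close>, and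
  its first unit vector is a joint eigenvector.\<close>

lemma two_k_le: "2 * k \<le> l"
proof (rule ccontr)
  assume neg: "\<not> 2 * k \<le> l"
  then have ln: "l < n" using k l by simp
  have "unit_vec n l = (0\<^sub>v n :: complex vec)"
  proof (rule no_common_eigenvector)
    fix v
    obtain lam where lam: "k \<le> card {i. i < l \<and> lam \<le> Re (H v $$ (i, i))}"
      "\<And>x a. x \<in> carrier_vec n \<Longrightarrow> x \<noteq> 0\<^sub>v n \<Longrightarrow> (\<forall>i<l. x $ i = 0) \<Longrightarrow>
        H v *\<^sub>v x = complex_of_real a \<cdot>\<^sub>v x \<Longrightarrow> a \<le> lam" using dominated[of v] unfolding dominated_below_def by blast
    obtain mu where mu: "k \<le> card {i. i < l \<and> mu \<le> Re (H (- v) $$ (i, i))}"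
      "\<And>x a. x \<in> carrier_vec n \<Longrightarrow> x \<noteq> 0\<^sub>v n \<Longrightarrow> (\<forall>i<l. x $ i = 0) \<Longrightarrow>
        H (- v) *\<^sub>v x = complex_of_real a \<cdot>\<^sub>v x \<Longrightarrow> a \<le> mu" using dominated[of "- v"] unfolding dominated_below_def by blast
    let ?I = "{i. i < l \<and> lam \<le> Re (H v $$ (i, i))}" and ?J = "{i. i < l \<and> mu \<le> Re (H (- v) $$ (i, i))}"
    have "?I \<inter> ?J \<noteq> {}"
    proof
      assume "?I \<inter> ?J = {}"
      then have "card ?I + card ?J = card (?I \<union> ?J)" by (intro card_Un_disjoint[symmetric]) auto
      also have "\<dots> \<le> card {..<l}" by (intro card_mono) auto
      finally show False using lam(1) mu(1) neg by simp
    qed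
    then obtain i where i: "i < l" "lam \<le> Re (H v $$ (i, i))" "mu \<le> Re (H (- v) $$ (i, i))" by blast
    have "Re (H (- v) $$ (i, i)) = - Re (H v $$ (i, i))"
      unfolding pencil_minus using i l carrier_matD[OF pencil_carrier[of n A v]] by simp
    then have lm: "lam \<le> - mu" using i by simp
    have "diag_upto n l (H v)" unfolding diag_upto_def using H_off_diag by blast
    then obtain V b where V: "diagonalizes n V (H v) b"
      and Vt: "\<And>i t. i < n \<Longrightarrow> t < l \<Longrightarrow> V $$ (i, t) = (if i = t then 1 else 0)"
      using spectral_fixing[OF H_herm _ l] by metis
    have V': "diagonalizes n V (H (- v)) (\<lambda>i. - b i)"
      unfolding pencil_minus by (rule diagonalizes_uminus[OF V])
    have b: "b i = lam" if "i < n" "l \<le> i" for i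
      using lam(2)[OF lower_eigencolumn[OF V l that Vt]] mu(2)[OF lower_eigencolumn[OF V' l that Vt]] lm by simp
    note VD = diagonalizesD[OF V]
    have Vl: "V $$ (l, j) = 0" if "j < l" for j using Vt[OF ln that] that by simp
    have "H v *\<^sub>v unit_vec n l = complex_of_real lam \<cdot>\<^sub>v unit_vec n l"
    proof (rule eq_vecI)
      fix i assume "i < dim_vec (complex_of_real lam \<cdot>\<^sub>v unit_vec n l)"
      then have i: "i < n" by simp
      have "(H v *\<^sub>v unit_vec n l) $ i = H v $$ (i, l)" by (rule mult_unit_vec[OF pencil_carrier ln i])
      also have "H v $$ (i, l) = (adj (adj V) * rdiag n b * adj V) $$ (i, l)" using VD(5) by simp
      also have "\<dots> = (\<Sum>j<n. b j * (cnj (adj V $$ (j, i)) * adj V $$ (j, l)))"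
        by (rule rdiag_conj_index[OF adj_carrier[OF VD(2)] i ln])
      also have "\<dots> = (\<Sum>j<n. complex_of_real lam * (V $$ (i, j) * cnj (V $$ (l, j))))"
      proof (intro sum.cong refl)
        fix j assume "j \<in> {..<n}"
        then show "b j * (cnj (adj V $$ (j, i)) * adj V $$ (j, l)) = lam * (V $$ (i, j) * cnj (V $$ (l, j)))"
          using VD(2) i ln Vl[of j] b[of j] by (cases "j < l") auto
      qed
      also have "\<dots> = complex_of_real lam * (if i = l then 1 else 0)"
        unfolding sum_distrib_left[symmetric] unitary_sums(2)[OF VD(1) i ln] ..
      finally show "(H v *\<^sub>v unit_vec n l) $ i = (complex_of_real lam \<cdot>\<^sub>v unit_vec n l) $ i"
        using i ln by (auto simp: unit_vec_def)
    qed (simp add: pencil_def)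
    then show "\<exists>a. H v *\<^sub>v unit_vec n l = a \<cdot>\<^sub>v unit_vec n l" by blast
  qed (use ln in auto)
  then have "unit_vec n l $ l = (0\<^sub>v n :: complex vec) $ l" by simp
  then show False using ln by simp
qed

end

section \<open>Ranges of partially diagonal families\<close>

lemma sum_lessThan_restrict:
  fixes f :: "nat \<Rightarrow> 'a::comm_monoid_add"
  assumes "l \<le> n" "\<And>i. l \<le> i \<Longrightarrow> i < n \<Longrightarrow> f i = 0"
  shows "(\<Sum>i<n. f i) = (\<Sum>i<l. f i)"
  by (rule sum.mono_neutral_right) (use assms in auto)

lemma diag_range_permute_subset:
  assumes A: "\<And>j. A j \<in> carrier_mat n n" and p: "p permutes {..<n}"
  shows "diag_range n c A \<subseteq> diag_range n (c \<circ> p) A"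
proof
  fix x assume "x \<in> diag_range n c A"
  then obtain U where U: "unitary_mat n U"
    and x: "\<And>j. vec_nth x j = (\<Sum>i<n. c i * Re ((adj U * A j * U) $$ (i, i)))" by (auto simp: diag_range_def)
  note P = permute_cols[OF U p]
  have "vec_nth x j = (\<Sum>i<n. (c \<circ> p) i * Re ((adj (permute_cols n p U) * A j * permute_cols n p U) $$ (i, i)))" for j
  proof -
    have "vec_nth x j = (\<Sum>i<n. c (p i) * Re ((adj U * A j * U) $$ (p i, p i)))"
      unfolding x using sum.permute[OF p, of "\<lambda>i. c i * Re ((adj U * A j * U) $$ (i, i))"] by (simp add: o_def)
    also have "\<dots> = (\<Sum>i<n. (c \<circ> p) i * Re ((adj (permute_cols n p U) * A j * permute_cols n p U) $$ (i, i)))"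
      by (intro sum.cong refl) (simp add: P(3)[OF A])
    finally show ?thesis .
  qed
  then show "x \<in> diag_range n (c \<circ> p) A" using P(2) unfolding diag_range_def by blast
qed

lemma diag_range_permute:
  assumes A: "\<And>j. A j \<in> carrier_mat n n" and p: "p permutes {..<n}"
  shows "diag_range n (c \<circ> p) A = diag_range n c A"
proof
  show "diag_range n c A \<subseteq> diag_range n (c \<circ> p) A" by (rule diag_range_permute_subset[OF A p])
  have "c \<circ> p \<circ> inv_into UNIV p = c" using permutes_inverses(1)[OF p] by (auto simp: fun_eq_iff)
  then show "diag_range n (c \<circ> p) A \<subseteq> diag_range n c A"
    using diag_range_permute_subset[OF A permutes_inv[OF p], of "c \<circ> p"] by simp
qed

text \<open>The position among the eigenvalues of \<open>C\<close> of the \<open>i\<close>-th entry of \<open>C_hat\<close>; the omitted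
  middle positions are assigned to the indices from \<open>l\<close> on.\<close>

definition interleave :: "nat \<Rightarrow> nat \<Rightarrow> nat \<Rightarrow> nat \<Rightarrow> nat" where
  "interleave n l k i = (if i < k then i else if i < l then i + (n - l) else if i < n then k + (i - l) else i)"

lemma interleave_permutes:
  assumes "k \<le> l" "l \<le> n"
  shows "interleave n l k permutes {..<n}"
proof (rule bij_imp_permutes)
  let ?g = "\<lambda>r. if r < k then r else if r < k + (n - l) then l + (r - k) else r - (n - l)"
  show "bij_betw (interleave n l k) {..<n} {..<n}"
    by (rule bij_betw_byWitness[where f' = ?g]) (use assms in \<open>auto simp: interleave_def\<close>)
qed (use assms in \<open>auto simp: interleave_def\<close>)

text \<open>Otherwise all entries reaching \<open>lam\<close> would stand before position
  \<open>i\<close>, where there are fewer than \<open>k\<close> places. \<open>sorted_bottom\<close>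
  is the mirror image.\<close>

lemma sorted_top:
  fixes d :: "nat \<Rightarrow> real"
  assumes p: "p permutes {..<l}" and srt: "\<And>i j. i \<le> j \<Longrightarrow> j < l \<Longrightarrow> d (p j) \<le> d (p i)"
    and card: "k \<le> card {i. i < l \<and> lam \<le> d i}" and i: "i < k" "i < l"
  shows "lam \<le> d (p i)"
proof (rule ccontr)
  assume neg: "\<not> ?thesis"
  have "{t. t < l \<and> lam \<le> d t} \<subseteq> p ` {..<i}"
  proof
    fix t assume t: "t \<in> {t. t < l \<and> lam \<le> d t}"
    then obtain s where s: "s < l" "t = p s"
      using permutes_image[OF p] by (metis (mono_tags, lifting) imageE lessThan_iff mem_Collect_eq)
    then have "s < i" using neg srt[of i s] t by (metis mem_Collect_eq not_less order_trans)
    then show "t \<in> p ` {..<i}" using s by auto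
  qed
  then have "card {t. t < l \<and> lam \<le> d t} \<le> card (p ` {..<i})" by (intro card_mono) auto
  also have "\<dots> \<le> i" using card_image_le[of "{..<i}" p] by simp
  finally show False using card i by simp
qed

lemma sorted_bottom:
  fixes d :: "nat \<Rightarrow> real"
  assumes p: "p permutes {..<l}" and srt: "\<And>i j. i \<le> j \<Longrightarrow> j < l \<Longrightarrow> d (p j) \<le> d (p i)"
    and card: "k \<le> card {i. i < l \<and> d i \<le> mu}" and i: "l - k \<le> i" "i < l" and kl: "k \<le> l"
  shows "d (p i) \<le> mu"
proof (rule ccontr)
  assume neg: "\<not> ?thesis"
  have "{t. t < l \<and> d t \<le> mu} \<subseteq> p ` {Suc i..<l}"
  proof
    fix t assume t: "t \<in> {t. t < l \<and> d t \<le> mu}"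
    then obtain s where s: "s < l" "t = p s"
      using permutes_image[OF p] by (metis (mono_tags, lifting) imageE lessThan_iff mem_Collect_eq)
    have "i < s"
    proof (rule ccontr)
      assume "\<not> i < s"
      then show False using neg srt[of s i] t s i by simp
    qed
    then show "t \<in> p ` {Suc i..<l}" using s by auto
  qed
  then have "card {t. t < l \<and> d t \<le> mu} \<le> card (p ` {Suc i..<l})" by (intro card_mono) auto
  also have "\<dots> \<le> l - Suc i" using card_image_le[of "{Suc i..<l}" p] by simp
  finally show False using card i kl by simp
qed

lemma not_in_hull_separation:
  fixes x :: "real ^ 'm::finite"
  assumes "finite S" "x \<notin> convex hull S"
  obtains v where "\<And>y. y \<in> S \<Longrightarrow> inner v y < inner v x"
proof -
  have "closed (convex hull S)" using assms(1) by (simp add: compact_imp_closed finite_imp_compact_convex_hull)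
  then obtain a b where ab: "inner a x < b" "\<And>y. y \<in> convex hull S \<Longrightarrow> b < inner a y"
    using separating_hyperplane_closed_point[of "convex hull S" x] assms(2) convex_convex_hull by blast
  have "inner (- a) y < inner (- a) x" if "y \<in> S" for y
    using ab(1) ab(2)[OF hull_inc[OF that]] by simp
  then show ?thesis using that by blast
qed

lemma inner_perm_point:
  fixes D A :: "'m::finite \<Rightarrow> complex mat"
  assumes p: "p permutes {..<l}" and l: "l \<le> n"
    and D: "\<And>j i. i < l \<Longrightarrow> D j $$ (i, i) = A j $$ (i, i)"
    and y: "\<And>j. vec_nth y j = (\<Sum>i<l. c i * Re (D j $$ (p i, p i)))"
  shows "inner v y = (\<Sum>i<l. c i * Re (pencil n A v $$ (p i, p i)))"
proof -
  have pl: "p i < l" if "i < l" for i using permutes_in_image[OF p, of i] that by simp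
  have "inner v y = (\<Sum>j\<in>UNIV. \<Sum>i<l. c i * (vec_nth v j * Re (D j $$ (p i, p i))))"
    by (simp add: inner_vec_def y sum_distrib_left mult_ac)
  also have "\<dots> = (\<Sum>i<l. \<Sum>j\<in>UNIV. c i * (vec_nth v j * Re (D j $$ (p i, p i))))" by (rule sum.swap)
  also have "\<dots> = (\<Sum>i<l. c i * Re (pencil n A v $$ (p i, p i)))"
  proof (intro sum.cong refl)
    fix i assume "i \<in> {..<l}"
    then have i: "p i < l" "p i < n" using pl l by (auto intro: less_le_trans)
    show "(\<Sum>j\<in>UNIV. c i * (vec_nth v j * Re (D j $$ (p i, p i)))) = c i * Re (pencil n A v $$ (p i, p i))"
      using i by (simp add: pencil_index D Re_sum sum_distrib_left)
  qed
  finally show ?thesis .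
qed

lemma diagonalizes_fixed_entry:
  assumes V: "diagonalizes n V H b" and l: "l \<le> n" and i: "i < l"
    and Vt: "\<And>i t. i < n \<Longrightarrow> t < l \<Longrightarrow> V $$ (i, t) = (if i = t then 1 else 0)"
  shows "Re (H $$ (i, i)) = b i"
proof -
  note VD = diagonalizesD[OF V]
  have iN: "i < n" using i l by simp
  have "H $$ (i, i) = (adj (adj V) * rdiag n b * adj V) $$ (i, i)" using VD(5) by simp
  also have "\<dots> = (\<Sum>j<n. b j * (cnj (adj V $$ (j, i)) * adj V $$ (j, i)))"
    by (rule rdiag_conj_index[OF adj_carrier[OF VD(2)] iN iN])
  also have "\<dots> = (\<Sum>j<n. if j = i then complex_of_real (b i) else 0)"
    using VD(2) iN fixed_columns_adj[OF VD(1) l Vt _ i] by (intro sum.cong refl) auto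
  finally show ?thesis using iN by simp
qed

text \<open>A point outside the hull is separated from it by some \<open>v\<close>. The nonzero
  weights of \<open>c\<close> meet only the extreme eigenvalues of \<open>H v\<close>, which occur
  in the diagonal block, so the trace inequality bounds the functional on the range by its value at
  a permutation point: a contradiction.\<close>

lemma diag_range_subset_hull:
  fixes A D :: "'m::finite \<Rightarrow> complex mat"
  assumes herm: "\<And>j. hermitian_mat n (A j)" and dg: "\<And>j. diag_upto n l (A j)" and l: "l \<le> n"
    and kl: "2 * k \<le> l" and dom: "\<And>v. dominated_below n k l (pencil n A v)"
    and c: "antitone n c" and c0: "\<And>i. k \<le> i \<Longrightarrow> i < n - k \<Longrightarrow> c i = 0"
    and c': "\<And>i. i < l \<Longrightarrow> c' i = c (interleave n l k i)"
    and D: "\<And>j i. i < l \<Longrightarrow> D j $$ (i, i) = A j $$ (i, i)"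
  shows "diag_range n c A \<subseteq> convex hull (perm_points l c' D)"
proof (rule ccontr)
  assume "\<not> ?thesis"
  then obtain x where x: "x \<in> diag_range n c A" "x \<notin> convex hull (perm_points l c' D)" by blast
  from not_in_hull_separation[OF finite_perm_points x(2)] obtain v
    where sep: "\<And>y. y \<in> perm_points l c' D \<Longrightarrow> inner v y < inner v x" by blast
  let ?H = "pencil n A v" and ?t = "interleave n l k"
  have A: "A j \<in> carrier_mat n n" for j by (rule hermitianD(1)[OF herm])
  have Hh: "hermitian_mat n ?H" by (rule hermitian_pencil[OF herm])
  have "diag_upto n l ?H"
    unfolding diag_upto_def
  proof (intro allI impI)
    fix i t assume "i < n" "t < l" "i \<noteq> t"
    moreover from this have "t < n" using l by simp
    ultimately show "?H $$ (i, t) = 0"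
      using dg by (subst pencil_index) (auto simp: diag_upto_def intro!: sum.neutral)
  qed
  then obtain V a where V: "diagonalizes n V ?H a"
    and Vt: "\<And>i t. i < n \<Longrightarrow> t < l \<Longrightarrow> V $$ (i, t) = (if i = t then 1 else 0)"
    using spectral_fixing[OF Hh _ l] by metis
  have V': "diagonalizes n V (pencil n A (- v)) (\<lambda>i. - a i)"
    unfolding pencil_minus by (rule diagonalizes_uminus[OF V])
  have ad: "Re (?H $$ (i, i)) = a i" if "i < l" for i by (rule diagonalizes_fixed_entry[OF V l that Vt])
  have ad': "Re (pencil n A (- v) $$ (i, i)) = - a i" if "i < l" for i
    by (rule diagonalizes_fixed_entry[OF V' l that Vt])
  obtain lam where lam: "k \<le> card {i. i < l \<and> lam \<le> Re (?H $$ (i, i))}"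
      "\<And>x a. x \<in> carrier_vec n \<Longrightarrow> x \<noteq> 0\<^sub>v n \<Longrightarrow> (\<forall>i<l. x $ i = 0) \<Longrightarrow>
        ?H *\<^sub>v x = complex_of_real a \<cdot>\<^sub>v x \<Longrightarrow> a \<le> lam"
    using dom[of v] unfolding dominated_below_def by blast
  obtain mu where mu: "k \<le> card {i. i < l \<and> mu \<le> Re (pencil n A (- v) $$ (i, i))}"
      "\<And>x a. x \<in> carrier_vec n \<Longrightarrow> x \<noteq> 0\<^sub>v n \<Longrightarrow> (\<forall>i<l. x $ i = 0) \<Longrightarrow>
        pencil n A (- v) *\<^sub>v x = complex_of_real a \<cdot>\<^sub>v x \<Longrightarrow> a \<le> mu"
    using dom[of "- v"] unfolding dominated_below_def by blast
  have a_lam: "a i \<le> lam" and a_mu: "- mu \<le> a i" if "l \<le> i" "i < n" for i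
    using lam(2)[OF lower_eigencolumn[OF V l that(2,1) Vt]] mu(2)[OF lower_eigencolumn[OF V' l that(2,1) Vt]] by simp_all
  \<comment> \<open>Only the eigenvalues of the diagonal block are sorted, so that \<open>p\<close>
    describes a permutation point; those of the complementary block keep their places.\<close>
  obtain p where p: "p permutes {..<l}" and srt: "\<And>i j. i \<le> j \<Longrightarrow> j < l \<Longrightarrow> a (p j) \<le> a (p i)"
    using exists_sorting_permutation[of l a] by metis
  have pn: "p permutes {..<n}" using permutes_subset[OF p] l by auto
  have pl: "p i < l" if "i < l" for i using permutes_in_image[OF p, of i] that by simp
  have pid: "p i = i" if "l \<le> i" for i using permutes_not_in[OF p] that by simp
  have "{i. i < l \<and> lam \<le> Re (?H $$ (i, i))} = {i. i < l \<and> lam \<le> a i}" using ad by auto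
  then have top: "lam \<le> a (p i)" if "i < k" for i
    using sorted_top[where d = a and k = k and lam = lam and i = i, OF p srt] lam(1) that kl by auto
  have "{i. i < l \<and> mu \<le> Re (pencil n A (- v) $$ (i, i))} = {i. i < l \<and> a i \<le> - mu}" using ad' by auto
  then have bot: "a (p i) \<le> - mu" if "l - k \<le> i" "i < l" for i
    using sorted_bottom[where d = a and k = k and mu = "- mu" and i = i, OF p srt] mu(1) that kl by auto
  have t: "?t permutes {..<n}" by (rule interleave_permutes) (use kl l in auto)
  have so: "similarly_ordered n (c \<circ> ?t) (a \<circ> p)"
    unfolding similarly_ordered_def o_def
  proof (intro allI impI)
    fix i j assume ij: "i < n" "j < n" and lt: "c (?t j) < c (?t i)"
    have tn: "?t i < n" "?t j < n" using permutes_in_image[OF t] ij by (metis lessThan_iff)+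
    have tij: "?t i < ?t j"
    proof (rule ccontr)
      assume "\<not> ?t i < ?t j"
      then have "c (?t i) \<le> c (?t j)" using c tn by auto
      then show False using lt by simp
    qed
    \<comment> \<open>\<open>c\<close> is zero at the positions from \<open>k\<close> to
      \<open>n - k - 1\<close>. A strict drop therefore starts among the first \<open>k\<close>
      positions or ends among the last \<open>k\<close>.\<close>
    have nmid: "?t i < k \<or> n - k \<le> ?t j"
    proof (rule ccontr)
      assume "\<not> ?thesis"
      then have "c (?t i) = 0" "c (?t j) = 0" using tij by (auto intro!: c0)
      then show False using lt by simp
    qed
    show "a (p j) \<le> a (p i)"
    proof (cases "i < l"; cases "j < l")
      assume "i < l" "j < l"
      then have "i \<le> j" using tij by (auto simp: interleave_def split: if_splits)
      then show ?thesis using srt \<open>j < l\<close> by simp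
    next
      \<comment> \<open>Interleaving sends the complementary index \<open>j\<close> to a middle
        position, so \<open>i\<close> is one of the top \<open>k\<close> indices; its eigenvalue
        reaches \<open>lam\<close>, which bounds the complement from above. The next case is
        symmetric, with \<open>- mu\<close>.\<close>
      assume l': "i < l" "\<not> j < l"
      then have "i < k" using nmid tij ij kl l by (auto simp: interleave_def split: if_splits)
      then show ?thesis using top a_lam[of j] pid[of j] l' ij by force
    next
      assume l': "\<not> i < l" "j < l"
      then have "l - k \<le> j" using nmid tij ij kl l by (auto simp: interleave_def split: if_splits)
      then show ?thesis using bot[of j] a_mu[of i] pid[of i] l' ij by force
    next
      assume l': "\<not> i < l" "\<not> j < l"
      then have "False" using nmid tij ij kl l by (auto simp: interleave_def split: if_splits)
      then show ?thesis ..
    qed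
  qed
  have "x \<in> diag_range n (c \<circ> ?t) A" using x(1) diag_range_permute[where A = A, OF A t] by blast
  then obtain U where U: "unitary_mat n U"
    and xU: "\<And>j. vec_nth x j = (\<Sum>i<n. (c \<circ> ?t) i * Re ((adj U * A j * U) $$ (i, i)))"
    by (auto simp: diag_range_def)
  have "inner v x = (\<Sum>i<n. (c \<circ> ?t) i * Re ((adj U * ?H * U) $$ (i, i)))"
    by (rule inner_diag_point[OF A unitaryD(1)[OF U] xU])
  also have "\<dots> \<le> (\<Sum>i<n. (c \<circ> ?t) i * (a \<circ> p) i)"
    by (rule trace_rearrangement[OF diagonalizes_permute[OF V pn] U so])
  also have "\<dots> = (\<Sum>i<l. (c \<circ> ?t) i * (a \<circ> p) i)"
    by (rule sum_lessThan_restrict[OF l]) (use kl l in \<open>auto simp: interleave_def intro!: c0\<close>)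
  also have "\<dots> = (\<Sum>i<l. c' i * Re (?H $$ (p i, p i)))"
    by (intro sum.cong refl) (use ad pl c' in auto)
  also have "\<dots> = inner v (vec_lambda (\<lambda>j. \<Sum>i<l. c' i * Re (D j $$ (p i, p i))))"
    by (rule inner_perm_point[OF p l D, symmetric]) auto
  also have "\<dots> < inner v x" by (rule sep) (use p in \<open>auto simp: perm_points_def\<close>)
  finally show False by simp
qed

text \<open>A unitary of size \<open>l\<close> is extended by the identity. After interleaving the
  weights at the remaining indices are zero, so the added columns contribute nothing.\<close>

lemma diag_range_block_subset:
  fixes A D :: "'m::finite \<Rightarrow> complex mat"
  assumes A: "\<And>j. A j \<in> carrier_mat n n" and l: "l \<le> n" and kl: "2 * k \<le> l"
    and c0: "\<And>i. k \<le> i \<Longrightarrow> i < n - k \<Longrightarrow> c i = 0"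
    and c': "\<And>i. i < l \<Longrightarrow> c' i = c (interleave n l k i)"
    and D: "\<And>j. D j \<in> carrier_mat l l" "\<And>j p q. p < l \<Longrightarrow> q < l \<Longrightarrow> D j $$ (p, q) = A j $$ (p, q)"
  shows "diag_range l c' D \<subseteq> diag_range n c A"
proof
  fix x assume "x \<in> diag_range l c' D"
  then obtain X where X: "unitary_mat l X"
    and x: "\<And>j. vec_nth x j = (\<Sum>i<l. c' i * Re ((adj X * D j * X) $$ (i, i)))" by (auto simp: diag_range_def)
  note XD = unitaryD[OF X]
  define Z where "Z = Matrix.mat n n (\<lambda>(i, j). if i < l \<and> j < l then X $$ (i, j) else if i = j then 1 else 0)"
  have Zc: "Z \<in> carrier_mat n n" by (simp add: Z_def)
  have Zi: "Z $$ (i, j) = (if i < l \<and> j < l then X $$ (i, j) else if i = j then 1 else 0)" if "i < n" "j < n" for i j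
    using that by (simp add: Z_def)
  have U: "unitary_mat n Z"
  proof (rule unitaryI[OF Zc])
    fix i j assume ij: "i < n" "j < n"
    show "(\<Sum>p<n. cnj (Z $$ (p, i)) * Z $$ (p, j)) = (if i = j then 1 else 0)"
    proof (cases "i < l \<and> j < l")
      case True
      have "(\<Sum>p<n. cnj (Z $$ (p, i)) * Z $$ (p, j)) = (\<Sum>p<l. cnj (Z $$ (p, i)) * Z $$ (p, j))"
        using True ij by (intro sum_lessThan_restrict[OF l]) (auto simp: Zi)
      also have "\<dots> = (\<Sum>p<l. cnj (X $$ (p, i)) * X $$ (p, j))"
        using True ij l by (intro sum.cong refl) (auto simp: Zi)
      finally show ?thesis using unitary_sums(1)[OF X, of i j] True by simp
    next
      case False
      then consider "l \<le> i" | "l \<le> j" by linarith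
      then show ?thesis
      proof cases
        case 1
        have "(\<Sum>p<n. cnj (Z $$ (p, i)) * Z $$ (p, j)) = (\<Sum>p<n. if p = i then Z $$ (i, j) else 0)"
          using 1 ij by (intro sum.cong refl) (auto simp: Zi)
        then show ?thesis using 1 ij by (simp add: Zi)
      next
        case 2
        have "(\<Sum>p<n. cnj (Z $$ (p, i)) * Z $$ (p, j)) = (\<Sum>p<n. if p = j then cnj (Z $$ (j, i)) else 0)"
          using 2 ij by (intro sum.cong refl) (auto simp: Zi)
        then show ?thesis using 2 ij by (simp add: Zi)
      qed
    qed
  qed
  have entry: "(adj Z * A j * Z) $$ (i, i) = (adj X * D j * X) $$ (i, i)" if i: "i < l" for i j
  proof -
    have iN: "i < n" using i l by simp
    have "(adj Z * A j * Z) $$ (i, i) = (\<Sum>p<l. \<Sum>q<n. cnj (Z $$ (p, i)) * A j $$ (p, q) * Z $$ (q, i))"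
      unfolding conj_index[OF A Zc iN iN] using i by (intro sum_lessThan_restrict[OF l]) (auto simp: Zi)
    also have "\<dots> = (\<Sum>p<l. \<Sum>q<l. cnj (Z $$ (p, i)) * A j $$ (p, q) * Z $$ (q, i))"
      using i by (intro sum.cong refl sum_lessThan_restrict[OF l]) (auto simp: Zi)
    also have "\<dots> = (\<Sum>p<l. \<Sum>q<l. cnj (X $$ (p, i)) * D j $$ (p, q) * X $$ (q, i))"
      using i l by (intro sum.cong refl) (auto simp: Zi D)
    also have "\<dots> = (adj X * D j * X) $$ (i, i)" unfolding conj_index[OF D(1) XD(1) i i] ..
    finally show ?thesis .
  qed
  have "vec_nth x j = (\<Sum>i<n. (c \<circ> interleave n l k) i * Re ((adj Z * A j * Z) $$ (i, i)))" for j
  proof -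
    have "(\<Sum>i<n. (c \<circ> interleave n l k) i * Re ((adj Z * A j * Z) $$ (i, i)))
      = (\<Sum>i<l. (c \<circ> interleave n l k) i * Re ((adj Z * A j * Z) $$ (i, i)))"
      by (rule sum_lessThan_restrict[OF l]) (use kl l in \<open>auto simp: interleave_def intro!: c0\<close>)
    also have "\<dots> = vec_nth x j" unfolding x by (intro sum.cong refl) (simp add: c' entry)
    finally show ?thesis ..
  qed
  then have "x \<in> diag_range n (c \<circ> interleave n l k) A" using U unfolding diag_range_def by blast
  moreover have "interleave n l k permutes {..<n}" by (rule interleave_permutes) (use kl l in auto)
  ultimately show "x \<in> diag_range n c A" using diag_range_permute[where A = A, OF A] by blast
qed

section \<open>Eigenvalues, gap indices and joint ranges\<close>

lemma diagonalizes_cong: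
  assumes "diagonalizes n Y H b" "\<And>i. i < n \<Longrightarrow> b i = b' i"
  shows "diagonalizes n Y H b'"
proof -
  have "rdiag n b = rdiag n b'" unfolding mat_diag_def using assms(2) by (intro cong_mat) auto
  then show ?thesis using assms(1) by (simp add: diagonalizes_def)
qed

lemma diagonalizes_rdiag: "diagonalizes n (1\<^sub>m n) (rdiag n b) b"
  by (simp add: diagonalizes_def left_mult_one_mat[OF mat_diag_dim] right_mult_one_mat[OF mat_diag_dim])

text \<open>Similarity to diag(c) makes the \<open>c i\<close> the roots of the characteristic
  polynomial with multiplicity; as \<open>c\<close> is descending, sorting the roots returns it.
  \<open>eig\<close> counts from 1, hence \<open>Suc i\<close>.\<close>

lemma eig_diagonalizes:
  assumes dec: "diagonalizes n Y C c" and c: "antitone n c" and i: "i < n"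
  shows "eig C (Suc i) = c i"
proof -
  note Y = diagonalizesD[OF dec] and YD = unitaryD[OF diagonalizesD(1)[OF dec]]
  have "similar_mat C (rdiag n c)"
    by (rule similar_matI[of _ _ Y "adj Y" n]) (use Y YD in auto)
  then have "char_poly C = char_poly (rdiag n c)" by (rule char_poly_similar)
  also have "\<dots> = (\<Prod>a\<leftarrow>diag_mat (rdiag n c). [:- a, 1:])"
    by (rule char_poly_upper_triangular[of _ n]) (auto simp: mat_diag_def)
  also have "diag_mat (rdiag n c) = map (\<lambda>i. complex_of_real (c i)) [0..<n]"
    by (auto simp: diag_mat_def mat_diag_def)
  finally have cp: "char_poly C = prod_list (map (\<lambda>i. [:- complex_of_real (c i), 1:]) [0..<n])"
    by (simp add: o_def)
  have "proots (prod_list (map (\<lambda>i. [:- complex_of_real (c i), 1:]) xs))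
      = mset (map (\<lambda>i. complex_of_real (c i)) xs)" for xs :: "nat list"
  proof (induction xs)
    case (Cons x xs)
    have "prod_list (map (\<lambda>i. [:- complex_of_real (c i), 1:]) xs) \<noteq> 0"
      by (auto simp: prod_list_zero_iff)
    then have "proots ([:- complex_of_real (c x), 1:] * prod_list (map (\<lambda>i. [:- complex_of_real (c i), 1:]) xs))
        = proots [:- complex_of_real (c x), 1:] + proots (prod_list (map (\<lambda>i. [:- complex_of_real (c i), 1:]) xs))"
      by (intro proots_mult) auto
    then show ?case using Cons.IH by simp
  qed simp
  then have roots: "image_mset Re (proots (char_poly C)) = mset (map c [0..<n])"
    unfolding cp by (simp add: image_mset.compositionality o_def flip: mset_map)
  have "sorted (rev (map c [0..<n]))"
    using c by (auto simp: sorted_iff_nth_mono rev_nth)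
  then have "sort (map c [0..<n]) = rev (map c [0..<n])"
    by (intro properties_for_sort) auto
  then have "eig C (Suc i) = rev (rev (map c [0..<n])) ! i"
    unfolding eig_def roots sorted_list_of_multiset_mset by simp
  then show ?thesis using i by simp
qed

lemma hermitian_eig:
  assumes "hermitian_mat n C"
  obtains Y where "diagonalizes n Y C (\<lambda>i. eig C (Suc i))" "antitone n (\<lambda>i. eig C (Suc i))"
proof -
  obtain Y c where Y: "diagonalizes n Y C c" "antitone n c" using spectral_sorted[OF assms] by blast
  have e: "eig C (Suc i) = c i" if "i < n" for i by (rule eig_diagonalizes[OF Y that])
  show ?thesis
  proof (rule that)
    show "diagonalizes n Y C (\<lambda>i. eig C (Suc i))" by (rule diagonalizes_cong[OF Y(1)]) (simp add: e)
    show "antitone n (\<lambda>i. eig C (Suc i))" using Y(2) e by auto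
  qed
qed

lemma constant_eig_scalar:
  assumes dec: "diagonalizes n Y C c" and eq: "\<And>i. i < n \<Longrightarrow> c i = s"
  shows "scalar_mat n C"
proof -
  note Y = diagonalizesD[OF diagonalizes_cong[OF dec eq]]
  have "rdiag n (\<lambda>_. s) = complex_of_real s \<cdot>\<^sub>m 1\<^sub>m n" by (rule eq_matI) (auto simp: mat_diag_def)
  then have "C = complex_of_real s \<cdot>\<^sub>m 1\<^sub>m n"
    using Y(5) unitaryD[OF Y(1)] by (simp add: mult_smult_distrib[of _ n n _ n] mult_smult_assoc_mat[of _ n n _ n])
  then show ?thesis unfolding scalar_mat_def by blast
qed

section \<open>Joint ranges in terms of eigenvalues\<close>

lemma trace_conj_diagonalizes:
  assumes dec: "diagonalizes n Y C c" and A: "hermitian_mat n A" and U: "unitary_mat n U"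
  shows "tr (C * adj U * A * U) = complex_of_real (\<Sum>i<n. c i * Re ((adj (U * Y) * A * (U * Y)) $$ (i, i)))"
proof -
  note Y = diagonalizesD[OF dec] and UD = unitaryD[OF U] and Ac = hermitianD(1)[OF A]
  define W where "W = adj (U * Y) * A * (U * Y)"
  have UY: "U * Y \<in> carrier_mat n n" using UD(1) Y(2) by auto
  have W: "hermitian_mat n W" unfolding W_def by (rule hermitian_conj[OF A UY])
  have "C * adj U * A * U = Y * (rdiag n c * (adj Y * (adj U * (A * U))))"
    by (subst Y(5)) (use Y(2) UD(1) Ac in \<open>simp add: sq_assoc[where n = n] sq_mult[where n = n]\<close>)
  then have "tr (C * adj U * A * U) = tr (rdiag n c * (adj Y * (adj U * (A * U))) * Y)"
    using Y(2) UD(1) Ac by (simp add: tr_mult_comm[of Y n n] sq_mult[where n = n])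
  also have "rdiag n c * (adj Y * (adj U * (A * U))) * Y = rdiag n c * W"
    unfolding W_def adj_mult[OF UD(1) Y(2)]
    using Y(2) UD(1) Ac by (simp add: sq_assoc[where n = n] sq_mult[where n = n])
  also have "tr (rdiag n c * W) = (\<Sum>i<n. (rdiag n c * W) $$ (i, i))"
    by (rule tr_sum[OF sq_mult[OF mat_diag_dim hermitianD(1)[OF W]]])
  also have "\<dots> = (\<Sum>i<n. complex_of_real (c i * Re (W $$ (i, i))))"
    using hermitianD(1)[OF W] hermitian_diag_real[OF W]
    by (intro sum.cong refl) (simp add: rdiag_sandwich_index(2)[where n = n])
  finally show ?thesis unfolding W_def by simp
qed

text \<open>The eigenbasis \<open>Y\<close> of \<open>C\<close> is absorbed into the unitary, which
  runs over the whole group: \<open>U\<close> is exchanged for \<open>U * Y\<close>.\<close>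

lemma joint_C_range_eq_diag_range:
  fixes A :: "'m::finite \<Rightarrow> complex mat"
  assumes dec: "diagonalizes n Y C c" and A: "\<And>j. hermitian_mat n (A j)"
  shows "joint_C_range C A = diag_range n c A"
proof
  note Y = diagonalizesD[OF dec]
  have dim: "dim_row C = n" using Y(3) by simp
  show "joint_C_range C A \<subseteq> diag_range n c A"
  proof
    fix x assume "x \<in> joint_C_range C A"
    then obtain U where U: "unitary_mat n U" and x: "\<And>j. complex_of_real (vec_nth x j) = tr (C * adj U * A j * U)"
      unfolding joint_C_range_def dim by blast
    have "vec_nth x j = (\<Sum>i<n. c i * Re ((adj (U * Y) * A j * (U * Y)) $$ (i, i)))" for j
      using x[of j] unfolding trace_conj_diagonalizes[OF dec A U] of_real_eq_iff .
    then show "x \<in> diag_range n c A" unfolding diag_range_def using unitary_mult[OF U Y(1)] by blast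
  qed
  show "diag_range n c A \<subseteq> joint_C_range C A"
  proof
    fix x assume "x \<in> diag_range n c A"
    then obtain U where U: "unitary_mat n U"
      and x: "\<And>j. vec_nth x j = (\<Sum>i<n. c i * Re ((adj U * A j * U) $$ (i, i)))" by (auto simp: diag_range_def)
    define U' where "U' = U * adj Y"
    have U': "unitary_mat n U'" unfolding U'_def by (intro unitary_mult U unitary_adj Y)
    have "U' * Y = U" unfolding U'_def
      using unitaryD[OF U] unitaryD[OF Y(1)] by (simp add: sq_assoc[where n = n])
    then have "complex_of_real (vec_nth x j) = tr (C * adj U' * A j * U')" for j
      using trace_conj_diagonalizes[OF dec A U', of j] x[of j] by simp
    then show "x \<in> joint_C_range C A" unfolding joint_C_range_def dim using U' by blast
  qed
qed

lemma diag_range_conj_subset: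
  fixes A :: "'m::finite \<Rightarrow> complex mat"
  assumes A: "\<And>j. A j \<in> carrier_mat n n" and U: "unitary_mat n U"
  shows "diag_range n c (\<lambda>j. adj U * A j * U) \<subseteq> diag_range n c A"
proof
  fix x assume "x \<in> diag_range n c (\<lambda>j. adj U * A j * U)"
  then obtain V where V: "unitary_mat n V"
    and x: "\<And>j. vec_nth x j = (\<Sum>i<n. c i * Re ((adj V * (adj U * A j * U) * V) $$ (i, i)))"
    by (auto simp: diag_range_def)
  have "vec_nth x j = (\<Sum>i<n. c i * Re ((adj (U * V) * A j * (U * V)) $$ (i, i)))" for j
    unfolding x conj_mult[OF A unitaryD(1)[OF U] unitaryD(1)[OF V]] ..
  then show "x \<in> diag_range n c A" unfolding diag_range_def using unitary_mult[OF U V] by blast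
qed

lemma diag_range_conj:
  fixes A :: "'m::finite \<Rightarrow> complex mat"
  assumes A: "\<And>j. A j \<in> carrier_mat n n" and U: "unitary_mat n U"
  shows "diag_range n c (\<lambda>j. adj U * A j * U) = diag_range n c A"
proof
  show "diag_range n c (\<lambda>j. adj U * A j * U) \<subseteq> diag_range n c A"
    by (rule diag_range_conj_subset[where A = A, OF A U])
  have B: "adj U * A j * U \<in> carrier_mat n n" for j using unitaryD(1)[OF U] A[of j] by auto
  show "diag_range n c A \<subseteq> diag_range n c (\<lambda>j. adj U * A j * U)"
    using diag_range_conj_subset[where A = "\<lambda>j. adj U * A j * U", OF B unitary_adj[OF U], of c]
      conj_cancel(1)[OF A U] by simp
qed

lemma trace_conj_real:
  assumes A: "A \<in> carrier_mat n n" and U: "unitary_mat n U"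
  shows "(\<Sum>i<n. Re ((adj U * A * U) $$ (i, i))) = (\<Sum>i<n. Re (A $$ (i, i)))"
proof -
  note UD = unitaryD[OF U]
  have "tr (adj U * A * U) = tr (U * (adj U * A))"
    using A UD(1) by (intro tr_mult_comm[of _ n n]) auto
  also have "\<dots> = tr A" using unitary_cancel(2)[OF U A] by simp
  finally have "Re (tr (adj U * A * U)) = Re (tr A)" by simp
  moreover have "adj U * A * U \<in> carrier_mat n n" using A UD(1) by auto
  ultimately show ?thesis using A by (simp add: tr_sum[of _ n] Re_sum)
qed

text \<open>The trace of \<open>A j\<close> is invariant under unitary conjugation, so a constant
  subtracted from all weights only translates the range. This leads from C - c_(k+1) I back to
  C.\<close>

lemma diag_range_shift:
  fixes A :: "'m::finite \<Rightarrow> complex mat"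
  assumes A: "\<And>j. A j \<in> carrier_mat n n"
  shows "diag_range n c A
    = (+) (vec_lambda (\<lambda>j. s * (\<Sum>i<n. Re (A j $$ (i, i))))) ` diag_range n (\<lambda>i. c i - s) A" (is "_ = (+) ?t ` _")
proof -
  have split: "(\<Sum>i<n. c i * Re ((adj U * A j * U) $$ (i, i)))
      = s * (\<Sum>i<n. Re (A j $$ (i, i))) + (\<Sum>i<n. (c i - s) * Re ((adj U * A j * U) $$ (i, i)))"
    if "unitary_mat n U" for U j
    unfolding trace_conj_real[OF A that, symmetric]
    by (simp add: sum_distrib_left sum.distrib[symmetric] algebra_simps)
  show ?thesis
  proof (intro Set.set_eqI iffI)
    fix x assume "x \<in> diag_range n c A"
    then obtain U where U: "unitary_mat n U"
      "\<And>j. vec_nth x j = (\<Sum>i<n. c i * Re ((adj U * A j * U) $$ (i, i)))" by (auto simp: diag_range_def)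
    then have "x - ?t \<in> diag_range n (\<lambda>i. c i - s) A"
      unfolding diag_range_def by (auto simp: split intro!: exI[of _ U])
    then show "x \<in> (+) ?t ` diag_range n (\<lambda>i. c i - s) A" by (intro image_eqI[of _ _ "x - ?t"]) auto
  next
    fix x assume "x \<in> (+) ?t ` diag_range n (\<lambda>i. c i - s) A"
    then obtain U where U: "unitary_mat n U"
      "\<And>j. vec_nth x j = s * (\<Sum>i<n. Re (A j $$ (i, i))) + (\<Sum>i<n. (c i - s) * Re ((adj U * A j * U) $$ (i, i)))"
      by (auto simp: diag_range_def)
    then show "x \<in> diag_range n c A" unfolding diag_range_def by (auto simp: split intro!: exI[of _ U])
  qed
qed

lemma diagonalizes_shift:
  assumes dec: "diagonalizes n Y C c"
  shows "diagonalizes n Y (C - complex_of_real s \<cdot>\<^sub>m 1\<^sub>m n) (\<lambda>i. c i - s)"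
proof -
  note Y = diagonalizesD[OF dec] and YD = unitaryD[OF diagonalizesD(1)[OF dec]]
  have s1: "complex_of_real s \<cdot>\<^sub>m 1\<^sub>m n \<in> carrier_mat n n" by simp
  have "adj Y * (C - complex_of_real s \<cdot>\<^sub>m 1\<^sub>m n) * Y
      = adj Y * C * Y - adj Y * (complex_of_real s \<cdot>\<^sub>m 1\<^sub>m n) * Y"
    unfolding mult_minus_distrib_mat[OF adj_carrier[OF Y(2)] Y(3) s1]
    by (rule minus_mult_distrib_mat[OF sq_mult[OF adj_carrier[OF Y(2)] Y(3)]
          sq_mult[OF adj_carrier[OF Y(2)] s1] Y(2)])
  also have "adj Y * (complex_of_real s \<cdot>\<^sub>m 1\<^sub>m n) * Y = complex_of_real s \<cdot>\<^sub>m 1\<^sub>m n"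
    using YD by (simp add: mult_smult_distrib[of _ n n _ n] mult_smult_assoc_mat[of _ n n _ n])
  also have "adj Y * C * Y - complex_of_real s \<cdot>\<^sub>m 1\<^sub>m n = rdiag n (\<lambda>i. c i - s)"
    unfolding Y(4) by (rule eq_matI) (auto simp: mat_diag_def)
  finally show ?thesis using Y(1,3) s1 by (simp add: diagonalizes_def minus_carrier_mat)
qed

section \<open>Gap indices\<close>

lemma gamma_sets_finite:
  "finite ({j. j \<in> {1..n - 1} \<and> 2 * j \<le> n \<and> eig C j > eig C (j + 1)} \<union>
    {n - j | j. j \<in> {1..n - 1} \<and> 2 * (n - j) \<le> n \<and> eig C j > eig C (j + 1)})"
  by (rule finite_subset[of _ "{..n}"]) auto

text \<open>A drop after some position j with k < j < n - k would contribute the smaller of j and n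
  - j to \<open>gamma\<close>, and both exceed k.\<close>

lemma gamma_le_flat:
  assumes C: "hermitian_mat n C" and g: "gamma n C \<le> k"
  shows "k \<le> i \<Longrightarrow> i < n - k \<Longrightarrow> eig C (Suc i) = eig C (Suc k)"
proof (induction i rule: dec_induct)
  case (step i)
  obtain Y where anti: "antitone n (\<lambda>i. eig C (Suc i))" using hermitian_eig[OF C] by blast
  have "\<not> eig C (Suc i) > eig C (Suc i + 1)"
  proof
    assume gap: "eig C (Suc i) > eig C (Suc i + 1)"
    have j: "Suc i \<in> {1..n - 1}" using step by auto
    show False
    proof (cases "2 * Suc i \<le> n")
      case True
      then have "Suc i \<le> gamma n C"
        unfolding gamma_def using j gap by (intro Max_ge gamma_sets_finite) blast
      then show False using g step by simp
    next
      case False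
      then have "n - Suc i \<le> gamma n C"
        unfolding gamma_def using j gap by (intro Max_ge gamma_sets_finite) auto
      then show False using g step by simp
    qed
  qed
  moreover have "eig C (Suc (Suc i)) \<le> eig C (Suc i)" using anti step by auto
  ultimately show ?case using step by simp
qed simp

text \<open>A non-scalar \<open>C\<close> has a drop, so the maximum in \<open>gamma\<close> is
  taken over a nonempty set and is attained. The alternatives stem from the two sets; negation
  exchanges them (\<open>polytope_hull_gap\<close>).\<close>

lemma gamma_gap:
  assumes C: "hermitian_mat n C" "\<not> scalar_mat n C" and g: "gamma n C = k"
  shows "eig C k > eig C (k + 1) \<or> eig C (n - k) > eig C (n - k + 1)"
proof -
  let ?S1 = "{j. j \<in> {1..n - 1} \<and> 2 * j \<le> n \<and> eig C j > eig C (j + 1)}"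
  let ?S2 = "{n - j | j. j \<in> {1..n - 1} \<and> 2 * (n - j) \<le> n \<and> eig C j > eig C (j + 1)}"
  obtain Y where Y: "diagonalizes n Y C (\<lambda>i. eig C (Suc i))" "antitone n (\<lambda>i. eig C (Suc i))"
    using hermitian_eig[OF C(1)] by blast
  have "\<exists>i. Suc i < n \<and> eig C (Suc (Suc i)) < eig C (Suc i)"
  proof (rule ccontr)
    assume neg: "\<not> ?thesis"
    have "eig C (Suc i) = eig C (Suc 0)" if "i < n" for i
      using that
    proof (induction i)
      case (Suc i)
      then have "eig C (Suc (Suc i)) \<le> eig C (Suc i)" using Y(2) by auto
      then show ?case using Suc neg by force
    qed simp
    then show False using constant_eig_scalar[OF Y(1)] C(2) by blast
  qed
  then obtain i where i: "Suc i < n" "eig C (Suc (Suc i)) < eig C (Suc i)" by blast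
  have j: "Suc i \<in> {1..n - 1}" "eig C (Suc i) > eig C (Suc i + 1)" using i by auto
  have "?S1 \<union> ?S2 \<noteq> {}"
  proof (cases "2 * Suc i \<le> n")
    case True
    then have "Suc i \<in> ?S1" using j by blast
    then show ?thesis by blast
  next
    case False
    then have "2 * (n - Suc i) \<le> n" by simp
    then have "n - Suc i \<in> ?S2" using j by blast
    then show ?thesis by blast
  qed
  then have "k \<in> ?S1 \<union> ?S2"
    using Max_in[OF gamma_sets_finite[of n C]] g unfolding gamma_def by blast
  then show ?thesis
  proof
    assume "k \<in> ?S2"
    then obtain j where "j \<in> {1..n - 1}" "k = n - j" "eig C j > eig C (j + 1)" by blast
    moreover from this have "n - k = j" by auto
    ultimately show ?thesis by simp
  qed blast
qed

section \<open>Block matrices and the indicator of the first k indices\<close>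

lemma diag_block_two:
  fixes D Q :: "complex mat"
  assumes D: "D \<in> carrier_mat l l" and Q: "Q \<in> carrier_mat r r"
  shows "diag_block_mat [D, Q] \<in> carrier_mat (l + r) (l + r)"
    "\<And>i j. i < l + r \<Longrightarrow> j < l + r \<Longrightarrow> diag_block_mat [D, Q] $$ (i, j)
      = (if i < l then if j < l then D $$ (i, j) else 0 else if j < l then 0 else Q $$ (i - l, j - l))"
proof -
  have eq: "diag_block_mat [D, Q] = four_block_mat D (0\<^sub>m l r) (0\<^sub>m r l) Q"
    unfolding diag_block_mat.simps(2)[of D] diag_block_mat_singleton Let_def using D Q by simp
  show "diag_block_mat [D, Q] \<in> carrier_mat (l + r) (l + r)"
    unfolding eq by (rule four_block_carrier_mat[OF D Q])
  show "diag_block_mat [D, Q] $$ (i, j)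
      = (if i < l then if j < l then D $$ (i, j) else 0 else if j < l then 0 else Q $$ (i - l, j - l))"
    if "i < l + r" "j < l + r" for i j
    unfolding eq using D Q that by (auto simp: index_mat_four_block)
qed

lemma indicator_block:
  assumes "k \<le> n"
  shows "diag_block_mat [1\<^sub>m k, 0\<^sub>m (n - k) (n - k)] = rdiag n (indic k)"
proof (rule eq_matI)
  note B = diag_block_two[OF one_carrier_mat[of k] zero_carrier_mat[of "n - k" "n - k"]]
  have kn: "k + (n - k) = n" using assms by simp
  note B' = B[unfolded kn]
  show "dim_row (diag_block_mat [1\<^sub>m k, 0\<^sub>m (n - k) (n - k)]) = dim_row (rdiag n (indic k))"
    "dim_col (diag_block_mat [1\<^sub>m k, 0\<^sub>m (n - k) (n - k)]) = dim_col (rdiag n (indic k))"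
    using carrier_matD[OF B'(1)] by (simp_all add: mat_diag_def)
  fix i j assume "i < dim_row (rdiag n (indic k))" "j < dim_col (rdiag n (indic k))"
  then have ij: "i < n" "j < n" by (auto simp: mat_diag_def)
  show "diag_block_mat [1\<^sub>m k, 0\<^sub>m (n - k) (n - k)] $$ (i, j) = rdiag n (indic k) $$ (i, j)"
    unfolding B'(2)[OF ij] using ij by (auto simp: mat_diag_def)
qed

lemma antitone_indic: "antitone n (indic k)"
  by auto

lemma eig_indicator:
  assumes "j \<in> {1..n}"
  shows "eig (rdiag n (indic k)) j = (if j \<le> k then 1 else 0)"
  using eig_diagonalizes[OF diagonalizes_rdiag antitone_indic, of "j - 1" n k] assms by auto

lemma gamma_indicator:
  assumes "1 \<le> k" "2 * k \<le> n"
  shows "gamma n (rdiag n (indic k)) = k"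
proof -
  let ?C = "rdiag n (indic k)"
  have gap: "eig ?C j > eig ?C (j + 1) \<longleftrightarrow> j = k" if "j \<in> {1..n - 1}" for j
    using that eig_indicator[of j n k] eig_indicator[of "j + 1" n k] by (auto split: if_splits)
  have "{j. j \<in> {1..n - 1} \<and> 2 * j \<le> n \<and> eig ?C j > eig ?C (j + 1)} = {k}"
    using gap assms by auto
  \<comment> \<open>Nonempty only for \<open>n = 2 * k\<close>, when \<open>n - k\<close> is
    \<open>k\<close> again.\<close>
  moreover have "{n - j | j. j \<in> {1..n - 1} \<and> 2 * (n - j) \<le> n \<and> eig ?C j > eig ?C (j + 1)} \<subseteq> {k}"
    using gap assms by auto
  ultimately have "({j. j \<in> {1..n - 1} \<and> 2 * j \<le> n \<and> eig ?C j > eig ?C (j + 1)} \<union>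
    {n - j | j. j \<in> {1..n - 1} \<and> 2 * (n - j) \<le> n \<and> eig ?C j > eig ?C (j + 1)}) = {k}" by auto
  then show ?thesis unfolding gamma_def by simp
qed

lemma indicator_not_scalar:
  assumes "1 \<le> k" "k < n"
  shows "\<not> scalar_mat n (rdiag n (indic k))"
proof
  assume "scalar_mat n (rdiag n (indic k))"
  then obtain a where a: "rdiag n (indic k) = a \<cdot>\<^sub>m 1\<^sub>m n" by (auto simp: scalar_mat_def)
  have "rdiag n (indic k) $$ (0, 0) = 1" "rdiag n (indic k) $$ (k, k) = 0" using assms by (auto simp: mat_diag_def)
  then show False unfolding a using assms by auto
qed

section \<open>From a polyhedral hull to the block structure\<close>

lemma diag_range_uminus:
  fixes A :: "'m::finite \<Rightarrow> complex mat"
  shows "diag_range n (\<lambda>i. - c i) A = uminus ` diag_range n c A"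
proof (intro Set.set_eqI iffI)
  fix x assume "x \<in> diag_range n (\<lambda>i. - c i) A"
  then have "- x \<in> diag_range n c A"
    unfolding diag_range_def by (auto simp: sum_negf)
  then show "x \<in> uminus ` diag_range n c A" by force
next
  fix x assume "x \<in> uminus ` diag_range n c A"
  then show "x \<in> diag_range n (\<lambda>i. - c i) A"
    unfolding diag_range_def by (auto simp: sum_negf)
qed

text \<open>If the drop sits at n - k, the weights are negated and reversed. This reflects the range
  in the origin, keeps the weights descending and moves the drop to k.\<close>

lemma polytope_hull_gap:
  fixes A :: "'m::finite \<Rightarrow> complex mat"
  assumes A: "\<And>j. hermitian_mat n (A j)" and k: "k \<in> {1..n div 2}"
    and C: "hermitian_mat n C" "\<not> scalar_mat n C" "gamma n C = k"
    and poly: "polytope (convex hull (joint_C_range C A))"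
  obtains c where "antitone n c" "c k < c (k - 1)" "polytope (convex hull (diag_range n c A))"
proof -
  have Ac: "A j \<in> carrier_mat n n" for j by (rule hermitianD(1)[OF A])
  define e where "e i = eig C (Suc i)" for i
  obtain Y where Y: "diagonalizes n Y C e" "antitone n e"
    using hermitian_eig[OF C(1)] unfolding e_def by blast
  have poly_e: "polytope (convex hull (diag_range n e A))"
    using poly joint_C_range_eq_diag_range[where A = A, OF Y(1) A] by simp
  have kn: "1 \<le> k" "2 * k \<le> n" using k by auto
  from gamma_gap[OF C] show ?thesis
  proof
    assume "eig C k > eig C (k + 1)"
    then have "e k < e (k - 1)" using kn by (simp add: e_def)
    then show ?thesis using that Y(2) poly_e by blast
  next
    assume gap: "eig C (n - k) > eig C (n - k + 1)"
    let ?c = "(\<lambda>i. - e i) \<circ> reversal n"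
    have "antitone n ?c" using Y(2) by (auto simp: reversal_def)
    moreover have "?c k < ?c (k - 1)"
    proof -
      have "reversal n k = n - Suc k" "reversal n (k - 1) = n - k" using kn by (auto simp: reversal_def)
      moreover have "Suc (n - Suc k) = n - k" using kn by simp
      ultimately show ?thesis using gap by (simp add: e_def)
    qed
    moreover have "diag_range n ?c A = uminus ` diag_range n e A"
      using diag_range_permute[where A = A, OF Ac reversal_permutes] diag_range_uminus[of n e A] by simp
    then have "convex hull (diag_range n ?c A) = uminus ` (convex hull (diag_range n e A))"
      by (simp add: convex_hull_linear_image linear_uminus)
    then have "polytope (convex hull (diag_range n ?c A))"
      using polytope_linear_image[OF linear_uminus poly_e] by simp
    ultimately show ?thesis using that by blast
  qed
qed

lemma polytope_structure:
  fixes A :: "'m::finite \<Rightarrow> complex mat"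
  assumes A: "\<And>j. hermitian_mat n (A j)" and k: "k \<in> {1..n div 2}"
    and c: "antitone n c" "c k < c (k - 1)" and poly: "polytope (convex hull (diag_range n c A))"
  obtains l U where "2 * k \<le> l" "l \<le> n" "unitary_mat n U" "\<And>j. diag_upto n l (adj U * A j * U)"
    "\<And>v. dominated_below n k l (pencil n (\<lambda>j. adj U * A j * U) v)"
proof -
  have Ac: "A j \<in> carrier_mat n n" for j by (rule hermitianD(1)[OF A])
  obtain l U where l: "l \<le> n" and U: "unitary_mat n U" and dg: "\<And>j. diag_upto n l (adj U * A j * U)"
    and nj: "\<And>x. \<not> joint_ev n l (\<lambda>j. adj U * A j * U) x"
    using joint_diag[of A n 0, OF Ac] by (auto simp: diag_upto_def)
  obtain T where T: "finite T" "convex hull (diag_range n c A) = convex hull T"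
    using poly unfolding polytope_def by blast
  interpret polyhedral_core n k l "\<lambda>j. adj U * A j * U" c T
  proof
    show "hermitian_mat n (adj U * A j * U)" for j by (rule hermitian_conj[OF A unitaryD(1)[OF U]])
    show "convex hull diag_range n c (\<lambda>j. adj U * A j * U) = convex hull T"
      using diag_range_conj[where A = A, OF Ac U] T(2) by simp
  qed (use l dg nj c k T in auto)
  show ?thesis
    using that[OF two_k_le l U dg dominated] .
qed

text \<open>Three inclusions close up: the range lies in the hull of the permutation points, this
  hull in the range of the diagonal block by Horn, and that range in the original one by padding.
  Interleaving is increasing on the first \<open>l\<close> indices, so \<open>c'\<close> inherits
  the order that Horn's theorem relies on.\<close>

lemma structure_range_eq:
  fixes B D :: "'m::finite \<Rightarrow> complex mat"
  assumes B: "\<And>j. hermitian_mat n (B j)" and dg: "\<And>j. diag_upto n l (B j)" and l: "2 * k \<le> l" "l \<le> n"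
    and dom: "\<And>v. dominated_below n k l (pencil n B v)"
    and D: "\<And>j. D j \<in> carrier_mat l l" "\<And>j p q. p < l \<Longrightarrow> q < l \<Longrightarrow> D j $$ (p, q) = B j $$ (p, q)"
    and c: "antitone n c" "\<And>i. k \<le> i \<Longrightarrow> i < n - k \<Longrightarrow> c i = 0"
    and c': "\<And>i. i < l \<Longrightarrow> c' i = c (interleave n l k i)"
  shows "diag_range n c B = diag_range l c' D" "diag_range n c B = convex hull (perm_points l c' D)"
proof -
  have dD: "diagonal_mat (D j)" for j
    unfolding diagonal_mat_def
  proof (intro allI impI)
    fix p q assume "p < dim_row (D j)" "q < dim_col (D j)" "p \<noteq> q"
    then have "p < l" "q < l" "p \<noteq> q" using D(1)[of j] by auto
    then show "D j $$ (p, q) = 0" using D(2) dg[of j] l by (auto simp: diag_upto_def)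
  qed
  have c'a: "antitone l c'"
  proof (intro allI impI)
    fix i j assume ij: "i \<le> j" "j < l"
    have "interleave n l k i \<le> interleave n l k j" "interleave n l k j < n"
      using ij l by (auto simp: interleave_def)
    then show "c' j \<le> c' i" using c' ij c(1) by auto
  qed
  have 1: "diag_range n c B \<subseteq> convex hull (perm_points l c' D)"
    by (rule diag_range_subset_hull[OF B dg l(2,1) dom c c']) (use D in auto)
  have 2: "convex hull (perm_points l c' D) \<subseteq> diag_range l c' D"
    by (rule hull_perm_points_subset[OF D(1) dD c'a])
  have 3: "diag_range l c' D \<subseteq> diag_range n c B"
    by (rule diag_range_block_subset[where A = B and D = D and c = c and c' = c', OF hermitianD(1)[OF B] l(2,1) c(2) c' D])
  show "diag_range n c B = diag_range l c' D" "diag_range n c B = convex hull (perm_points l c' D)"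
    using 1 2 3 by blast+
qed

lemma polytope_hull_perm_points: "polytope (convex hull (perm_points n c D))"
  unfolding polytope_def using finite_perm_points by blast

text \<open>This is \<open>structure_range_eq\<close> with \<open>n = l\<close>: no complementary
  block is left to dominate, \<open>lam\<close> may be any lower bound of the diagonal, and
  interleaving is the identity.\<close>

lemma diagonal_range_polytope:
  fixes D :: "'m::finite \<Rightarrow> complex mat"
  assumes D: "\<And>j. hermitian_mat l (D j)" "\<And>j. diagonal_mat (D j)" and k: "2 * k \<le> l"
  shows "polytope (diag_range l (indic k) D)"
proof -
  have Dc: "D j \<in> carrier_mat l l" for j by (rule hermitianD(1)[OF D(1)])
  have "dominated_below l k l (pencil l D v)" for v
  proof -
    obtain lam where lam: "\<And>i. i < l \<Longrightarrow> lam \<le> Re (pencil l D v $$ (i, i))"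
    proof
      fix i assume "i < l"
      then show "Min ((\<lambda>i. Re (pencil l D v $$ (i, i))) ` {..<l}) \<le> Re (pencil l D v $$ (i, i))" by simp
    qed
    then have "{i. i < l \<and> lam \<le> Re (pencil l D v $$ (i, i))} = {..<l}" by auto
    then have "k \<le> card {i. i < l \<and> lam \<le> Re (pencil l D v $$ (i, i))}" using k by simp
    moreover have "x = 0\<^sub>v l" if "x \<in> carrier_vec l" "\<forall>i<l. x $ i = 0" for x :: "complex vec"
      using that by (intro eq_vecI) auto
    ultimately show ?thesis unfolding dominated_below_def by blast
  qed
  moreover have "diag_upto l l (D j)" for j
    using D(2)[of j] Dc[of j] by (auto simp: diag_upto_def diagonal_mat_def)
  ultimately have "diag_range l (indic k) D = convex hull (perm_points l (indic k) D)"
    using k Dc by (intro structure_range_eq(2)[where k = k] D) (auto simp: interleave_def)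
  then show ?thesis using polytope_hull_perm_points by simp
qed

lemma diag_upto_block:
  assumes B: "hermitian_mat n B" and dg: "diag_upto n l B" and l: "l \<le> n"
  defines "D \<equiv> Matrix.mat l l (\<lambda>(p, q). B $$ (p, q))"
    and "Q \<equiv> Matrix.mat (n - l) (n - l) (\<lambda>(p, q). B $$ (p + l, q + l))"
  shows "D \<in> carrier_mat l l" "diagonal_mat D" "Q \<in> carrier_mat (n - l) (n - l)"
    "B = diag_block_mat [D, Q]" "hermitian_mat l D"
proof -
  show D: "D \<in> carrier_mat l l" and Q: "Q \<in> carrier_mat (n - l) (n - l)" by (simp_all add: D_def Q_def)
  show "diagonal_mat D"
    using dg l by (auto simp: diagonal_mat_def D_def diag_upto_def)
  have ln: "l + (n - l) = n" using l by simp
  note blk = diag_block_two[OF D Q, unfolded ln]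
  show "B = diag_block_mat [D, Q]"
  proof (rule eq_matI)
    fix i j assume "i < dim_row (diag_block_mat [D, Q])" "j < dim_col (diag_block_mat [D, Q])"
    then have ij: "i < n" "j < n" using carrier_matD[OF blk(1)] by auto
    show "B $$ (i, j) = diag_block_mat [D, Q] $$ (i, j)"
      unfolding blk(2)[OF ij] using ij dg hermitian_diag_upto_row[OF B dg l ij(2), of i]
      by (auto simp: D_def Q_def diag_upto_def)
  qed (use carrier_matD[OF blk(1)] hermitianD(1)[OF B] in auto)
  show "hermitian_mat l D"
  proof (rule hermitianI[OF D])
    fix i j assume "i < l" "j < l"
    moreover from this have "i < n" "j < n" using l by auto
    ultimately show "D $$ (j, i) = cnj (D $$ (i, j))"
      using hermitianD(3)[OF B, of i j] by (simp add: D_def)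
  qed
qed

lemma hermitian_block:
  assumes "hermitian_mat n (diag_block_mat [D, Q])" "D \<in> carrier_mat l l" "Q \<in> carrier_mat (n - l) (n - l)"
    and l: "l \<le> n"
  shows "hermitian_mat l D"
proof (rule hermitianI[OF assms(2)])
  fix i j assume ij: "i < l" "j < l"
  have ln: "l + (n - l) = n" using l by simp
  have ijn: "i < n" "j < n" using ij l by auto
  note blk = diag_block_two(2)[OF assms(2,3), unfolded ln]
  show "D $$ (j, i) = cnj (D $$ (i, j))"
    using hermitianD(3)[OF assms(1) ijn] unfolding blk[OF ijn] blk[OF ijn(2,1)] using ij by simp
qed

text \<open>For I_k + 0 the subtracted c_(k+1) is zero, and the entries taken from the lower end
  vanish because their index exceeds k. This is how (c) specializes to (b).\<close>

lemma C_hat_indicator: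
  assumes "1 \<le> k" "2 * k \<le> l" "l \<le> n"
  shows "C_hat n k l (rdiag n (indic k)) = rdiag l (indic k)"
  unfolding C_hat_def mat_diag_def[of l]
proof (rule cong_mat[OF refl refl])
  fix i j assume "i < l" "j < l"
  moreover have "eig (rdiag n (indic k)) (k + 1) = 0" using assms by (subst eig_indicator) auto
  moreover have "eig (rdiag n (indic k)) (j + 1 + n - l) = 0" if "\<not> j < k"
    using that \<open>j < l\<close> assms by (subst eig_indicator) auto
  moreover have "eig (rdiag n (indic k)) (j + 1) = 1" if "j < k"
    using that assms by (subst eig_indicator) auto
  ultimately show "(case (i, j) of (i, j) \<Rightarrow> if i = j
      then complex_of_real ((if j < k then eig (rdiag n (indic k)) (j + 1) else eig (rdiag n (indic k)) (j + 1 + n - l))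
        - eig (rdiag n (indic k)) (k + 1)) else 0)
    = (case (i, j) of (i, j) \<Rightarrow> if i = j then complex_of_real (indic k j) else 0)"
    by auto
qed

text \<open>After c_(k+1) is subtracted the weights vanish in the middle by
  \<open>gamma_le_flat\<close>, and interleaving lists the entries of \<open>C_hat\<close>. Assuming
  only \<open>gamma n C \<le> k\<close> serves (c) and (d) at once; undoing the shift is a
  translation and preserves polytopes.\<close>

lemma shifted_range_eq:
  fixes A :: "'m::finite \<Rightarrow> complex mat"
  assumes A: "\<And>j. hermitian_mat n (A j)" and k: "k \<in> {1..n div 2}" and l: "2 * k \<le> l" "l \<le> n"
    and U: "unitary_mat n U" and dg: "\<And>j. diag_upto n l (adj U * A j * U)"
    and dom: "\<And>v. dominated_below n k l (pencil n (\<lambda>j. adj U * A j * U) v)"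
    and D: "\<And>j. D j = Matrix.mat l l (\<lambda>(p, q). (adj U * A j * U) $$ (p, q))"
    and C: "hermitian_mat n C" "gamma n C \<le> k"
  shows "joint_C_range (C - complex_of_real (eig C (k + 1)) \<cdot>\<^sub>m 1\<^sub>m n) A = joint_C_range (C_hat n k l C) D"
    "polytope (joint_C_range C A)"
proof -
  have Ac: "A j \<in> carrier_mat n n" for j by (rule hermitianD(1)[OF A])
  define e where "e i = eig C (Suc i)" for i
  obtain Y where Y: "diagonalizes n Y C e" "antitone n e"
    using hermitian_eig[OF C(1)] unfolding e_def by blast
  define c where "c i = e i - e k" for i
  define c' where "c' i = (if i < k then eig C (i + 1) else eig C (i + 1 + n - l)) - eig C (k + 1)" for i
  let ?B = "\<lambda>j. adj U * A j * U"
  have B: "hermitian_mat n (?B j)" for j by (rule hermitian_conj[OF A unitaryD(1)[OF U]])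
  have Dh: "hermitian_mat l (D j)" for j unfolding D by (rule diag_upto_block(5)[OF B dg l(2)])
  have ca: "antitone n c" using Y(2) by (auto simp: c_def)
  have c0: "c i = 0" if "k \<le> i" "i < n - k" for i
    using gamma_le_flat[OF C that] by (simp add: c_def e_def)
  have c'c: "c' i = c (interleave n l k i)" if "i < l" for i
  proof -
    \<comment> \<open>The index in \<open>C_hat\<close> counts from 1 and is the successor of the
      \<open>interleave\<close> position, which counts from 0.\<close>
    have "i + 1 + n - l = Suc (i + (n - l))" using l by simp
    then show ?thesis using that by (simp add: c'_def c_def e_def interleave_def)
  qed
  have Dc: "D j \<in> carrier_mat l l" "p < l \<Longrightarrow> q < l \<Longrightarrow> D j $$ (p, q) = ?B j $$ (p, q)" for j p q
    by (simp_all add: D)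
  note eq = structure_range_eq[where B = ?B and D = D and c = c and c' = c', OF B dg l dom Dc ca c0 c'c]
  have conj: "diag_range n c ?B = diag_range n c A" by (rule diag_range_conj[OF Ac U])
  have ek: "eig C (k + 1) = e k" by (simp add: e_def)
  have "joint_C_range (C - complex_of_real (eig C (k + 1)) \<cdot>\<^sub>m 1\<^sub>m n) A = diag_range n c A"
    unfolding ek c_def by (rule joint_C_range_eq_diag_range[OF diagonalizes_shift[OF Y(1)] A])
  also have "\<dots> = diag_range l c' D" using eq(1) conj by simp
  also have "\<dots> = joint_C_range (C_hat n k l C) D"
    unfolding C_hat_def c'_def[symmetric]
    by (rule joint_C_range_eq_diag_range[symmetric, OF diagonalizes_rdiag Dh])
  finally show "joint_C_range (C - complex_of_real (eig C (k + 1)) \<cdot>\<^sub>m 1\<^sub>m n) A = joint_C_range (C_hat n k l C) D" .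
  have "polytope (diag_range n c A)" using eq(2) conj polytope_hull_perm_points by simp
  then have "polytope (diag_range n e A)"
    unfolding c_def diag_range_shift[where A = A and c = e and s = "e k", OF Ac]
    by (simp add: polytope_translation_eq)
  then show "polytope (joint_C_range C A)"
    using joint_C_range_eq_diag_range[where A = A, OF Y(1) A] by simp
qed

text \<open>From (a) one block structure is obtained that serves (c) and (d) simultaneously. The
  other implications use the test matrix I_k + 0, whose \<open>gamma\<close> is k: (c) at this
  matrix gives (b), the diagonal block in (b) makes its range a polytope and gives (a), and (d)
  covers it directly.\<close>

theorem theorem5p1:
  fixes n k :: nat and A :: "'m::finite \<Rightarrow> complex mat"
  assumes "\<And>j. hermitian_mat n (A j)"
    and "k \<in> {1..n div 2}"
  shows
    "let
       a = (\<exists>C. hermitian_mat n C \<and> \<not> scalar_mat n C \<and> gamma n C = k \<and>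
              (polytope (convex hull (joint_C_range C A)) \<or> polytope (joint_C_range C A)));
       b = (\<exists>l U D Q. 2 * k \<le> l \<and> l \<le> n \<and> unitary_mat n U \<and>
              (\<forall>j. D j \<in> carrier_mat l l \<and> diagonal_mat (D j) \<and>
                   Q j \<in> carrier_mat (n - l) (n - l) \<and>
                   mat_adjoint U * A j * U = diag_block_mat [D j, Q j]) \<and>
              joint_k_range n k A = joint_k_range l k D);
       c = (\<exists>l U D Q. 2 * k \<le> l \<and> l \<le> n \<and> unitary_mat n U \<and>
              (\<forall>j. D j \<in> carrier_mat l l \<and> diagonal_mat (D j) \<and>
                   Q j \<in> carrier_mat (n - l) (n - l) \<and>
                   mat_adjoint U * A j * U = diag_block_mat [D j, Q j]) \<and>
              (\<forall>C. hermitian_mat n C \<and> \<not> scalar_mat n C \<and> gamma n C = k \<longrightarrow>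
                   joint_C_range (C - complex_of_real (eig C (k + 1)) \<cdot>\<^sub>m 1\<^sub>m n) A =
                   joint_C_range (C_hat n k l C) D));
       d = (\<forall>C. hermitian_mat n C \<and> \<not> scalar_mat n C \<and> gamma n C \<le> k \<longrightarrow>
              polytope (joint_C_range C A))
     in (a \<longleftrightarrow> b) \<and> (b \<longleftrightarrow> c) \<and> (c \<longleftrightarrow> d)"
proof -
  note herm = assms(1) and k = assms(2)
  have kn: "1 \<le> k" "2 * k \<le> n" "k < n" "k \<le> n" using k by auto
  let ?C = "rdiag n (indic k)"
  have C: "hermitian_mat n ?C" "\<not> scalar_mat n ?C" "gamma n ?C = k"
    using indicator_not_scalar[OF kn(1,3)] gamma_indicator[OF kn(1,2)] by simp_all
  have k_range: "joint_k_range n k A = joint_C_range ?C A"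
    unfolding joint_k_range_def indicator_block[OF kn(4)] ..
  define a where "a = (\<exists>C. hermitian_mat n C \<and> \<not> scalar_mat n C \<and> gamma n C = k \<and>
              (polytope (convex hull (joint_C_range C A)) \<or> polytope (joint_C_range C A)))"
  define b where "b = (\<exists>l U D Q. 2 * k \<le> l \<and> l \<le> n \<and> unitary_mat n U \<and>
              (\<forall>j. D j \<in> carrier_mat l l \<and> diagonal_mat (D j) \<and>
                   Q j \<in> carrier_mat (n - l) (n - l) \<and>
                   mat_adjoint U * A j * U = diag_block_mat [D j, Q j]) \<and>
              joint_k_range n k A = joint_k_range l k D)"
  define c where "c = (\<exists>l U D Q. 2 * k \<le> l \<and> l \<le> n \<and> unitary_mat n U \<and>
              (\<forall>j. D j \<in> carrier_mat l l \<and> diagonal_mat (D j) \<and>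
                   Q j \<in> carrier_mat (n - l) (n - l) \<and>
                   mat_adjoint U * A j * U = diag_block_mat [D j, Q j]) \<and>
              (\<forall>C. hermitian_mat n C \<and> \<not> scalar_mat n C \<and> gamma n C = k \<longrightarrow>
                   joint_C_range (C - complex_of_real (eig C (k + 1)) \<cdot>\<^sub>m 1\<^sub>m n) A =
                   joint_C_range (C_hat n k l C) D))"
  define d where "d = (\<forall>C. hermitian_mat n C \<and> \<not> scalar_mat n C \<and> gamma n C \<le> k \<longrightarrow>
              polytope (joint_C_range C A))"
  have acd: "c \<and> d" if a
  proof -
    obtain C where C: "hermitian_mat n C" "\<not> scalar_mat n C" "gamma n C = k"
      and "polytope (convex hull (joint_C_range C A)) \<or> polytope (joint_C_range C A)"
      using \<open>a\<close> unfolding a_def by blast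
    \<comment> \<open>In the second case the range is itself convex, hence equal to its
      hull.\<close>
    then have "polytope (convex hull (joint_C_range C A))"
      by (metis convex_hull_eq polytope_imp_convex)
    then obtain c' where c': "antitone n c'" "c' k < c' (k - 1)" "polytope (convex hull (diag_range n c' A))"
      using polytope_hull_gap[where A = A, OF herm k C] by blast
    obtain l U where l: "2 * k \<le> l" "l \<le> n" and U: "unitary_mat n U"
      and dg: "\<And>j. diag_upto n l (adj U * A j * U)"
      and dom: "\<And>v. dominated_below n k l (pencil n (\<lambda>j. adj U * A j * U) v)"
      using polytope_structure[where A = A, OF herm k c'] by blast
    define D where "D j = Matrix.mat l l (\<lambda>(p, q). (adj U * A j * U) $$ (p, q))" for j
    define Q where "Q j = Matrix.mat (n - l) (n - l) (\<lambda>(p, q). (adj U * A j * U) $$ (p + l, q + l))" for j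
    have blk: "D j \<in> carrier_mat l l \<and> diagonal_mat (D j) \<and> Q j \<in> carrier_mat (n - l) (n - l) \<and>
        adj U * A j * U = diag_block_mat [D j, Q j]" for j
      unfolding D_def Q_def
      using diag_upto_block[OF hermitian_conj[OF herm unitaryD(1)[OF U]] dg l(2), of j] by blast
    note eq = shifted_range_eq[where A = A, OF herm k l U dg dom D_def]
    have "joint_C_range (C - complex_of_real (eig C (k + 1)) \<cdot>\<^sub>m 1\<^sub>m n) A = joint_C_range (C_hat n k l C) D"
      if "hermitian_mat n C" "gamma n C = k" for C using eq(1) that by simp
    then have c unfolding c_def using l U blk by blast
    moreover have d unfolding d_def using eq(2) by blast
    ultimately show ?thesis ..
  qed
  have cb: b if c
  proof -
    from \<open>c\<close> obtain l U D Q where l: "2 * k \<le> l" "l \<le> n" and U: "unitary_mat n U"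
      and blk: "\<forall>j. D j \<in> carrier_mat l l \<and> diagonal_mat (D j) \<and> Q j \<in> carrier_mat (n - l) (n - l) \<and>
        adj U * A j * U = diag_block_mat [D j, Q j]"
      and eq: "joint_C_range (?C - complex_of_real (eig ?C (k + 1)) \<cdot>\<^sub>m 1\<^sub>m n) A = joint_C_range (C_hat n k l ?C) D"
      unfolding c_def using C by blast
    \<comment> \<open>As \<open>k < n\<close>, the eigenvalue after the \<open>k\<close> ones exists
      and is 0, so the shift in (c) leaves the test matrix unchanged.\<close>
    have "eig ?C (k + 1) = 0" using kn by (subst eig_indicator) auto
    moreover have "?C - complex_of_real 0 \<cdot>\<^sub>m 1\<^sub>m n = ?C" by (rule eq_matI) (auto simp: mat_diag_def)
    moreover have "joint_k_range l k D = joint_C_range (rdiag l (indic k)) D"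
      unfolding joint_k_range_def using l by (subst indicator_block) auto
    ultimately have "joint_k_range n k A = joint_k_range l k D"
      using eq C_hat_indicator[OF kn(1) l] k_range by simp
    then show ?thesis unfolding b_def using l U blk by blast
  qed
  have ba: a if b
  proof -
    from \<open>b\<close> obtain l U D Q where l: "2 * k \<le> l" "l \<le> n" and U: "unitary_mat n U"
      and blk: "\<And>j. D j \<in> carrier_mat l l" "\<And>j. diagonal_mat (D j)" "\<And>j. Q j \<in> carrier_mat (n - l) (n - l)"
        "\<And>j. adj U * A j * U = diag_block_mat [D j, Q j]"
      and eq: "joint_k_range n k A = joint_k_range l k D"
      unfolding b_def by blast
    have D: "hermitian_mat l (D j)" for j
    proof -
      have "hermitian_mat n (diag_block_mat [D j, Q j])"
        unfolding blk(4)[symmetric] by (rule hermitian_conj[OF herm unitaryD(1)[OF U]])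
      then show ?thesis by (rule hermitian_block[OF _ blk(1,3) l(2)])
    qed
    have "joint_k_range l k D = diag_range l (indic k) D"
      unfolding joint_k_range_def using l joint_C_range_eq_diag_range[where A = D, OF diagonalizes_rdiag D]
      by (subst indicator_block) auto
    then have "polytope (joint_C_range ?C A)"
      using diagonal_range_polytope[where D = D, OF D blk(2) l(1)] eq k_range by simp
    then show ?thesis unfolding a_def using C by blast
  qed
  have da: a if d
  proof -
    have "polytope (joint_C_range ?C A)" using \<open>d\<close>[unfolded d_def, rule_format, of ?C] C by simp
    then show ?thesis unfolding a_def using C by blast
  qed
  have "(a \<longleftrightarrow> b) \<and> (b \<longleftrightarrow> c) \<and> (c \<longleftrightarrow> d)" using acd cb ba da by blast
  then show ?thesis unfolding a_def b_def c_def d_def Let_def .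
qed

end
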